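(* Let $(M^{2n+1},\theta,\xi,\eta,g)$ be a nearly cosymplectic manifold. Then its almost contact structure defines a harmonic map, and hence a harmonic section. That is, the first harmonic section equation $$[\bar\nabla^*\bar\nabla J,J]=0,$$ the second harmonic section equation $$\nabla^*\nabla\xi=|\nabla\xi|^2\,\xi-\tfrac12\,J\Big(\sum_{i=1}^{2n+1}(\bar\nabla_{E_i}J)(\nabla_{E_i}\xi)\Big),$$ and the harmonic map equation $$\sum_{i=1}^{2n+1}\langle\bar\nabla_{E_i}J,[\bar R(E_i,X),J]\rangle+8\sum_{i=1}^{2n+1}g(\nabla_{E_i}\xi,R(E_i,X)\xi)=0\qquad\text{for all }X\in TM$$ are all satisfied, where $\{E_i\}_{i=1,\dots,2n+1}$ is a local orthonormal frame of $TM$ of the form $\{F_i\}_{i=1,\dots,2n}\cup\{\xi\}$ with $\{F_i\}$ a local orthonormal frame of $\mathcal F$.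
   Context: An almost contact (metric) structure on a Riemannian manifold $(M^{2n+1},g)$ consists of a $(1,1)$-tensor $\theta$, a 1-form $\eta$ and a unit vector field $\xi$ with $\theta^2=-\mathrm{Id}+\eta\otimes\xi$, $\eta(\xi)=1$, compatible with the metric: $g(\theta X,\theta Y)=g(X,Y)-\eta(X)\eta(Y)$ (so $\eta=g(\xi,\cdot)$, $\theta\xi=0$ and $\theta$ is skew-symmetric). It is nearly cosymplectic, and $(M,\theta,\xi,\eta,g)$ is a nearly cosymplectic manifold, if $(\nabla_X\theta)(Y)+(\nabla_Y\theta)(X)=0$ for all $X,Y$, where $\nabla$ is the Levi-Civita connection of $g$. $\mathcal F$ is the distribution orthogonal to $\xi$ (rank $2n$), $J$ is the restriction of $\theta$ to $\mathcal F$, and $\bar\nabla$ is the connection on the vector bundle $\mathcal F\to M$ obtained by projecting $\nabla$ orthogonally onto $\mathcal F$; $(\bar\nabla_XJ)(Y)=\bar\nabla_X(JY)-J\bar\nabla_XY$ for $X\in TM$ and $Y$ a section of $\mathcal F$. Second covariant derivatives are $\nabla^2_{X,Y}=\nabla_X\nabla_Y-\nabla_{\nabla_XY}$ and $\bar\nabla^2_{X,Y}=\bar\nabla_X\bar\nabla_Y-\bar\nabla_{\nabla_XY}$, and $\nabla^*\nabla=-\mathrm{trace}\,\nabla^2$, $\bar\nabla^*\bar\nabla=-\mathrm{trace}\,\bar\nabla^2$ (traces over an orthonormal frame of $TM$). The curvature is $R(X,Y)=[\nabla_X,\nabla_Y]-\nabla_{[X,Y]}$, and $\bar R(X,Y)=[\bar\nabla_X,\bar\nabla_Y]-\bar\nabla_{[X,Y]}$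 is the curvature of $(\mathcal F,\bar\nabla)$. $[\cdot,\cdot]$ between endomorphisms is the commutator, $\langle A,B\rangle=\sum_{j=1}^{2n}g(AF_j,BF_j)$ for endomorphisms $A,B$ of $\mathcal F$, and $|\nabla\xi|^2=\sum_i|\nabla_{E_i}\xi|^2$. An almost contact structure is said to define a harmonic section if the first and second harmonic section equations hold, and a harmonic map if in addition the harmonic map equation holds. *)

theory Defs
  imports "HOL-Analysis.Analysis"
begin

section \<open>Smooth manifolds\<close>

primrec Ck_on :: "nat \<Rightarrow> 'e::euclidean_space set \<Rightarrow> ('e \<Rightarrow> 'b::real_normed_vector) \<Rightarrow> bool" where
  "Ck_on 0 S f \<longleftrightarrow> continuous_on S f"
| "Ck_on (Suc k) S f \<longleftrightarrow>
     (\<forall>x\<in>S. f differentiable (at x)) \<and> (\<forall>v. Ck_on k S (\<lambda>x. frechet_derivative f (at x) v))"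

text \<open>Only used for open \<^term>\<open>S\<close>.\<close>

definition smooth_on :: "'e::euclidean_space set \<Rightarrow> ('e \<Rightarrow> 'b::real_normed_vector) \<Rightarrow> bool" where
  "smooth_on S f \<longleftrightarrow> (\<forall>k. Ck_on k S f)"

text \<open>A chart is given by its domain and its coordinate map; the atlas need not be maximal. The
  dimension of the manifold is that of the model space \<^typ>\<open>'e\<close>.\<close>

record ('a, 'e) manifold =
  mtop :: "'a topology"
  atlas :: "('a set \<times> ('a \<Rightarrow> 'e)) set"

definition smooth_manifold :: "('a, 'e::euclidean_space) manifold \<Rightarrow> bool" where
  "smooth_manifold M \<longleftrightarrow>
     Hausdorff_space (mtop M) \<and> second_countable (mtop M) \<and>
     (\<Union>(U, \<phi>)\<in>atlas M. U) = topspace (mtop M) \<and>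
     (\<forall>(U, \<phi>)\<in>atlas M. openin (mtop M) U \<and> open (\<phi> ` U) \<and>
        homeomorphic_map (subtopology (mtop M) U) (top_of_set (\<phi> ` U)) \<phi>) \<and>
     (\<forall>(U, \<phi>)\<in>atlas M. \<forall>(V, \<psi>)\<in>atlas M. smooth_on (\<phi> ` (U \<inter> V)) (\<psi> \<circ> inv_into U \<phi>))"

text \<open>Real functions are total; \<^term>\<open>smooth_fun M W f\<close> only concerns the values of \<^term>\<open>f\<close> on the
  open set \<^term>\<open>W\<close>.\<close>

definition smooth_fun :: "('a, 'e::euclidean_space) manifold \<Rightarrow> 'a set \<Rightarrow> ('a \<Rightarrow> real) \<Rightarrow> bool" where
  "smooth_fun M W f \<longleftrightarrow> (\<forall>(U, \<phi>)\<in>atlas M. smooth_on (\<phi> ` (U \<inter> W)) (f \<circ> inv_into U \<phi>))"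

definition smooth_at :: "('a, 'e::euclidean_space) manifold \<Rightarrow> 'a \<Rightarrow> ('a \<Rightarrow> real) \<Rightarrow> bool" where
  "smooth_at M p f \<longleftrightarrow> (\<exists>W. openin (mtop M) W \<and> p \<in> W \<and> smooth_fun M W f)"


section \<open>Tangent vectors and vector fields\<close>

text \<open>The vector space of all functionals on real functions; the tangent spaces are subspaces.\<close>

typedef 'a functional = "UNIV :: (('a \<Rightarrow> real) \<Rightarrow> real) set"
  morphisms dapply Functional
  by simp

setup_lifting type_definition_functional

instantiation functional :: (type) real_vector
begin

lift_definition zero_functional :: "'a functional" is "\<lambda>f. 0" .
lift_definition plus_functional :: "'a functional \<Rightarrow> 'a functional \<Rightarrow> 'a functional"
  is "\<lambda>D D' f. D f + D' f" .
lift_definition minus_functional :: "'a functional \<Rightarrow> 'a functional \<Rightarrow> 'a functional"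
  is "\<lambda>D D' f. D f - D' f" .
lift_definition uminus_functional :: "'a functional \<Rightarrow> 'a functional"
  is "\<lambda>D f. - D f" .
lift_definition scaleR_functional :: "real \<Rightarrow> 'a functional \<Rightarrow> 'a functional"
  is "\<lambda>c D f. c * D f" .

instance
  by standard (transfer; simp add: fun_eq_iff algebra_simps)+

end

text \<open>\<^term>\<open>tangent_space M p\<close> consists of the derivations at \<^term>\<open>p\<close> of the algebra of germs of smooth
  functions. Since functionals are total, they are normalised to vanish on functions that are
  not smooth near \<^term>\<open>p\<close>.\<close>

definition tangent_space :: "('a, 'e::euclidean_space) manifold \<Rightarrow> 'a \<Rightarrow> 'a functional set" where
  "tangent_space M p = {D.
     (\<forall>f h. smooth_at M p f \<and> smooth_at M p h \<longrightarrow>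
        dapply D (\<lambda>q. f q + h q) = dapply D f + dapply D h \<and>
        dapply D (\<lambda>q. f q * h q) = f p * dapply D h + h p * dapply D f) \<and>
     (\<forall>f c. smooth_at M p f \<longrightarrow> dapply D (\<lambda>q. c * f q) = c * dapply D f) \<and>
     (\<forall>f h W. openin (mtop M) W \<and> p \<in> W \<and> smooth_fun M W f \<and> (\<forall>q\<in>W. f q = h q) \<longrightarrow>
        dapply D f = dapply D h) \<and>
     (\<forall>f. \<not> smooth_at M p f \<longrightarrow> dapply D f = 0)}"

type_synonym 'a field = "'a \<Rightarrow> 'a functional"

definition vector_field :: "('a, 'e::euclidean_space) manifold \<Rightarrow> 'a set \<Rightarrow> 'a field \<Rightarrow> bool" where
  "vector_field M U X \<longleftrightarrow>
     (\<forall>p\<in>U. X p \<in> tangent_space M p) \<and>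
     (\<forall>W f. openin (mtop M) W \<and> W \<subseteq> U \<and> smooth_fun M W f \<longrightarrow>
        smooth_fun M W (\<lambda>p. dapply (X p) f))"

text \<open>Smooth sections over \<^term>\<open>U\<close> of a distribution \<^term>\<open>B\<close>, i.e. of a family of subspaces of
  the tangent spaces.\<close>

definition smooth_section ::
  "('a, 'e::euclidean_space) manifold \<Rightarrow> ('a \<Rightarrow> 'a functional set) \<Rightarrow> 'a set \<Rightarrow> 'a field \<Rightarrow> bool" where
  "smooth_section M B U Z \<longleftrightarrow> vector_field M U Z \<and> (\<forall>p\<in>U. Z p \<in> B p)"

definition lie_bracket ::
  "('a, 'e::euclidean_space) manifold \<Rightarrow> 'a field \<Rightarrow> 'a field \<Rightarrow> 'a field" where
  "lie_bracket M X Y p = Functional (\<lambda>f. if smooth_at M p f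
     then dapply (X p) (\<lambda>q. dapply (Y q) f) - dapply (Y p) (\<lambda>q. dapply (X q) f) else 0)"


section \<open>Riemannian metrics and the Levi-Civita connection\<close>

definition lin_on :: "'v::real_vector set \<Rightarrow> ('v \<Rightarrow> 'w::real_vector) \<Rightarrow> bool" where
  "lin_on S f \<longleftrightarrow>
     (\<forall>u\<in>S. \<forall>v\<in>S. f (u + v) = f u + f v) \<and> (\<forall>u\<in>S. \<forall>c. f (c *\<^sub>R u) = c *\<^sub>R f u)"

type_synonym 'a metric = "'a \<Rightarrow> 'a functional \<Rightarrow> 'a functional \<Rightarrow> real"

definition riemannian_metric :: "('a, 'e::euclidean_space) manifold \<Rightarrow> 'a metric \<Rightarrow> bool" where
  "riemannian_metric M g \<longleftrightarrow>
     (\<forall>p\<in>topspace (mtop M). \<forall>u\<in>tangent_space M p.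
        lin_on (tangent_space M p) (g p u) \<and>
        (\<forall>v\<in>tangent_space M p. g p u v = g p v u) \<and>
        (u \<noteq> 0 \<longrightarrow> 0 < g p u u)) \<and>
     (\<forall>U X Y. openin (mtop M) U \<and> vector_field M U X \<and> vector_field M U Y \<longrightarrow>
        smooth_fun M U (\<lambda>p. g p (X p) (Y p)))"

text \<open>Connections act on vector fields defined on arbitrary open subsets (as is needed to
  differentiate local frames). The last clause makes them compatible with restriction, since a
  field on an open set is also a field on each smaller one.\<close>

type_synonym 'a connection = "'a field \<Rightarrow> 'a field \<Rightarrow> 'a field"

definition affine_connection :: "('a, 'e::euclidean_space) manifold \<Rightarrow> 'a connection \<Rightarrow> bool" where
  "affine_connection M nab \<longleftrightarrow>
     (\<forall>U X Y. openin (mtop M) U \<and> vector_field M U X \<and> vector_field M U Y \<longrightarrow>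
        vector_field M U (nab X Y) \<and>
        (\<forall>Z. vector_field M U Z \<longrightarrow> (\<forall>p\<in>U.
           nab (\<lambda>q. X q + Z q) Y p = nab X Y p + nab Z Y p \<and>
           nab X (\<lambda>q. Y q + Z q) p = nab X Y p + nab X Z p)) \<and>
        (\<forall>f. smooth_fun M U f \<longrightarrow> (\<forall>p\<in>U.
           nab (\<lambda>q. f q *\<^sub>R X q) Y p = f p *\<^sub>R nab X Y p \<and>
           nab X (\<lambda>q. f q *\<^sub>R Y q) p = dapply (X p) f *\<^sub>R Y p + f p *\<^sub>R nab X Y p)) \<and>
        (\<forall>X' Y'. (\<forall>q\<in>U. X' q = X q \<and> Y' q = Y q) \<longrightarrow> (\<forall>p\<in>U. nab X' Y' p = nab X Y p)))"

definition levi_civita ::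
  "('a, 'e::euclidean_space) manifold \<Rightarrow> 'a metric \<Rightarrow> 'a connection \<Rightarrow> bool" where
  "levi_civita M g nab \<longleftrightarrow> affine_connection M nab \<and>
     (\<forall>U X Y. openin (mtop M) U \<and> vector_field M U X \<and> vector_field M U Y \<longrightarrow>
        (\<forall>p\<in>U. nab X Y p - nab Y X p = lie_bracket M X Y p) \<and>
        (\<forall>Z. vector_field M U Z \<longrightarrow> (\<forall>p\<in>U.
           dapply (X p) (\<lambda>q. g q (Y q) (Z q)) = g p (nab X Y p) (Z p) + g p (Y p) (nab X Z p))))"

definition curvature ::
  "('a, 'e::euclidean_space) manifold \<Rightarrow> 'a connection \<Rightarrow> 'a field \<Rightarrow> 'a field \<Rightarrow> 'a field \<Rightarrow> 'a field" where
  "curvature M D X Y Z p = D X (D Y Z) p - D Y (D X Z) p - D (lie_bracket M X Y) Z p"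

definition orthonormal_frame ::
  "('a, 'e::euclidean_space) manifold \<Rightarrow> 'a metric \<Rightarrow> ('a \<Rightarrow> 'a functional set) \<Rightarrow>
     nat \<Rightarrow> 'a set \<Rightarrow> (nat \<Rightarrow> 'a field) \<Rightarrow> bool" where
  "orthonormal_frame M g B k U E \<longleftrightarrow>
     (\<forall>i<k. smooth_section M B U (E i)) \<and>
     (\<forall>p\<in>U. (\<forall>i<k. \<forall>j<k. g p (E i p) (E j p) = (if i = j then 1 else 0)) \<and>
             span ((\<lambda>i. E i p) ` {..<k}) = B p)"


section \<open>Nearly cosymplectic structures\<close>

definition almost_contact_metric ::
  "('a, 'e::euclidean_space) manifold \<Rightarrow> 'a metric \<Rightarrow> ('a \<Rightarrow> 'a functional \<Rightarrow> 'a functional) \<Rightarrow>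
     'a field \<Rightarrow> ('a \<Rightarrow> 'a functional \<Rightarrow> real) \<Rightarrow> bool" where
  "almost_contact_metric M g \<theta> \<xi> \<eta> \<longleftrightarrow>
     vector_field M (topspace (mtop M)) \<xi> \<and>
     (\<forall>p\<in>topspace (mtop M).
        lin_on (tangent_space M p) (\<eta> p) \<and>
        lin_on (tangent_space M p) (\<theta> p) \<and> \<theta> p ` tangent_space M p \<subseteq> tangent_space M p) \<and>
     (\<forall>U X. openin (mtop M) U \<and> vector_field M U X \<longrightarrow>
        smooth_fun M U (\<lambda>p. \<eta> p (X p)) \<and> vector_field M U (\<lambda>p. \<theta> p (X p))) \<and>
     (\<forall>p\<in>topspace (mtop M). g p (\<xi> p) (\<xi> p) = 1 \<and> \<eta> p (\<xi> p) = 1 \<and>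
        (\<forall>u\<in>tangent_space M p.
           \<theta> p (\<theta> p u) = - u + \<eta> p u *\<^sub>R \<xi> p \<and>
           (\<forall>v\<in>tangent_space M p. g p (\<theta> p u) (\<theta> p v) = g p u v - \<eta> p u * \<eta> p v)))"

text \<open>Sections of endomorphism bundles are represented by the operators they induce on (local)
  vector fields, and covariantly differentiated with respect to a connection \<^term>\<open>D\<close>.\<close>

type_synonym 'a op = "'a field \<Rightarrow> 'a field"

definition cov_End :: "'a connection \<Rightarrow> 'a field \<Rightarrow> 'a op \<Rightarrow> 'a op" where
  "cov_End D X A Z p = D X (A Z) p - A (D X Z) p"

definition op_commutator :: "'a op \<Rightarrow> 'a op \<Rightarrow> 'a op" where
  "op_commutator A B Z p = A (B Z) p - B (A Z) p"

definition nearly_cosymplectic ::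
  "('a, 'e::euclidean_space) manifold \<Rightarrow> 'a metric \<Rightarrow> 'a connection \<Rightarrow>
     ('a \<Rightarrow> 'a functional \<Rightarrow> 'a functional) \<Rightarrow> 'a field \<Rightarrow> ('a \<Rightarrow> 'a functional \<Rightarrow> real) \<Rightarrow> bool" where
  "nearly_cosymplectic M g nab \<theta> \<xi> \<eta> \<longleftrightarrow> almost_contact_metric M g \<theta> \<xi> \<eta> \<and>
     (\<forall>U X Y. openin (mtop M) U \<and> vector_field M U X \<and> vector_field M U Y \<longrightarrow>
        (\<forall>p\<in>U. cov_End nab X (\<lambda>Z q. \<theta> q (Z q)) Y p + cov_End nab Y (\<lambda>Z q. \<theta> q (Z q)) X p = 0))"

definition Fdist ::
  "('a, 'e::euclidean_space) manifold \<Rightarrow> 'a metric \<Rightarrow> 'a field \<Rightarrow> 'a \<Rightarrow> 'a functional set" where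
  "Fdist M g \<xi> p = {v \<in> tangent_space M p. g p (\<xi> p) v = 0}"

text \<open>The restriction of \<^term>\<open>\<theta>\<close> to \<open>\<F>\<close>, unspecified outside of \<open>\<F>\<close>.\<close>

definition Jtensor ::
  "('a, 'e::euclidean_space) manifold \<Rightarrow> 'a metric \<Rightarrow> ('a \<Rightarrow> 'a functional \<Rightarrow> 'a functional) \<Rightarrow>
     'a field \<Rightarrow> 'a \<Rightarrow> 'a functional \<Rightarrow> 'a functional" where
  "Jtensor M g \<theta> \<xi> p = restrict (\<theta> p) (Fdist M g \<xi> p)"

definition Jop ::
  "('a, 'e::euclidean_space) manifold \<Rightarrow> 'a metric \<Rightarrow> ('a \<Rightarrow> 'a functional \<Rightarrow> 'a functional) \<Rightarrow>
     'a field \<Rightarrow> 'a op" where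
  "Jop M g \<theta> \<xi> Z p = Jtensor M g \<theta> \<xi> p (Z p)"

text \<open>The orthogonal projection onto \<open>\<F>\<close> is \<open>v - g(v, \<xi>) \<xi>\<close>, because \<open>\<xi>\<close> has unit length.\<close>

definition nabla_bar :: "'a metric \<Rightarrow> 'a connection \<Rightarrow> 'a field \<Rightarrow> 'a connection" where
  "nabla_bar g nab \<xi> X Z p = nab X Z p - g p (nab X Z p) (\<xi> p) *\<^sub>R \<xi> p"


section \<open>Harmonic sections and harmonic maps\<close>

text \<open>Indices start at 0: \<open>E 0, \<dots>, E (2n - 1)\<close> is the frame of \<open>\<F>\<close> and \<open>E (2n) = \<xi>\<close>.\<close>

definition adapted_frame ::
  "('a, 'e::euclidean_space) manifold \<Rightarrow> 'a metric \<Rightarrow> 'a field \<Rightarrow>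
     nat \<Rightarrow> 'a set \<Rightarrow> (nat \<Rightarrow> 'a field) \<Rightarrow> bool" where
  "adapted_frame M g \<xi> n U E \<longleftrightarrow>
     orthonormal_frame M g (tangent_space M) (2 * n + 1) U E \<and>
     orthonormal_frame M g (Fdist M g \<xi>) (2 * n) U E \<and>
     (\<forall>p\<in>U. E (2 * n) p = \<xi> p)"

definition rough_laplacian :: "'a connection \<Rightarrow> nat \<Rightarrow> (nat \<Rightarrow> 'a field) \<Rightarrow> 'a op" where
  "rough_laplacian nab n E Z p =
     - (\<Sum>i<2 * n + 1. nab (E i) (nab (E i) Z) p - nab (nab (E i) (E i)) Z p)"

text \<open>The analogue for endomorphism fields \<^term>\<open>A\<close> of a subbundle with connection \<^term>\<open>D\<close>; the
  base is differentiated with the connection \<^term>\<open>nab\<close>.\<close>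

definition rough_laplacian_End ::
  "'a connection \<Rightarrow> 'a connection \<Rightarrow> nat \<Rightarrow> (nat \<Rightarrow> 'a field) \<Rightarrow> 'a op \<Rightarrow> 'a op" where
  "rough_laplacian_End nab D n E A Z p =
     - (\<Sum>i<2 * n + 1.
          cov_End D (E i) (cov_End D (E i) A) Z p - cov_End D (nab (E i) (E i)) A Z p)"

definition inner_End ::
  "'a metric \<Rightarrow> nat \<Rightarrow> (nat \<Rightarrow> 'a field) \<Rightarrow> 'a op \<Rightarrow> 'a op \<Rightarrow> 'a \<Rightarrow> real" where
  "inner_End g n E A B p = (\<Sum>j<2 * n. g p (A (E j) p) (B (E j) p))"

definition first_harmonic_section_eq ::
  "('a, 'e::euclidean_space) manifold \<Rightarrow> 'a metric \<Rightarrow> 'a connection \<Rightarrow>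
     ('a \<Rightarrow> 'a functional \<Rightarrow> 'a functional) \<Rightarrow> 'a field \<Rightarrow> nat \<Rightarrow> bool" where
  "first_harmonic_section_eq M g nab \<theta> \<xi> n \<longleftrightarrow>
     (\<forall>U E Z. openin (mtop M) U \<and> adapted_frame M g \<xi> n U E \<and>
          smooth_section M (Fdist M g \<xi>) U Z \<longrightarrow>
        (\<forall>p\<in>U. op_commutator
           (rough_laplacian_End nab (nabla_bar g nab \<xi>) n E (Jop M g \<theta> \<xi>)) (Jop M g \<theta> \<xi>) Z p = 0))"

definition second_harmonic_section_eq ::
  "('a, 'e::euclidean_space) manifold \<Rightarrow> 'a metric \<Rightarrow> 'a connection \<Rightarrow>
     ('a \<Rightarrow> 'a functional \<Rightarrow> 'a functional) \<Rightarrow> 'a field \<Rightarrow> nat \<Rightarrow> bool" where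
  "second_harmonic_section_eq M g nab \<theta> \<xi> n \<longleftrightarrow>
     (\<forall>U E. openin (mtop M) U \<and> adapted_frame M g \<xi> n U E \<longrightarrow>
        (\<forall>p\<in>U. rough_laplacian nab n E \<xi> p =
           (\<Sum>i<2 * n + 1. g p (nab (E i) \<xi> p) (nab (E i) \<xi> p)) *\<^sub>R \<xi> p
           - (1 / 2) *\<^sub>R Jtensor M g \<theta> \<xi> p
               (\<Sum>i<2 * n + 1.
                  cov_End (nabla_bar g nab \<xi>) (E i) (Jop M g \<theta> \<xi>) (nab (E i) \<xi>) p)))"

text \<open>Every tangent vector at a point of \<^term>\<open>U\<close> extends to a smooth field on \<^term>\<open>U\<close>, with constant
  coefficients in the frame, so the quantification over \<^term>\<open>X\<close> covers all tangent vectors.\<close>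

definition harmonic_map_eq ::
  "('a, 'e::euclidean_space) manifold \<Rightarrow> 'a metric \<Rightarrow> 'a connection \<Rightarrow>
     ('a \<Rightarrow> 'a functional \<Rightarrow> 'a functional) \<Rightarrow> 'a field \<Rightarrow> nat \<Rightarrow> bool" where
  "harmonic_map_eq M g nab \<theta> \<xi> n \<longleftrightarrow>
     (\<forall>U E X. openin (mtop M) U \<and> adapted_frame M g \<xi> n U E \<and> vector_field M U X \<longrightarrow>
        (\<forall>p\<in>U.
           (\<Sum>i<2 * n + 1. inner_End g n E
              (cov_End (nabla_bar g nab \<xi>) (E i) (Jop M g \<theta> \<xi>))
              (op_commutator (curvature M (nabla_bar g nab \<xi>) (E i) X) (Jop M g \<theta> \<xi>)) p)
           + 8 * (\<Sum>i<2 * n + 1. g p (nab (E i) \<xi> p) (curvature M nab (E i) X \<xi> p)) = 0))"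

definition defines_harmonic_section ::
  "('a, 'e::euclidean_space) manifold \<Rightarrow> 'a metric \<Rightarrow> 'a connection \<Rightarrow>
     ('a \<Rightarrow> 'a functional \<Rightarrow> 'a functional) \<Rightarrow> 'a field \<Rightarrow> nat \<Rightarrow> bool" where
  "defines_harmonic_section M g nab \<theta> \<xi> n \<longleftrightarrow>
     first_harmonic_section_eq M g nab \<theta> \<xi> n \<and> second_harmonic_section_eq M g nab \<theta> \<xi> n"

definition defines_harmonic_map ::
  "('a, 'e::euclidean_space) manifold \<Rightarrow> 'a metric \<Rightarrow> 'a connection \<Rightarrow>
     ('a \<Rightarrow> 'a functional \<Rightarrow> 'a functional) \<Rightarrow> 'a field \<Rightarrow> nat \<Rightarrow> bool" where
  "defines_harmonic_map M g nab \<theta> \<xi> n \<longleftrightarrow>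
     defines_harmonic_section M g nab \<theta> \<xi> n \<and> harmonic_map_eq M g nab \<theta> \<xi> n"

end

theory Submission
  imports Defs
begin

text \<open>Write \<open>h = \<nabla>\<xi>\<close>, \<open>\<alpha>(X,Y,Z) = g((\<nabla>\<^sub>X\<theta>)Y,Z)\<close> and \<open>N = \<nabla>h\<close>. Differentiating the structure equations shows that \<open>h\<close> is
  skew, kills \<open>\<xi>\<close> and anticommutes with \<open>\<theta>\<close>, and that \<open>\<nabla>\<^sup>2\<theta>\<close> is skew in its last three slots.
  Commuting \<open>\<nabla>\<^sub>\<xi>\<close> with \<open>\<nabla>\<^sub>X\<close> on \<open>\<theta>\<close> makes \<open>P(X,Y,Z) = g(N\<^sub>XY,\<theta>Z) - \<alpha>(X,hY,Z)\<close> totally skew; with the first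
  Bianchi identity for the Killing field \<open>\<xi>\<close> this forces \<open>\<alpha>(X,Y,hZ) = 0\<close> and \<open>g(N\<^sub>WX,Y) = 0\<close> for
  \<open>X,Y,Z\<close> orthogonal to \<open>\<xi>\<close>, which settles the second equation.

  The first equation reduces to the \<open>\<theta>\<close>-linearity of the trace of \<open>\<nabla>\<^sup>2\<theta>\<close> on the complement of \<open>\<xi>\<close>;
  computing this trace once by commuting derivatives and once by moving \<open>\<theta>\<close> between its slots expresses
  the defect as two different multiples of the same curvature trace. In the harmonic map equation the
  curvature is contracted with the 3-form \<open>g(J(\<nabla>\<^sub>XJ)Y,Z)\<close>, so it vanishes by the first Bianchi
  identity, and the remaining terms vanish by the identities for \<open>\<alpha>\<close> and \<open>N\<close>.\<close>

section \<open>Smooth functions and vector fields\<close>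

text \<open>The obstacle is that connections and their derivatives act on fields over an open set,
  while the argument is multilinear algebra at one point. The operators involved are therefore shown
  to be linear over the smooth functions on U, and the adapted frame, which lives on the same U,
  turns them into multilinear maps on the model space, where z = \<xi> is a basis vector and the
  equations become statements about traces. Commuting \<nabla> along \<xi> with another derivative
  pays off because \<xi> is a Killing field: the curvature R(\<xi>,X)Y that appears is -N_X Y, so no
  new unknown enters. The projected connection and its curvature differ from \<nabla> and R by terms
  quadratic in h. In the first equation they are harmless because h anticommutes with \<theta>, so
  that h^2 commutes with it; in the third because \<alpha> vanishes once an argument is a value of h
  and the others are orthogonal to \<xi>.\<close>

lemma Ck_on_cong:
  assumes "open S" "Ck_on k S f" "\<And>x. x \<in> S \<Longrightarrow> f x = g x"
  shows "Ck_on k S g"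
  using assms(2,3)
proof (induction k arbitrary: f g)
  case 0
  then show ?case by (simp cong: continuous_on_cong)
next
  case (Suc k)
  have d: "(g has_derivative frechet_derivative f (at x)) (at x)" if "x \<in> S" for x
  proof -
    have "(f has_derivative frechet_derivative f (at x)) (at x)"
      using Suc.prems that by (simp add: frechet_derivative_works)
    then show ?thesis
      using has_derivative_transform_within_open [OF _ \<open>open S\<close> that] Suc.prems(2) by blast
  qed
  have "Ck_on k S (\<lambda>x. frechet_derivative g (at x) v)" for v
  proof (rule Suc.IH [of "\<lambda>x. frechet_derivative f (at x) v"])
    show "Ck_on k S (\<lambda>x. frechet_derivative f (at x) v)"
      using Suc.prems by simp
    show "frechet_derivative f (at x) v = frechet_derivative g (at x) v" if "x \<in> S" for x
      using frechet_derivative_at [OF d [OF that]] by simp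
  qed
  then show ?case
    using d by (auto simp: differentiable_def)
qed

lemma Ck_on_subset:
  assumes "Ck_on k S f" "S' \<subseteq> S"
  shows "Ck_on k S' f"
  using assms by (induction k arbitrary: f) (auto intro: continuous_on_subset)

lemma Ck_on_Suc: "Ck_on (Suc k) S f \<Longrightarrow> Ck_on k S f"
proof (induction k arbitrary: f)
  case 0
  then show ?case
    by (auto simp: differentiable_at_withinI intro!: differentiable_imp_continuous_on simp: differentiable_on_def)
next
  case (Suc k)
  then show ?case by (meson Ck_on.simps(2))
qed

lemma Ck_on_const: "Ck_on k S (\<lambda>x. c)"
  by (induction k arbitrary: c) auto

lemma Ck_on_add:
  assumes "open S" "Ck_on k S f" "Ck_on k S g"
  shows "Ck_on k S (\<lambda>x. f x + g x)"
  using assms(2,3)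
proof (induction k arbitrary: f g)
  case 0
  then show ?case by (simp add: continuous_on_add)
next
  case (Suc k)
  have d: "frechet_derivative (\<lambda>x. f x + g x) (at x)
      = (\<lambda>v. frechet_derivative f (at x) v + frechet_derivative g (at x) v)" if "x \<in> S" for x
    using Suc.prems that
    by (intro frechet_derivative_at [symmetric] has_derivative_add) (simp_all add: frechet_derivative_works)
  have "Ck_on k S (\<lambda>x. frechet_derivative (\<lambda>x. f x + g x) (at x) v)" for v
    by (rule Ck_on_cong [OF \<open>open S\<close> Suc.IH [of "\<lambda>x. frechet_derivative f (at x) v" "\<lambda>x. frechet_derivative g (at x) v"]])
      (use Suc.prems in \<open>simp_all add: d\<close>)
  then show ?case
    using Suc.prems by simp
qed

lemma Ck_on_mult:
  fixes f g :: "'e::euclidean_space \<Rightarrow> real"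
  assumes "open S" "Ck_on k S f" "Ck_on k S g"
  shows "Ck_on k S (\<lambda>x. f x * g x)"
  using assms(2,3)
proof (induction k arbitrary: f g)
  case 0
  then show ?case by (simp add: continuous_on_mult)
next
  case (Suc k)
  have d: "frechet_derivative (\<lambda>x. f x * g x) (at x)
      = (\<lambda>v. f x * frechet_derivative g (at x) v + frechet_derivative f (at x) v * g x)" if "x \<in> S" for x
    using Suc.prems that
    by (intro frechet_derivative_at [symmetric] has_derivative_mult) (simp_all add: frechet_derivative_works)
  have "Ck_on k S (\<lambda>x. frechet_derivative (\<lambda>x. f x * g x) (at x) v)" for v
    by (rule Ck_on_cong [OF \<open>open S\<close> Ck_on_add [OF \<open>open S\<close> Suc.IH Suc.IH]])
      (use Suc.prems Ck_on_Suc in \<open>auto simp: d\<close>)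
  then show ?case
    using Suc.prems by simp
qed

section \<open>Smooth functions and derivations on a manifold\<close>

locale manifold_calculus =
  fixes M :: "('a, 'e::euclidean_space) manifold"
  assumes smooth_manifold: "smooth_manifold M"
begin

lemma chart_open:
  assumes "(V, \<phi>) \<in> atlas M" "openin (mtop M) W"
  shows "open (\<phi> ` (V \<inter> W))"
proof -
  from smooth_manifold assms(1) have V: "openin (mtop M) V" "open (\<phi> ` V)"
      "homeomorphic_map (subtopology (mtop M) V) (top_of_set (\<phi> ` V)) \<phi>"
    unfolding smooth_manifold_def by auto
  have "openin (subtopology (mtop M) V) (V \<inter> W)"
    using assms(2) by (auto simp: openin_subtopology)
  then have "openin (top_of_set (\<phi> ` V)) (\<phi> ` (V \<inter> W))"
    using V(3) homeomorphic_imp_open_map open_map_def by blast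
  then show ?thesis
    using V(2) openin_open_eq by blast
qed

lemma inv_chart:
  assumes "(V, \<phi>) \<in> atlas M" "openin (mtop M) W" "x \<in> \<phi> ` (V \<inter> W)"
  shows "inv_into V \<phi> x \<in> W"
proof -
  from smooth_manifold assms(1) have V: "openin (mtop M) V"
      "homeomorphic_map (subtopology (mtop M) V) (top_of_set (\<phi> ` V)) \<phi>"
    unfolding smooth_manifold_def by auto
  then have "inj_on \<phi> V"
    using homeomorphic_imp_injective_map [OF V(2)] openin_subset [OF V(1)] by (simp add: inf.absorb2)
  then show ?thesis
    using assms(3) by (auto simp: inv_into_f_f)
qed

lemma smooth_fun_iff:
  "smooth_fun M W f \<longleftrightarrow>
    (\<forall>V \<phi> k. (V, \<phi>) \<in> atlas M \<longrightarrow> Ck_on k (\<phi> ` (V \<inter> W)) (\<lambda>x. f (inv_into V \<phi> x)))"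
  unfolding smooth_fun_def smooth_on_def o_def by auto

lemma smooth_fun_cong:
  assumes "openin (mtop M) W" "smooth_fun M W f" "\<And>q. q \<in> W \<Longrightarrow> f q = f' q"
  shows "smooth_fun M W f'"
  unfolding smooth_fun_iff
proof (intro allI impI)
  fix V \<phi> k assume V: "(V, \<phi>) \<in> atlas M"
  then have "Ck_on k (\<phi> ` (V \<inter> W)) (\<lambda>x. f (inv_into V \<phi> x))"
    using assms(2) unfolding smooth_fun_iff by blast
  then show "Ck_on k (\<phi> ` (V \<inter> W)) (\<lambda>x. f' (inv_into V \<phi> x))"
    by (rule Ck_on_cong [OF chart_open [OF V assms(1)]]) (simp add: assms(3) inv_chart [OF V assms(1)])
qed

lemma smooth_fun_subset: "smooth_fun M W f \<Longrightarrow> W' \<subseteq> W \<Longrightarrow> smooth_fun M W' f"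
  unfolding smooth_fun_iff by (meson Ck_on_subset Int_mono image_mono order_refl)

lemma smooth_fun_const: "smooth_fun M W (\<lambda>q. c)"
  unfolding smooth_fun_iff by (simp add: Ck_on_const)

lemma smooth_fun_add:
  "openin (mtop M) W \<Longrightarrow> smooth_fun M W f \<Longrightarrow> smooth_fun M W f' \<Longrightarrow> smooth_fun M W (\<lambda>q. f q + f' q)"
  unfolding smooth_fun_iff by (simp add: Ck_on_add chart_open)

lemma smooth_fun_mult:
  "openin (mtop M) W \<Longrightarrow> smooth_fun M W f \<Longrightarrow> smooth_fun M W f' \<Longrightarrow> smooth_fun M W (\<lambda>q. f q * f' q)"
  unfolding smooth_fun_iff by (simp add: Ck_on_mult chart_open)

lemma smooth_fun_diff:
  "openin (mtop M) W \<Longrightarrow> smooth_fun M W f \<Longrightarrow> smooth_fun M W f' \<Longrightarrow> smooth_fun M W (\<lambda>q. f q - f' q)"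
  using smooth_fun_add [of W f "\<lambda>q. - 1 * f' q"] smooth_fun_mult [OF _ smooth_fun_const [of W "- 1"], of f']
  by simp

lemma smooth_fun_at: "openin (mtop M) W \<Longrightarrow> smooth_fun M W f \<Longrightarrow> p \<in> W \<Longrightarrow> smooth_at M p f"
  unfolding smooth_at_def by blast

lemma dapply_simps [simp]:
  "dapply (D + D') f = dapply D f + dapply D' f"
  "dapply (D - D') f = dapply D f - dapply D' f"
  "dapply (- D) f = - dapply D f"
  "dapply (c *\<^sub>R D) f = c * dapply D f"
  "dapply 0 f = 0"
  by (simp_all add: plus_functional.rep_eq minus_functional.rep_eq uminus_functional.rep_eq
      scaleR_functional.rep_eq zero_functional.rep_eq)

lemma functional_eqI: "(\<And>f. dapply D f = dapply D' f) \<Longrightarrow> D = D'"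
  using dapply_inject by blast

lemma tangent_space_0: "0 \<in> tangent_space M p"
  unfolding tangent_space_def by simp

lemma tangent_space_add: "u \<in> tangent_space M p \<Longrightarrow> v \<in> tangent_space M p \<Longrightarrow> u + v \<in> tangent_space M p"
  unfolding tangent_space_def
  by (simp add: distrib_left distrib_right)

lemma tangent_space_scale: "u \<in> tangent_space M p \<Longrightarrow> c *\<^sub>R u \<in> tangent_space M p"
  unfolding tangent_space_def
  by (simp add: algebra_simps)

lemma tangent_space_neg: "u \<in> tangent_space M p \<Longrightarrow> - u \<in> tangent_space M p"
  using tangent_space_scale [of u p "- 1"] by simp

lemma tangent_space_diff: "u \<in> tangent_space M p \<Longrightarrow> v \<in> tangent_space M p \<Longrightarrow> u - v \<in> tangent_space M p"
  using tangent_space_add [of u p "- v"] tangent_space_neg by simp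

lemma tangent_space_sum:
  "(\<And>i. i \<in> I \<Longrightarrow> u i \<in> tangent_space M p) \<Longrightarrow> sum u I \<in> tangent_space M p"
  by (induction I rule: infinite_finite_induct) (auto simp: tangent_space_0 tangent_space_add)

lemma deriv_add:
  "D \<in> tangent_space M p \<Longrightarrow> smooth_at M p f \<Longrightarrow> smooth_at M p f'
    \<Longrightarrow> dapply D (\<lambda>q. f q + f' q) = dapply D f + dapply D f'"
  unfolding tangent_space_def by blast

lemma deriv_mult:
  "D \<in> tangent_space M p \<Longrightarrow> smooth_at M p f \<Longrightarrow> smooth_at M p f'
    \<Longrightarrow> dapply D (\<lambda>q. f q * f' q) = f p * dapply D f' + f' p * dapply D f"
  unfolding tangent_space_def by blast

lemma deriv_scale:
  "D \<in> tangent_space M p \<Longrightarrow> smooth_at M p f \<Longrightarrow> dapply D (\<lambda>q. c * f q) = c * dapply D f"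
  unfolding tangent_space_def by blast

lemma deriv_cong:
  assumes "D \<in> tangent_space M p" "openin (mtop M) W" "p \<in> W" "smooth_fun M W f"
    and "\<And>q. q \<in> W \<Longrightarrow> f q = f' q"
  shows "dapply D f = dapply D f'"
proof -
  have "\<forall>f h W. openin (mtop M) W \<and> p \<in> W \<and> smooth_fun M W f \<and> (\<forall>q\<in>W. f q = h q) \<longrightarrow>
      dapply D f = dapply D h"
    using assms(1) unfolding tangent_space_def mem_Collect_eq by (elim conjE)
  from spec [OF spec [OF spec [OF this, of f], of f'], of W] show ?thesis
    using assms(2-) by blast
qed

lemma deriv_const:
  assumes "D \<in> tangent_space M p" "p \<in> topspace (mtop M)"
  shows "dapply D (\<lambda>q. c) = 0"
proof -
  have s: "smooth_at M p (\<lambda>q. c)" for c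
    using smooth_fun_at [OF openin_topspace smooth_fun_const assms(2)] .
  have "dapply D (\<lambda>q. 1 * 1) = 1 * dapply D (\<lambda>q. 1) + 1 * dapply D (\<lambda>q. 1)"
    using deriv_mult [OF assms(1) s s] .
  then have "dapply D (\<lambda>q. 1) = 0"
    by simp
  then show ?thesis
    using deriv_scale [OF assms(1) s, of c 1] by simp
qed

lemma deriv_diff:
  assumes "D \<in> tangent_space M p" "smooth_at M p f" "smooth_at M p f'"
  shows "dapply D (\<lambda>q. f q - f' q) = dapply D f - dapply D f'"
proof -
  obtain W where W: "openin (mtop M) W" "p \<in> W" "smooth_fun M W f'"
    using assms(3) unfolding smooth_at_def by blast
  have "smooth_at M p (\<lambda>q. - 1 * f' q)"
    by (rule smooth_fun_at [OF W(1) smooth_fun_mult [OF W(1) smooth_fun_const W(3)] W(2)])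
  from deriv_add [OF assms(1,2) this] deriv_scale [OF assms(1,3), of "- 1"] show ?thesis
    by simp
qed

end

locale smooth_domain = manifold_calculus M for M :: "('a, 'e::euclidean_space) manifold" +
  fixes U :: "'a set"
  assumes open_U: "openin (mtop M) U"
begin

abbreviation VF where "VF \<equiv> vector_field M U"
abbreviation SF where "SF \<equiv> smooth_fun M U"

lemma U_topspace: "p \<in> U \<Longrightarrow> p \<in> topspace (mtop M)"
  using open_U openin_subset by blast

lemma VF_tangent: "VF X \<Longrightarrow> p \<in> U \<Longrightarrow> X p \<in> tangent_space M p"
  unfolding vector_field_def by blast

lemma VF_smooth:
  "VF X \<Longrightarrow> openin (mtop M) W \<Longrightarrow> W \<subseteq> U \<Longrightarrow> smooth_fun M W f \<Longrightarrow> smooth_fun M W (\<lambda>p. dapply (X p) f)"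
  unfolding vector_field_def by blast

lemma VF_deriv: "VF X \<Longrightarrow> SF f \<Longrightarrow> SF (\<lambda>p. dapply (X p) f)"
  by (rule VF_smooth [OF _ open_U order_refl])

lemma VF_0: "VF (\<lambda>q. 0)"
  unfolding vector_field_def by (simp add: tangent_space_0 smooth_fun_const)

lemma VF_add: "VF X \<Longrightarrow> VF Y \<Longrightarrow> VF (\<lambda>q. X q + Y q)"
  unfolding vector_field_def by (simp add: tangent_space_add smooth_fun_add)

lemma VF_scale: "SF f \<Longrightarrow> VF X \<Longrightarrow> VF (\<lambda>q. f q *\<^sub>R X q)"
  unfolding vector_field_def
  by (simp add: tangent_space_scale) (metis smooth_fun_mult smooth_fun_subset)

lemma VF_neg: "VF X \<Longrightarrow> VF (\<lambda>q. - X q)"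
  using VF_scale [OF smooth_fun_const, of X "- 1"] by simp

lemma VF_diff: "VF X \<Longrightarrow> VF Y \<Longrightarrow> VF (\<lambda>q. X q - Y q)"
  using VF_add [OF _ VF_neg, of X Y] by simp

lemma VF_sum: "(\<And>i. i \<in> I \<Longrightarrow> VF (X i)) \<Longrightarrow> VF (\<lambda>q. \<Sum>i\<in>I. X i q)"
  by (induction I rule: infinite_finite_induct) (auto simp: VF_0 VF_add)

lemma VF_cong:
  assumes X: "VF X" and eq: "\<And>q. q \<in> U \<Longrightarrow> X q = Y q"
  shows "VF Y"
  unfolding vector_field_def
proof (intro conjI ballI allI impI)
  fix p assume "p \<in> U"
  then show "Y p \<in> tangent_space M p"
    using VF_tangent [OF X] eq by metis
next
  fix W f assume W: "openin (mtop M) W \<and> W \<subseteq> U \<and> smooth_fun M W f"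
  show "smooth_fun M W (\<lambda>p. dapply (Y p) f)"
    by (rule smooth_fun_cong [of _ "\<lambda>p. dapply (X p) f"]) (use W VF_smooth [OF X] eq in auto)
qed

lemma SF_at: "SF f \<Longrightarrow> p \<in> U \<Longrightarrow> smooth_at M p f"
  by (rule smooth_fun_at [OF open_U])

lemma VF_deriv_add:
  "VF X \<Longrightarrow> SF f \<Longrightarrow> SF f' \<Longrightarrow> p \<in> U \<Longrightarrow> dapply (X p) (\<lambda>q. f q + f' q) = dapply (X p) f + dapply (X p) f'"
  by (rule deriv_add [OF VF_tangent [of X p] SF_at SF_at])

lemma VF_deriv_cong:
  "VF X \<Longrightarrow> SF f \<Longrightarrow> p \<in> U \<Longrightarrow> (\<And>q. q \<in> U \<Longrightarrow> f q = f' q) \<Longrightarrow> dapply (X p) f = dapply (X p) f'"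
  by (rule deriv_cong [OF VF_tangent [of X p] open_U])

lemma VF_deriv_const: "VF X \<Longrightarrow> p \<in> U \<Longrightarrow> dapply (X p) (\<lambda>q. c) = 0"
  by (rule deriv_const [OF VF_tangent [of X p] U_topspace])

lemma dapply_lie_bracket:
  "dapply (lie_bracket M X Y p) f = (if smooth_at M p f
     then dapply (X p) (\<lambda>q. dapply (Y q) f) - dapply (Y p) (\<lambda>q. dapply (X q) f) else 0)"
  unfolding lie_bracket_def by (simp add: Functional_inverse)

lemma lie_bracket_jacobi:
  assumes X: "VF X" and Y: "VF Y" and Z: "VF Z" and p: "p \<in> U"
  shows "lie_bracket M X (lie_bracket M Y Z) p + lie_bracket M Y (lie_bracket M Z X) p
    + lie_bracket M Z (lie_bracket M X Y) p = 0"
proof (rule functional_eqI)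
  fix f
  have *: "dapply (lie_bracket M X (lie_bracket M Y Z) p) f
      = dapply (X p) (\<lambda>q. dapply (Y q) (\<lambda>r. dapply (Z r) f)) - dapply (X p) (\<lambda>q. dapply (Z q) (\<lambda>r. dapply (Y r) f))
        - (dapply (Y p) (\<lambda>q. dapply (Z q) (\<lambda>r. dapply (X r) f)) - dapply (Z p) (\<lambda>q. dapply (Y q) (\<lambda>r. dapply (X r) f)))"
    if X: "VF X" and Y: "VF Y" and Z: "VF Z" and f: "smooth_at M p f" for X Y Z
  proof -
    \<comment> \<open>Brackets take the default value 0 on functions that are not smooth at the
      point, so the expansion into iterated derivatives is made on a neighbourhood where f is
      smooth.\<close>
    obtain W0 where "openin (mtop M) W0" "p \<in> W0" "smooth_fun M W0 f"
      using f unfolding smooth_at_def by blast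
    define W where "W = W0 \<inter> U"
    have W: "openin (mtop M) W" "p \<in> W" "smooth_fun M W f" "W \<subseteq> U"
      using \<open>openin (mtop M) W0\<close> \<open>p \<in> W0\<close> smooth_fun_subset [OF \<open>smooth_fun M W0 f\<close>] open_U p
      unfolding W_def by (simp_all add: openin_Int)
    note s = VF_smooth [OF _ W(1,4)]
    have at: "smooth_at M q h" if "q \<in> W" "smooth_fun M W h" for q h
      by (rule smooth_fun_at [OF W(1) that(2,1)])
    have YZ: "smooth_fun M W (\<lambda>q. dapply (Y q) (\<lambda>r. dapply (Z r) f))"
        "smooth_fun M W (\<lambda>q. dapply (Z q) (\<lambda>r. dapply (Y r) f))"
      by (rule s [OF Y s [OF Z W(3)]], rule s [OF Z s [OF Y W(3)]])
    have "dapply (X p) (\<lambda>q. dapply (lie_bracket M Y Z q) f)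
        = dapply (X p) (\<lambda>q. dapply (Y q) (\<lambda>r. dapply (Z r) f) - dapply (Z q) (\<lambda>r. dapply (Y r) f))"
      by (rule sym, rule deriv_cong [OF VF_tangent [OF X p] W(1,2) smooth_fun_diff [OF W(1) YZ]])
        (simp add: dapply_lie_bracket at W)
    also have "\<dots> = dapply (X p) (\<lambda>q. dapply (Y q) (\<lambda>r. dapply (Z r) f)) - dapply (X p) (\<lambda>q. dapply (Z q) (\<lambda>r. dapply (Y r) f))"
      by (rule deriv_diff [OF VF_tangent [OF X p] at [OF W(2) YZ(1)] at [OF W(2) YZ(2)]])
    finally show ?thesis
      using f at [OF W(2) s [OF X W(3)]] by (simp add: dapply_lie_bracket)
  qed
  show "dapply (lie_bracket M X (lie_bracket M Y Z) p + lie_bracket M Y (lie_bracket M Z X) p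
    + lie_bracket M Z (lie_bracket M X Y) p) f = dapply 0 f"
  proof (cases "smooth_at M p f")
    case True
    then show ?thesis
      by (simp add: * X Y Z)
  qed (simp add: dapply_lie_bracket)
qed

end

section \<open>Tensorial operators and the Levi-Civita connection\<close>

locale levi_civita_domain = smooth_domain M U
  for M :: "('a, 'e::euclidean_space) manifold" and U +
  fixes g :: "'a metric" and nab :: "'a connection"
  assumes metric: "riemannian_metric M g" and lc: "levi_civita M g nab"
begin

abbreviation TS where "TS p \<equiv> tangent_space M p"

lemmas tangent_intros = tangent_space_0 tangent_space_add tangent_space_scale tangent_space_neg
  tangent_space_diff

lemma g_lin: "p \<in> U \<Longrightarrow> u \<in> TS p \<Longrightarrow> lin_on (TS p) (g p u)"
  and g_sym: "p \<in> U \<Longrightarrow> u \<in> TS p \<Longrightarrow> v \<in> TS p \<Longrightarrow> g p u v = g p v u"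
  and g_pos: "p \<in> U \<Longrightarrow> u \<in> TS p \<Longrightarrow> u \<noteq> 0 \<Longrightarrow> 0 < g p u u"
  using metric U_topspace unfolding riemannian_metric_def by blast+

lemma g_SF: "VF X \<Longrightarrow> VF Y \<Longrightarrow> SF (\<lambda>q. g q (X q) (Y q))"
  by (rule metric [unfolded riemannian_metric_def, THEN conjunct2, THEN spec [of _ U],
      THEN spec [of _ X], THEN spec [of _ Y], THEN mp]) (simp add: open_U)

lemma g_add_right: "p \<in> U \<Longrightarrow> u \<in> TS p \<Longrightarrow> v \<in> TS p \<Longrightarrow> w \<in> TS p \<Longrightarrow> g p u (v + w) = g p u v + g p u w"
  and g_scale_right: "p \<in> U \<Longrightarrow> u \<in> TS p \<Longrightarrow> v \<in> TS p \<Longrightarrow> g p u (c *\<^sub>R v) = c * g p u v"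
  using g_lin unfolding lin_on_def by auto

lemma g_add_left: "p \<in> U \<Longrightarrow> u \<in> TS p \<Longrightarrow> v \<in> TS p \<Longrightarrow> w \<in> TS p \<Longrightarrow> g p (u + v) w = g p u w + g p v w"
  by (simp add: g_sym [of p _ w] g_add_right tangent_intros)

lemma g_scale_left: "p \<in> U \<Longrightarrow> u \<in> TS p \<Longrightarrow> v \<in> TS p \<Longrightarrow> g p (c *\<^sub>R u) v = c * g p u v"
  by (simp add: g_sym [of p _ v] g_scale_right tangent_intros)

lemma g_neg_right: "p \<in> U \<Longrightarrow> u \<in> TS p \<Longrightarrow> v \<in> TS p \<Longrightarrow> g p u (- v) = - g p u v"
  using g_scale_right [of p u v "- 1"] by simp

lemma g_neg_left: "p \<in> U \<Longrightarrow> u \<in> TS p \<Longrightarrow> v \<in> TS p \<Longrightarrow> g p (- u) v = - g p u v"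
  using g_scale_left [of p u v "- 1"] by simp

lemma g_diff_right: "p \<in> U \<Longrightarrow> u \<in> TS p \<Longrightarrow> v \<in> TS p \<Longrightarrow> w \<in> TS p \<Longrightarrow> g p u (v - w) = g p u v - g p u w"
  using g_add_right [of p u v "- w"] g_neg_right [of p u w] by (simp add: tangent_intros)

lemma g_diff_left: "p \<in> U \<Longrightarrow> u \<in> TS p \<Longrightarrow> v \<in> TS p \<Longrightarrow> w \<in> TS p \<Longrightarrow> g p (u - v) w = g p u w - g p v w"
  using g_add_left [of p u "- v" w] g_neg_left [of p v w] by (simp add: tangent_intros)

lemma g_0_right: "p \<in> U \<Longrightarrow> u \<in> TS p \<Longrightarrow> g p u 0 = 0"
  using g_scale_right [of p u 0 0] by (simp add: tangent_intros)

lemma g_0_left: "p \<in> U \<Longrightarrow> u \<in> TS p \<Longrightarrow> g p 0 u = 0"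
  using g_scale_left [of p 0 u 0] by (simp add: tangent_intros)

lemmas g_simps = g_add_left g_add_right g_scale_left g_scale_right g_neg_left g_neg_right
  g_diff_left g_diff_right g_0_left g_0_right

lemma g_sum_right:
  "p \<in> U \<Longrightarrow> u \<in> TS p \<Longrightarrow> (\<And>i. i \<in> I \<Longrightarrow> v i \<in> TS p) \<Longrightarrow> g p u (\<Sum>i\<in>I. v i) = (\<Sum>i\<in>I. g p u (v i))"
  by (induction I rule: infinite_finite_induct) (auto simp: g_simps tangent_space_sum)

lemma g_sum_left:
  "p \<in> U \<Longrightarrow> u \<in> TS p \<Longrightarrow> (\<And>i. i \<in> I \<Longrightarrow> v i \<in> TS p) \<Longrightarrow> g p (\<Sum>i\<in>I. v i) u = (\<Sum>i\<in>I. g p (v i) u)"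
  by (induction I rule: infinite_finite_induct) (auto simp: g_simps tangent_space_sum)

lemma connection: "affine_connection M nab"
  using lc unfolding levi_civita_def by blast

lemma connection_on_U:
  assumes "VF X" "VF Y"
  shows "VF (nab X Y) \<and>
    (\<forall>Z. VF Z \<longrightarrow> (\<forall>p\<in>U.
       nab (\<lambda>q. X q + Z q) Y p = nab X Y p + nab Z Y p \<and>
       nab X (\<lambda>q. Y q + Z q) p = nab X Y p + nab X Z p)) \<and>
    (\<forall>f. SF f \<longrightarrow> (\<forall>p\<in>U.
       nab (\<lambda>q. f q *\<^sub>R X q) Y p = f p *\<^sub>R nab X Y p \<and>
       nab X (\<lambda>q. f q *\<^sub>R Y q) p = dapply (X p) f *\<^sub>R Y p + f p *\<^sub>R nab X Y p)) \<and>
    (\<forall>X' Y'. (\<forall>q\<in>U. X' q = X q \<and> Y' q = Y q) \<longrightarrow> (\<forall>p\<in>U. nab X' Y' p = nab X Y p))"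
  by (rule connection [unfolded affine_connection_def, THEN spec [of _ U], THEN spec [of _ X],
      THEN spec [of _ Y], THEN mp]) (simp add: open_U assms)

lemma nab_VF: "VF X \<Longrightarrow> VF Y \<Longrightarrow> VF (nab X Y)"
  by (rule connection_on_U [THEN conjunct1])

lemma nab_add1: "VF X \<Longrightarrow> VF Y \<Longrightarrow> VF Z \<Longrightarrow> p \<in> U \<Longrightarrow> nab (\<lambda>q. X q + Z q) Y p = nab X Y p + nab Z Y p"
  and nab_add2: "VF X \<Longrightarrow> VF Y \<Longrightarrow> VF Z \<Longrightarrow> p \<in> U \<Longrightarrow> nab X (\<lambda>q. Y q + Z q) p = nab X Y p + nab X Z p"
  using connection_on_U [THEN conjunct2, THEN conjunct1, THEN spec [of _ Z]] by simp_all

lemma nab_scale1: "VF X \<Longrightarrow> VF Y \<Longrightarrow> SF f \<Longrightarrow> p \<in> U \<Longrightarrow> nab (\<lambda>q. f q *\<^sub>R X q) Y p = f p *\<^sub>R nab X Y p"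
  and nab_scale2: "VF X \<Longrightarrow> VF Y \<Longrightarrow> SF f \<Longrightarrow> p \<in> U \<Longrightarrow>
    nab X (\<lambda>q. f q *\<^sub>R Y q) p = dapply (X p) f *\<^sub>R Y p + f p *\<^sub>R nab X Y p"
  using connection_on_U [THEN conjunct2, THEN conjunct2, THEN conjunct1, THEN spec [of _ f]] by simp_all

lemma nab_cong:
  assumes "VF X" "VF Y" "p \<in> U"
    and "\<And>q. q \<in> U \<Longrightarrow> X' q = X q" "\<And>q. q \<in> U \<Longrightarrow> Y' q = Y q"
  shows "nab X' Y' p = nab X Y p"
  using connection_on_U [OF assms(1,2), THEN conjunct2, THEN conjunct2, THEN conjunct2,
      THEN spec [of _ X'], THEN spec [of _ Y']] assms(3-) by simp

lemma nab_cong2: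
  assumes "VF X" "VF Y" "p \<in> U" "\<And>q. q \<in> U \<Longrightarrow> Y' q = Y q"
  shows "nab X Y' p = nab X Y p"
  using assms by (intro nab_cong) auto

lemma nab_0: "VF X \<Longrightarrow> p \<in> U \<Longrightarrow> nab X (\<lambda>q. 0) p = 0"
  using nab_add2 [of X "\<lambda>q. 0" "\<lambda>q. 0" p] by (simp add: VF_0)

lemma nab_neg1: "VF X \<Longrightarrow> VF Y \<Longrightarrow> p \<in> U \<Longrightarrow> nab (\<lambda>q. - X q) Y p = - nab X Y p"
  using nab_scale1 [OF _ _ smooth_fun_const, of X Y p "- 1"] by simp

lemma nab_neg2: "VF X \<Longrightarrow> VF Y \<Longrightarrow> p \<in> U \<Longrightarrow> nab X (\<lambda>q. - Y q) p = - nab X Y p"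
  using nab_scale2 [OF _ _ smooth_fun_const, of X Y p "- 1"] by (simp add: VF_deriv_const)

lemma nab_diff1: "VF X \<Longrightarrow> VF Y \<Longrightarrow> VF Z \<Longrightarrow> p \<in> U \<Longrightarrow> nab (\<lambda>q. X q - Z q) Y p = nab X Y p - nab Z Y p"
  using nab_add1 [of X Y "\<lambda>q. - Z q" p] by (simp add: VF_neg nab_neg1)

lemma nab_diff2: "VF X \<Longrightarrow> VF Y \<Longrightarrow> VF Z \<Longrightarrow> p \<in> U \<Longrightarrow> nab X (\<lambda>q. Y q - Z q) p = nab X Y p - nab X Z p"
  using nab_add2 [of X Y "\<lambda>q. - Z q" p] by (simp add: VF_neg nab_neg2)

lemma torsion_free_metric:
  assumes "VF X" "VF Y"
  shows "(\<forall>p\<in>U. nab X Y p - nab Y X p = lie_bracket M X Y p) \<and>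
    (\<forall>Z. VF Z \<longrightarrow> (\<forall>p\<in>U.
       dapply (X p) (\<lambda>q. g q (Y q) (Z q)) = g p (nab X Y p) (Z p) + g p (Y p) (nab X Z p)))"
  by (rule lc [unfolded levi_civita_def, THEN conjunct2, THEN spec [of _ U], THEN spec [of _ X],
      THEN spec [of _ Y], THEN mp]) (simp add: open_U assms)

lemma torsion_free: "VF X \<Longrightarrow> VF Y \<Longrightarrow> p \<in> U \<Longrightarrow> lie_bracket M X Y p = nab X Y p - nab Y X p"
  using torsion_free_metric by simp

lemma nab_metric:
  "VF X \<Longrightarrow> VF Y \<Longrightarrow> VF Z \<Longrightarrow> p \<in> U \<Longrightarrow>
    dapply (X p) (\<lambda>q. g q (Y q) (Z q)) = g p (nab X Y p) (Z p) + g p (Y p) (nab X Z p)"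
  using torsion_free_metric by simp

lemma VF_lie_bracket: "VF X \<Longrightarrow> VF Y \<Longrightarrow> VF (lie_bracket M X Y)"
  by (rule VF_cong [OF VF_diff [OF nab_VF nab_VF]]) (auto simp: torsion_free)

lemmas VF_intros = VF_0 VF_add VF_scale VF_neg VF_diff nab_VF g_SF VF_lie_bracket smooth_fun_const

lemma nab_lie_bracket:
  assumes "VF X" "VF Y" "VF Z" "p \<in> U"
  shows "nab (lie_bracket M X Y) Z p = nab (nab X Y) Z p - nab (nab Y X) Z p"
proof -
  have "nab (lie_bracket M X Y) Z p = nab (\<lambda>q. nab X Y q - nab Y X q) Z p"
    using assms by (intro nab_cong) (auto simp: VF_intros torsion_free)
  then show ?thesis
    using assms by (simp add: nab_diff1 VF_intros)
qed

text \<open>Linearity over the smooth functions on U. The last clause is there because fields are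
  total functions: without it the operator could depend on values outside U.\<close>

definition tensorial :: "('a field \<Rightarrow> 'a field) \<Rightarrow> bool" where
  "tensorial H \<longleftrightarrow> (\<forall>X. VF X \<longrightarrow> VF (H X)) \<and>
     (\<forall>p\<in>U. (\<forall>X Y. VF X \<and> VF Y \<longrightarrow> H (\<lambda>q. X q + Y q) p = H X p + H Y p) \<and>
        (\<forall>f X. SF f \<and> VF X \<longrightarrow> H (\<lambda>q. f q *\<^sub>R X q) p = f p *\<^sub>R H X p) \<and>
        (\<forall>X Y. VF X \<and> (\<forall>q\<in>U. Y q = X q) \<longrightarrow> H Y p = H X p))"

lemma tensorialI:
  assumes "\<And>X. VF X \<Longrightarrow> VF (H X)"
    and "\<And>X Y p. VF X \<Longrightarrow> VF Y \<Longrightarrow> p \<in> U \<Longrightarrow> H (\<lambda>q. X q + Y q) p = H X p + H Y p"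
    and "\<And>f X p. SF f \<Longrightarrow> VF X \<Longrightarrow> p \<in> U \<Longrightarrow> H (\<lambda>q. f q *\<^sub>R X q) p = f p *\<^sub>R H X p"
    and "\<And>X Y p. VF X \<Longrightarrow> (\<And>q. q \<in> U \<Longrightarrow> Y q = X q) \<Longrightarrow> p \<in> U \<Longrightarrow> H Y p = H X p"
  shows "tensorial H"
  unfolding tensorial_def by (intro conjI ballI allI impI) (simp_all add: assms)

lemma tensorial_VF: "tensorial H \<Longrightarrow> VF X \<Longrightarrow> VF (H X)"
  unfolding tensorial_def by simp

lemma tensorial_add:
  "tensorial H \<Longrightarrow> VF X \<Longrightarrow> VF Y \<Longrightarrow> p \<in> U \<Longrightarrow> H (\<lambda>q. X q + Y q) p = H X p + H Y p"
  unfolding tensorial_def by simp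

lemma tensorial_scale:
  "tensorial H \<Longrightarrow> SF f \<Longrightarrow> VF X \<Longrightarrow> p \<in> U \<Longrightarrow> H (\<lambda>q. f q *\<^sub>R X q) p = f p *\<^sub>R H X p"
  unfolding tensorial_def by simp

lemma tensorial_cong:
  assumes "tensorial H" "VF X" "p \<in> U" "\<And>q. q \<in> U \<Longrightarrow> Y q = X q"
  shows "H Y p = H X p"
proof -
  have "\<forall>X Y. VF X \<and> (\<forall>q\<in>U. Y q = X q) \<longrightarrow> H Y p = H X p"
    using assms(1,3) unfolding tensorial_def by blast
  from spec [OF spec [OF this, of X], of Y] show ?thesis
    using assms by blast
qed

lemma tensorial_0: "tensorial H \<Longrightarrow> p \<in> U \<Longrightarrow> H (\<lambda>q. 0) p = 0"
  using tensorial_add [of H "\<lambda>q. 0" "\<lambda>q. 0" p] by (simp add: VF_0)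

lemma tensorial_sum:
  assumes "tensorial H" "p \<in> U" "\<And>i. i \<in> I \<Longrightarrow> VF (X i)"
  shows "H (\<lambda>q. \<Sum>i\<in>I. X i q) p = (\<Sum>i\<in>I. H (X i) p)"
  using assms(3)
  by (induction I rule: infinite_finite_induct)
    (simp_all add: tensorial_0 [OF assms(1,2)] tensorial_add [OF assms(1)] assms(2) VF_sum)

lemma tensorial_diff_op:
  assumes H: "tensorial H" and H': "tensorial H'"
  shows "tensorial (\<lambda>X q. H X q - H' X q)"
proof (rule tensorialI)
  show "H Y p - H' Y p = H X p - H' X p" if "VF X" "\<And>q. q \<in> U \<Longrightarrow> Y q = X q" "p \<in> U" for X Y p
    using tensorial_cong [OF H that(1,3,2)] tensorial_cong [OF H' that(1,3,2)] by simp
qed (simp_all add: VF_diff tensorial_VF [OF H] tensorial_VF [OF H'] tensorial_add [OF H] tensorial_add [OF H']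
    tensorial_scale [OF H] tensorial_scale [OF H'] scaleR_diff_right)

lemma tensorial_comp:
  assumes H: "tensorial H" and H': "tensorial H'"
  shows "tensorial (\<lambda>X. H (H' X))"
proof (rule tensorialI)
  fix X Y p assume X: "VF X" and Y: "VF Y" and p: "p \<in> U"
  have "H (H' (\<lambda>q. X q + Y q)) p = H (\<lambda>q. H' X q + H' Y q) p"
    using X Y p by (intro tensorial_cong [OF H]) (simp_all add: tensorial_VF [OF H'] tensorial_add [OF H'] VF_intros)
  then show "H (H' (\<lambda>q. X q + Y q)) p = H (H' X) p + H (H' Y) p"
    using X Y p by (simp add: tensorial_VF [OF H'] tensorial_add [OF H])
next
  fix f X p assume f: "SF f" and X: "VF X" and p: "p \<in> U"
  have "H (H' (\<lambda>q. f q *\<^sub>R X q)) p = H (\<lambda>q. f q *\<^sub>R H' X q) p"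
    using X f p by (intro tensorial_cong [OF H]) (simp_all add: tensorial_VF [OF H'] tensorial_scale [OF H'] VF_intros)
  then show "H (H' (\<lambda>q. f q *\<^sub>R X q)) p = f p *\<^sub>R H (H' X) p"
    using X f p by (simp add: tensorial_VF [OF H'] tensorial_scale [OF H])
next
  fix X Y p assume X: "VF X" and p: "p \<in> U" and eq: "\<And>q. q \<in> U \<Longrightarrow> Y q = X q"
  show "H (H' Y) p = H (H' X) p"
    by (rule tensorial_cong [OF H tensorial_VF [OF H' X] p]) (rule tensorial_cong [OF H' X _ eq])
qed (simp add: tensorial_VF [OF H'] tensorial_VF [OF H])

lemma tensorial_nab: "VF Z \<Longrightarrow> tensorial (\<lambda>X. nab X Z)"
  by (rule tensorialI) (auto simp: nab_VF nab_add1 nab_scale1 intro: nab_cong)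

lemma cov_End_VF: "tensorial H \<Longrightarrow> VF W \<Longrightarrow> VF X \<Longrightarrow> VF (cov_End nab W H X)"
proof -
  assume "tensorial H" "VF W" "VF X"
  then have "VF (\<lambda>p. nab W (H X) p - H (nab W X) p)"
    by (intro VF_diff nab_VF tensorial_VF [of H])
  then show ?thesis
    by (simp add: cov_End_def [abs_def])
qed

text \<open>The derivative of a factor f multiplies the same vector \<open>H X p\<close> in both
  terms of the difference and cancels.\<close>

lemma tensorial_cov_End:
  assumes H: "tensorial H" and W: "VF W"
  shows "tensorial (cov_End nab W H)"
proof (rule tensorialI)
  fix X Y p assume X: "VF X" and Y: "VF Y" and p: "p \<in> U"
  have "nab W (H (\<lambda>q. X q + Y q)) p = nab W (\<lambda>q. H X q + H Y q) p"
    using X Y p W by (intro nab_cong2) (simp_all add: tensorial_VF [OF H] tensorial_add [OF H] VF_intros)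
  moreover have "H (nab W (\<lambda>q. X q + Y q)) p = H (\<lambda>q. nab W X q + nab W Y q) p"
    using X Y p W by (intro tensorial_cong [OF H]) (simp_all add: nab_add2 VF_intros)
  ultimately show "cov_End nab W H (\<lambda>q. X q + Y q) p = cov_End nab W H X p + cov_End nab W H Y p"
    using X Y p W by (simp add: cov_End_def nab_add2 tensorial_add [OF H] tensorial_VF [OF H] VF_intros)
next
  fix f X p assume f: "SF f" and X: "VF X" and p: "p \<in> U"
  have "nab W (H (\<lambda>q. f q *\<^sub>R X q)) p = nab W (\<lambda>q. f q *\<^sub>R H X q) p"
    using X f p W by (intro nab_cong2) (simp_all add: tensorial_VF [OF H] tensorial_scale [OF H] VF_intros)
  moreover have "H (nab W (\<lambda>q. f q *\<^sub>R X q)) p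
      = H (\<lambda>q. dapply (W q) f *\<^sub>R X q + f q *\<^sub>R nab W X q) p"
    using X f p W by (intro tensorial_cong [OF H]) (simp_all add: nab_scale2 VF_intros VF_deriv)
  moreover have "\<dots> = dapply (W p) f *\<^sub>R H X p + f p *\<^sub>R H (nab W X) p"
    using X f p W by (simp add: tensorial_add [OF H] tensorial_scale [OF H] VF_intros VF_deriv)
  ultimately show "cov_End nab W H (\<lambda>q. f q *\<^sub>R X q) p = f p *\<^sub>R cov_End nab W H X p"
    using X f p W by (simp add: cov_End_def nab_scale2 tensorial_VF [OF H] scaleR_diff_right)
next
  fix X Y p assume X: "VF X" and p: "p \<in> U" and eq: "\<And>q. q \<in> U \<Longrightarrow> Y q = X q"
  have "nab W (H Y) p = nab W (H X) p"
    by (rule nab_cong2 [OF W tensorial_VF [OF H X] p]) (rule tensorial_cong [OF H X _ eq])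
  moreover have "H (nab W Y) p = H (nab W X) p"
    by (rule tensorial_cong [OF H nab_VF [OF W X] p]) (rule nab_cong2 [OF W X _ eq])
  ultimately show "cov_End nab W H Y p = cov_End nab W H X p"
    by (simp add: cov_End_def)
qed (simp add: cov_End_VF H W)

lemma tensorial_cov_End1:
  assumes H: "tensorial H" and X: "VF X"
  shows "tensorial (\<lambda>W. cov_End nab W H X)"
proof -
  have "tensorial (\<lambda>W q. nab W (H X) q - H (nab W X) q)"
    by (rule tensorial_diff_op [OF tensorial_nab [OF tensorial_VF [OF H X]] tensorial_comp [OF H tensorial_nab [OF X]]])
  moreover have "(\<lambda>W. cov_End nab W H X) = (\<lambda>W q. nab W (H X) q - H (nab W X) q)"
    by (intro ext) (simp add: cov_End_def)
  ultimately show ?thesis by simp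
qed

text \<open>The function g(HX,Y) + g(X,HY) vanishes on U, hence so does its derivative along W;
  skewness at the fields \<open>nab W X\<close> and \<open>nab W Y\<close> cancels the terms in
  which H is not differentiated.\<close>

lemma cov_End_skew:
  assumes H: "tensorial H" and W: "VF W" and X: "VF X" and Y: "VF Y" and p: "p \<in> U"
    and skew: "\<And>X Y q. VF X \<Longrightarrow> VF Y \<Longrightarrow> q \<in> U \<Longrightarrow> g q (H X q) (Y q) = - g q (X q) (H Y q)"
  shows "g p (cov_End nab W H X p) (Y p) = - g p (X p) (cov_End nab W H Y p)"
proof -
  note VF = tensorial_VF [OF H] W X Y nab_VF
  have "dapply (W p) (\<lambda>q. g q (H X q) (Y q)) + dapply (W p) (\<lambda>q. g q (X q) (H Y q))
      = dapply (W p) (\<lambda>q. g q (H X q) (Y q) + g q (X q) (H Y q))"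
    by (rule VF_deriv_add [OF W g_SF g_SF p, symmetric]) (rule VF)+
  also have "\<dots> = dapply (W p) (\<lambda>q. 0)"
    by (rule VF_deriv_cong [OF W _ p]) (simp_all add: VF g_SF smooth_fun_add open_U skew)
  also have "\<dots> = 0"
    by (rule VF_deriv_const [OF W p])
  finally show ?thesis
    using p skew [of X "nab W Y" p] skew [of "nab W X" Y p]
    by (simp add: nab_metric [OF W] VF cov_End_def g_simps VF_tangent)
qed

section \<open>Curvature of the Levi-Civita connection\<close>

abbreviation R where "R \<equiv> curvature M nab"

text \<open>Torsion-freeness splits the bracket term. In this form linearity in X and Y is inherited
  from that of \<open>cov_End\<close>.\<close>

lemma R_eq_hessian:
  assumes "VF X" "VF Y" "VF Z" "p \<in> U"
  shows "R X Y Z p = cov_End nab X (\<lambda>W. nab W Z) Y p - cov_End nab Y (\<lambda>W. nab W Z) X p"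
  using assms by (simp add: curvature_def nab_lie_bracket cov_End_def)

lemma R_VF: "VF X \<Longrightarrow> VF Y \<Longrightarrow> VF Z \<Longrightarrow> VF (R X Y Z)"
  unfolding curvature_def [abs_def] by (simp add: VF_intros)

lemma R_alt: "VF X \<Longrightarrow> VF Y \<Longrightarrow> VF Z \<Longrightarrow> p \<in> U \<Longrightarrow> R X Y Z p = - R Y X Z p"
  by (simp add: R_eq_hessian)

lemma tensorial_eq:
  assumes H: "tensorial H" and eq: "\<And>X q. VF X \<Longrightarrow> q \<in> U \<Longrightarrow> H' X q = H X q"
  shows "tensorial H'"
proof (rule tensorialI)
  show "VF (H' X)" if "VF X" for X
    by (rule VF_cong [OF tensorial_VF [OF H that]]) (simp add: eq that)
  show "H' Y p = H' X p" if "VF X" "\<And>q. q \<in> U \<Longrightarrow> Y q = X q" "p \<in> U" for X Y p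
    using tensorial_cong [OF H that(1,3,2)] VF_cong [OF that(1), of Y] that by (simp add: eq)
qed (simp_all add: eq VF_intros tensorial_add [OF H] tensorial_scale [OF H])

lemma tensorial_R1:
  assumes Y: "VF Y" and Z: "VF Z"
  shows "tensorial (\<lambda>X. R X Y Z)"
proof (rule tensorial_eq)
  show "tensorial (\<lambda>X q. cov_End nab X (\<lambda>W. nab W Z) Y q - cov_End nab Y (\<lambda>W. nab W Z) X q)"
    using Y Z by (intro tensorial_diff_op tensorial_cov_End1 tensorial_cov_End tensorial_nab)
qed (simp add: R_eq_hessian Y Z)

lemma tensorial_R2:
  assumes X: "VF X" and Z: "VF Z"
  shows "tensorial (\<lambda>Y. R X Y Z)"
proof (rule tensorial_eq)
  show "tensorial (\<lambda>Y q. cov_End nab X (\<lambda>W. nab W Z) Y q - cov_End nab Y (\<lambda>W. nab W Z) X q)"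
    using X Z by (intro tensorial_diff_op tensorial_cov_End1 tensorial_cov_End tensorial_nab)
qed (simp add: R_eq_hessian X Z)

lemma tensorial_R3:
  assumes X: "VF X" and Y: "VF Y"
  shows "tensorial (R X Y)"
proof (rule tensorialI)
  fix Z Z' p assume Z: "VF Z" "VF Z'" and p: "p \<in> U"
  have "nab X (nab Y (\<lambda>q. Z q + Z' q)) p = nab X (\<lambda>q. nab Y Z q + nab Y Z' q) p" if "VF X" "VF Y" for X Y
    using that Z p by (intro nab_cong2) (simp_all add: VF_intros nab_add2)
  then show "R X Y (\<lambda>q. Z q + Z' q) p = R X Y Z p + R X Y Z' p"
    using X Y Z p by (simp add: curvature_def nab_add2 VF_intros)
next
  fix f Z p assume f: "SF f" and Z: "VF Z" and p: "p \<in> U"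
  \<comment> \<open>After antisymmetrising in X and Y the mixed first-order terms cancel, and the
    second derivatives of f form exactly the bracket applied to f.\<close>
  have *: "nab X (nab Y (\<lambda>q. f q *\<^sub>R Z q)) p
      = dapply (X p) (\<lambda>q. dapply (Y q) f) *\<^sub>R Z p + dapply (Y p) f *\<^sub>R nab X Z p
        + dapply (X p) f *\<^sub>R nab Y Z p + f p *\<^sub>R nab X (nab Y Z) p"
    if "VF X" "VF Y" for X Y
  proof -
    have "nab X (nab Y (\<lambda>q. f q *\<^sub>R Z q)) p = nab X (\<lambda>q. dapply (Y q) f *\<^sub>R Z q + f q *\<^sub>R nab Y Z q) p"
      using that Z p f by (intro nab_cong2) (simp_all add: VF_intros nab_scale2 VF_deriv)
    then show ?thesis
      using that Z p f by (simp add: nab_add2 nab_scale2 VF_intros VF_deriv)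
  qed
  show "R X Y (\<lambda>q. f q *\<^sub>R Z q) p = f p *\<^sub>R R X Y Z p"
    using X Y Z p f
    by (simp add: curvature_def * nab_scale2 VF_intros dapply_lie_bracket SF_at algebra_simps)
next
  fix Z Z' p assume Z: "VF Z" and p: "p \<in> U" and eq: "\<And>q. q \<in> U \<Longrightarrow> Z' q = Z q"
  have "nab X (nab Y Z') p = nab X (nab Y Z) p" if "VF X" "VF Y" for X Y
    by (rule nab_cong2 [OF that(1) nab_VF [OF that(2) Z] p]) (rule nab_cong2 [OF that(2) Z _ eq])
  moreover have "nab (lie_bracket M X Y) Z' p = nab (lie_bracket M X Y) Z p"
    by (rule nab_cong2 [OF VF_lie_bracket [OF X Y] Z p eq])
  ultimately show "R X Y Z' p = R X Y Z p"
    using X Y by (simp add: curvature_def)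
qed (simp add: R_VF X Y)

text \<open>Compares [X,Y] applied to g(Z,W) with the commutator of the two derivatives; the mixed
  terms are symmetric in X and Y.\<close>

lemma R_skew:
  assumes X: "VF X" and Y: "VF Y" and Z: "VF Z" and W: "VF W" and p: "p \<in> U"
  shows "g p (R X Y Z p) (W p) = - g p (Z p) (R X Y W p)"
proof -
  have *: "dapply (X p) (\<lambda>q. dapply (Y q) (\<lambda>q. g q (Z q) (W q)))
      = g p (nab X (nab Y Z) p) (W p) + g p (nab Y Z p) (nab X W p)
        + g p (nab X Z p) (nab Y W p) + g p (Z p) (nab X (nab Y W) p)"
    if X: "VF X" and Y: "VF Y" for X Y
  proof -
    have "dapply (X p) (\<lambda>q. dapply (Y q) (\<lambda>q. g q (Z q) (W q)))
        = dapply (X p) (\<lambda>q. g q (nab Y Z q) (W q) + g q (Z q) (nab Y W q))"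
      by (rule VF_deriv_cong [OF X _ p]) (simp_all add: VF_deriv g_SF nab_metric [OF Y] Y Z W)
    then show ?thesis
      using X Y Z W p by (simp add: VF_deriv_add [OF X] g_SF VF_intros nab_metric [OF X])
  qed
  have "dapply (lie_bracket M X Y p) (\<lambda>q. g q (Z q) (W q))
      = dapply (X p) (\<lambda>q. dapply (Y q) (\<lambda>q. g q (Z q) (W q)))
        - dapply (Y p) (\<lambda>q. dapply (X q) (\<lambda>q. g q (Z q) (W q)))"
    using SF_at [OF g_SF [OF Z W] p] by (simp add: dapply_lie_bracket)
  moreover have "dapply (lie_bracket M X Y p) (\<lambda>q. g q (Z q) (W q))
      = g p (nab (lie_bracket M X Y) Z p) (W p) + g p (Z p) (nab (lie_bracket M X Y) W p)"
    by (rule nab_metric [OF VF_lie_bracket [OF X Y] Z W p])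
  ultimately show ?thesis
    using X Y Z W p by (simp add: * curvature_def g_simps VF_tangent VF_intros tangent_intros)
qed

text \<open>This is the Jacobi identity: the six second derivatives are paired by their outer
  direction, and torsion-freeness turns each pair into a double bracket plus a term that the bracket
  part of the curvature cancels.\<close>

lemma R_bianchi:
  assumes X: "VF X" and Y: "VF Y" and Z: "VF Z" and p: "p \<in> U"
  shows "R X Y Z p + R Y Z X p + R Z X Y p = 0"
proof -
  have *: "nab X (nab Y Z) p - nab X (nab Z Y) p = lie_bracket M X (lie_bracket M Y Z) p + nab (lie_bracket M Y Z) X p"
    if X: "VF X" and Y: "VF Y" and Z: "VF Z" for X Y Z
  proof -
    have "nab X (lie_bracket M Y Z) p = nab X (\<lambda>q. nab Y Z q - nab Z Y q) p"
      using X Y Z p by (intro nab_cong2) (simp_all add: VF_intros torsion_free)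
    then show ?thesis
      using X Y Z p torsion_free [of X "lie_bracket M Y Z" p] by (simp add: nab_diff2 VF_intros)
  qed
  show ?thesis
    using lie_bracket_jacobi [OF X Y Z p] * [OF X Y Z] * [OF Y Z X] * [OF Z X Y]
    by (simp add: curvature_def algebra_simps)
qed

text \<open>Covariant derivative of a vector-valued bilinear tensor. For \<nabla>\<theta> it is the
  second derivative of \<theta>, the inner direction of differentiation having become an
  argument.\<close>

definition cov_bil :: "'a field \<Rightarrow> ('a field \<Rightarrow> 'a op) \<Rightarrow> 'a field \<Rightarrow> 'a op" where
  "cov_bil W B X Y p = nab W (B X Y) p - B (nab W X) Y p - B X (nab W Y) p"

context
  fixes B assumes B1: "\<And>Y. VF Y \<Longrightarrow> tensorial (\<lambda>X. B X Y)" and B2: "\<And>X. VF X \<Longrightarrow> tensorial (B X)"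
begin

lemma tensorial_cov_bil1: "VF X \<Longrightarrow> VF Y \<Longrightarrow> tensorial (\<lambda>W. cov_bil W B X Y)"
proof -
  assume X: "VF X" and Y: "VF Y"
  have "(\<lambda>W. cov_bil W B X Y) = (\<lambda>W q. cov_End nab W (B X) Y q - B (nab W X) Y q)"
    by (intro ext) (simp add: cov_bil_def cov_End_def)
  moreover have "tensorial (\<lambda>W. B (nab W X) Y)"
    by (rule tensorial_comp [OF B1 [OF Y] tensorial_nab [OF X]])
  ultimately show ?thesis
    using tensorial_diff_op [OF tensorial_cov_End1 [OF B2 [OF X] Y]] by simp
qed

lemma tensorial_cov_bil2: "VF W \<Longrightarrow> VF Y \<Longrightarrow> tensorial (\<lambda>X. cov_bil W B X Y)"
proof -
  assume W: "VF W" and Y: "VF Y"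
  have "(\<lambda>X. cov_bil W B X Y) = (\<lambda>X q. cov_End nab W (\<lambda>X. B X Y) X q - B X (nab W Y) q)"
    by (intro ext) (simp add: cov_bil_def cov_End_def)
  then show ?thesis
    using tensorial_diff_op [OF tensorial_cov_End [OF B1 [OF Y] W] B1 [OF nab_VF [OF W Y]]] by simp
qed

lemma tensorial_cov_bil3: "VF W \<Longrightarrow> VF X \<Longrightarrow> tensorial (cov_bil W B X)"
proof -
  assume W: "VF W" and X: "VF X"
  have "cov_bil W B X = (\<lambda>Y q. cov_End nab W (B X) Y q - B (nab W X) Y q)"
    by (intro ext) (simp add: cov_bil_def cov_End_def)
  then show ?thesis
    using tensorial_diff_op [OF tensorial_cov_End [OF B2 [OF X] W] B2 [OF nab_VF [OF W X]]] by simp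
qed

end

end

section \<open>Structure equations of nearly cosymplectic manifolds\<close>

locale nearly_cosymplectic_domain = levi_civita_domain M U g nab
  for M :: "('a, 'e::euclidean_space) manifold" and U g nab +
  fixes \<theta> :: "'a \<Rightarrow> 'a functional \<Rightarrow> 'a functional" and \<xi> :: "'a field" and \<eta> :: "'a \<Rightarrow> 'a functional \<Rightarrow> real"
  assumes nc: "nearly_cosymplectic M g nab \<theta> \<xi> \<eta>"
begin

lemma acm: "almost_contact_metric M g \<theta> \<xi> \<eta>"
  using nc unfolding nearly_cosymplectic_def by (rule conjunct1)

lemma VF_restrict:
  assumes "vector_field M V X" "U \<subseteq> V"
  shows "VF X"
  using assms unfolding vector_field_def by blast

lemma VF_xi: "VF \<xi>"
  using acm unfolding almost_contact_metric_def
  by (intro VF_restrict [OF _ openin_subset [OF open_U]]) (erule conjunct1)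

lemma acm_point:
  assumes "p \<in> U"
  shows "lin_on (TS p) (\<eta> p)" "lin_on (TS p) (\<theta> p)" "\<theta> p ` TS p \<subseteq> TS p"
    and "g p (\<xi> p) (\<xi> p) = 1" "\<eta> p (\<xi> p) = 1"
    and "u \<in> TS p \<Longrightarrow> \<theta> p (\<theta> p u) = - u + \<eta> p u *\<^sub>R \<xi> p"
    and "u \<in> TS p \<Longrightarrow> v \<in> TS p \<Longrightarrow> g p (\<theta> p u) (\<theta> p v) = g p u v - \<eta> p u * \<eta> p v"
  using acm [unfolded almost_contact_metric_def, THEN conjunct2, THEN conjunct1,
      THEN bspec, OF U_topspace [OF assms]]
    acm [unfolded almost_contact_metric_def, THEN conjunct2, THEN conjunct2, THEN conjunct2,
      THEN bspec, OF U_topspace [OF assms]]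
  by simp_all

lemma th_TS: "p \<in> U \<Longrightarrow> u \<in> TS p \<Longrightarrow> \<theta> p u \<in> TS p"
  using acm_point(3) by blast

lemma th_add: "p \<in> U \<Longrightarrow> u \<in> TS p \<Longrightarrow> v \<in> TS p \<Longrightarrow> \<theta> p (u + v) = \<theta> p u + \<theta> p v"
  and th_scale: "p \<in> U \<Longrightarrow> u \<in> TS p \<Longrightarrow> \<theta> p (c *\<^sub>R u) = c *\<^sub>R \<theta> p u"
  using acm_point(2) unfolding lin_on_def by blast+

lemma th_neg: "p \<in> U \<Longrightarrow> u \<in> TS p \<Longrightarrow> \<theta> p (- u) = - \<theta> p u"
  using th_scale [of p u "- 1"] by simp

lemma th_diff: "p \<in> U \<Longrightarrow> u \<in> TS p \<Longrightarrow> v \<in> TS p \<Longrightarrow> \<theta> p (u - v) = \<theta> p u - \<theta> p v"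
  using th_add [of p u "- v"] by (simp add: th_neg tangent_space_neg)

lemma th_0: "p \<in> U \<Longrightarrow> \<theta> p 0 = 0"
  using th_scale [of p 0 0] by (simp add: tangent_space_0)

lemmas th_simps = th_add th_scale th_neg th_diff th_0

lemma xi_TS: "p \<in> U \<Longrightarrow> \<xi> p \<in> TS p"
  by (rule VF_tangent [OF VF_xi])

text \<open>Compatibility gives \<theta>\<xi> the squared length 1 - 1 = 0. Then \<theta>^3 u, read
  as \<theta>^2 applied to \<theta>u and as \<theta> applied to \<theta>^2 u, differs by
  \<eta>(\<theta>u) \<xi>.\<close>

lemma eta_th: "p \<in> U \<Longrightarrow> u \<in> TS p \<Longrightarrow> \<eta> p (\<theta> p u) = 0"
  and th_xi: "p \<in> U \<Longrightarrow> \<theta> p (\<xi> p) = 0"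
proof -
  assume p: "p \<in> U"
  note xi = xi_TS [OF p] and acm = acm_point [OF p]
  have "\<theta> p (\<theta> p (\<xi> p)) = 0"
    using acm(6) [OF xi] acm(5) by simp
  have "g p (\<theta> p (\<xi> p)) (\<theta> p (\<xi> p)) = 0"
    using acm(7) [OF xi xi] acm(4,5) by simp
  then show th_xi: "\<theta> p (\<xi> p) = 0"
    using g_pos [OF p th_TS [OF p xi]] by force
  assume u: "u \<in> TS p"
  have "\<theta> p (\<theta> p (\<theta> p u)) = - \<theta> p u + \<eta> p (\<theta> p u) *\<^sub>R \<xi> p"
    using acm(6) [OF th_TS [OF p u]] .
  moreover have "\<theta> p (\<theta> p (\<theta> p u)) = - \<theta> p u"
    using p u xi by (simp add: acm(6) th_simps tangent_intros th_xi)
  ultimately have "\<eta> p (\<theta> p u) *\<^sub>R \<xi> p = 0"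
    by simp
  moreover have "\<xi> p \<noteq> 0"
    using acm(4) g_0_left [OF p xi] by force
  ultimately show "\<eta> p (\<theta> p u) = 0"
    by simp
qed

lemma eta_eq: "p \<in> U \<Longrightarrow> u \<in> TS p \<Longrightarrow> \<eta> p u = g p (\<xi> p) u"
  using acm_point(7) [of p u "\<xi> p"] acm_point(5) [of p]
  by (simp add: xi_TS th_xi g_0_right th_TS g_sym [of p u])

lemma th_th: "p \<in> U \<Longrightarrow> u \<in> TS p \<Longrightarrow> \<theta> p (\<theta> p u) = - u + g p (\<xi> p) u *\<^sub>R \<xi> p"
  using acm_point(6) by (simp add: eta_eq)

lemma g_xi_xi: "p \<in> U \<Longrightarrow> g p (\<xi> p) (\<xi> p) = 1"
  by (rule acm_point(4))

lemma g_xi_th: "p \<in> U \<Longrightarrow> u \<in> TS p \<Longrightarrow> g p (\<xi> p) (\<theta> p u) = 0"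
  using eta_th [of p u] by (simp add: eta_eq th_TS)

lemma th_skew:
  assumes p: "p \<in> U" and u: "u \<in> TS p" and v: "v \<in> TS p"
  shows "g p (\<theta> p u) v = - g p u (\<theta> p v)"
proof -
  have "g p (\<theta> p (\<theta> p u)) (\<theta> p v) = g p (\<theta> p u) v"
    using acm_point(7) [OF p th_TS [OF p u] v] eta_th [OF p u] by simp
  then show ?thesis
    using assms by (simp add: th_th g_simps tangent_intros xi_TS th_TS g_xi_th)
qed

section \<open>Derivatives of the structure tensors\<close>

abbreviation Th :: "'a op" where "Th \<equiv> \<lambda>Z q. \<theta> q (Z q)"
abbreviation h :: "'a op" where "h \<equiv> \<lambda>X. nab X \<xi>"
abbreviation A :: "'a field \<Rightarrow> 'a op" where "A \<equiv> \<lambda>X. cov_End nab X Th"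
abbreviation N :: "'a field \<Rightarrow> 'a op" where "N \<equiv> \<lambda>X. cov_End nab X h"
abbreviation T :: "'a field \<Rightarrow> 'a field \<Rightarrow> 'a op" where "T \<equiv> \<lambda>W. cov_bil W A"

lemma Th_VF: "VF X \<Longrightarrow> VF (\<lambda>q. \<theta> q (X q))"
proof -
  assume "VF X"
  with open_U have "openin (mtop M) U \<and> VF X" ..
  with acm [unfolded almost_contact_metric_def, THEN conjunct2, THEN conjunct2, THEN conjunct1,
      THEN spec [of _ U], THEN spec [of _ X]] show ?thesis
    by simp
qed

lemma tensorial_Th: "tensorial Th"
  by (rule tensorialI) (simp_all add: Th_VF th_simps VF_tangent)

lemma tensorial_h: "tensorial h"
  by (rule tensorial_nab [OF VF_xi])

lemma tensorial_A1: "VF Y \<Longrightarrow> tensorial (\<lambda>X. A X Y)"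
  and tensorial_A2: "VF X \<Longrightarrow> tensorial (A X)"
  by (simp_all add: tensorial_cov_End1 tensorial_cov_End tensorial_Th)

lemma tensorial_N1: "VF Y \<Longrightarrow> tensorial (\<lambda>X. N X Y)"
  and tensorial_N2: "VF X \<Longrightarrow> tensorial (N X)"
  by (simp_all add: tensorial_cov_End1 tensorial_cov_End tensorial_h)

lemmas tensorial_T1 = tensorial_cov_bil1 [OF tensorial_A1 tensorial_A2]
  and tensorial_T2 = tensorial_cov_bil2 [OF tensorial_A1 tensorial_A2]
  and tensorial_T3 = tensorial_cov_bil3 [OF tensorial_A1 tensorial_A2]

lemma h_VF: "VF X \<Longrightarrow> VF (h X)"
  by (simp add: nab_VF VF_xi)

lemma A_VF: "VF X \<Longrightarrow> VF Y \<Longrightarrow> VF (A X Y)"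
  by (rule tensorial_VF [OF tensorial_A2])

lemma N_VF: "VF X \<Longrightarrow> VF Y \<Longrightarrow> VF (N X Y)"
  by (rule tensorial_VF [OF tensorial_N2])

lemmas nc_intros = VF_intros VF_xi Th_VF h_VF A_VF N_VF tangent_intros th_TS xi_TS VF_tangent

lemma A_alt: "VF X \<Longrightarrow> VF Y \<Longrightarrow> p \<in> U \<Longrightarrow> A X Y p = - A Y X p"
proof -
  assume *: "VF X" "VF Y" "p \<in> U"
  with open_U have "openin (mtop M) U \<and> VF X \<and> VF Y" by simp
  with nc [unfolded nearly_cosymplectic_def, THEN conjunct2,
      THEN spec [of _ U], THEN spec [of _ X], THEN spec [of _ Y]] *(3)
  have "A X Y p + A Y X p = 0"
    by simp
  then show ?thesis
    by (simp add: eq_neg_iff_add_eq_0)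
qed

lemma A_skew:
  "VF X \<Longrightarrow> VF Y \<Longrightarrow> VF Z \<Longrightarrow> p \<in> U \<Longrightarrow> g p (A X Y p) (Z p) = - g p (Y p) (A X Z p)"
  by (rule cov_End_skew [OF tensorial_Th]) (simp_all add: th_skew VF_tangent)

lemma A_xi: "VF X \<Longrightarrow> p \<in> U \<Longrightarrow> A X \<xi> p = - \<theta> p (h X p)"
proof -
  assume X: "VF X" and p: "p \<in> U"
  have "nab X (\<lambda>q. \<theta> q (\<xi> q)) p = nab X (\<lambda>q. 0) p"
    using X p by (intro nab_cong2) (simp_all add: VF_0 th_xi)
  then show ?thesis
    using X p by (simp add: cov_End_def nab_0)
qed

lemma g_h_xi: "VF X \<Longrightarrow> p \<in> U \<Longrightarrow> g p (h X p) (\<xi> p) = 0"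
proof -
  assume X: "VF X" and p: "p \<in> U"
  have "dapply (X p) (\<lambda>q. g q (\<xi> q) (\<xi> q)) = dapply (X p) (\<lambda>q. 1)"
    using g_xi_xi by (intro VF_deriv_cong [OF X g_SF [OF VF_xi VF_xi] p]) simp
  then show ?thesis
    using X p nab_metric [OF X VF_xi VF_xi p] g_sym [of p "\<xi> p" "h X p"]
    by (simp add: VF_deriv_const [OF X] nc_intros)
qed

lemma g_xi_h: "VF X \<Longrightarrow> p \<in> U \<Longrightarrow> g p (\<xi> p) (h X p) = 0"
  using g_h_xi [of X p] g_sym [of p "\<xi> p" "h X p"] by (simp add: nc_intros)

text \<open>Obtained by differentiating \<theta>^2 = -Id + g(\<xi>,.) \<xi>.\<close>

lemma A_Th:
  assumes X: "VF X" and Y: "VF Y" and p: "p \<in> U"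
  shows "A X (Th Y) p + \<theta> p (A X Y p) = g p (h X p) (Y p) *\<^sub>R \<xi> p + g p (Y p) (\<xi> p) *\<^sub>R h X p"
proof -
  have "nab X (\<lambda>q. \<theta> q (\<theta> q (Y q))) p = nab X (\<lambda>q. - Y q + g q (\<xi> q) (Y q) *\<^sub>R \<xi> q) p"
    using X Y p by (intro nab_cong2) (simp_all add: nc_intros th_th)
  also have "\<dots> = - nab X Y p + (g p (h X p) (Y p) + g p (\<xi> p) (nab X Y p)) *\<^sub>R \<xi> p + g p (\<xi> p) (Y p) *\<^sub>R h X p"
    using X Y p nab_metric [OF X VF_xi Y p] by (simp add: nc_intros nab_diff2 nab_scale2)
  finally show ?thesis
    using X Y p g_sym [of p "Y p" "\<xi> p"]
    by (simp add: cov_End_def nc_intros th_simps th_th algebra_simps)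
qed

text \<open>Alternation annihilates \<open>A \<xi> \<xi> p\<close>, which is -\<theta>(h\<xi>); so
  h\<xi> is a multiple of \<xi>, and it is also orthogonal to \<xi>.\<close>

lemma h_xi: "p \<in> U \<Longrightarrow> h \<xi> p = 0"
proof -
  assume p: "p \<in> U"
  have "A \<xi> \<xi> p = - A \<xi> \<xi> p"
    by (rule A_alt [OF VF_xi VF_xi p])
  then have "2 *\<^sub>R A \<xi> \<xi> p = 0"
    by (simp add: scaleR_2 eq_neg_iff_add_eq_0)
  then have "\<theta> p (h \<xi> p) = 0"
    using p by (simp add: A_xi VF_xi)
  then have "\<theta> p (\<theta> p (h \<xi> p)) = 0"
    using p by (simp add: th_0)
  then show ?thesis
    using p by (simp add: th_th nc_intros g_xi_h)
qed

text \<open>Alternation turns \<open>A_xi\<close> into A_\<xi> = \<theta>h. Inserted into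
  \<open>A_Th\<close> along \<xi>, where h\<xi> = 0 kills the right-hand side, this makes \<theta>h
  anticommute with \<theta>; one \<theta> can be cancelled because h takes values orthogonal to
  \<xi>.\<close>

lemma th_h_th: "VF X \<Longrightarrow> p \<in> U \<Longrightarrow> \<theta> p (h (Th X) p) = h X p"
  and th_h_eq: "VF X \<Longrightarrow> p \<in> U \<Longrightarrow> h (Th X) p = - \<theta> p (h X p)"
proof -
  assume X: "VF X" and p: "p \<in> U"
  have A: "A \<xi> X p = \<theta> p (h X p)" if "VF X" for X
    using A_alt [OF VF_xi that p] A_xi [OF that p] by simp
  have "\<theta> p (h (Th X) p) + \<theta> p (\<theta> p (h X p)) = 0"
    using A_Th [OF VF_xi X p] p X by (simp add: A nc_intros h_xi g_simps)
  then show *: "\<theta> p (h (Th X) p) = h X p"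
    using p X by (simp add: th_th nc_intros g_xi_h)
  have "\<theta> p (\<theta> p (h (Th X) p)) = - h (Th X) p"
    using p X by (simp add: th_th nc_intros g_xi_h)
  then show "h (Th X) p = - \<theta> p (h X p)"
    by (simp add: *)
qed

lemma th_h: "VF X \<Longrightarrow> p \<in> U \<Longrightarrow> \<theta> p (h X p) = - h (Th X) p"
  by (simp add: th_h_eq)

text \<open>The operator A_\<xi> = \<theta>h is skew; testing it against \<theta>Y and applying
  \<open>th_h_th\<close> removes \<theta> from both sides. Thus \<xi> is a Killing field.\<close>

lemma h_skew:
  assumes X: "VF X" and Y: "VF Y" and p: "p \<in> U"
  shows "g p (h X p) (Y p) = - g p (X p) (h Y p)"
proof -
  have A: "A \<xi> X p = \<theta> p (h X p)" if "VF X" for X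
    using A_alt [OF VF_xi that p] A_xi [OF that p] by simp
  have *: "g p (\<theta> p (h X p)) (Y p) = - g p (X p) (\<theta> p (h Y p))" if "VF X" "VF Y" for X Y
    using A_skew [OF VF_xi that p] by (simp add: A that)
  have "g p (\<theta> p (h X p)) (\<theta> p (Y p)) = - g p (X p) (h Y p)"
    using * [OF X Th_VF [OF Y]] th_h_th [OF Y p] by simp
  moreover have "g p (\<theta> p (h X p)) (\<theta> p (Y p)) = g p (h X p) (Y p)"
    using X Y p th_skew [of p "h X p" "\<theta> p (Y p)"]
    by (simp add: nc_intros th_th g_simps g_h_xi)
  ultimately show ?thesis by simp
qed

lemma N_xi: "VF X \<Longrightarrow> p \<in> U \<Longrightarrow> N X \<xi> p = - h (h X) p"
proof -
  assume X: "VF X" and p: "p \<in> U"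
  have "nab X (h \<xi>) p = nab X (\<lambda>q. 0) p"
    using X p by (intro nab_cong2) (simp_all add: VF_0 h_xi)
  then show ?thesis
    using X p by (simp add: cov_End_def nab_0)
qed

lemma N_skew:
  "VF X \<Longrightarrow> VF Y \<Longrightarrow> VF Z \<Longrightarrow> p \<in> U \<Longrightarrow> g p (N X Y p) (Z p) = - g p (Y p) (N X Z p)"
  by (rule cov_End_skew [OF tensorial_h]) (simp_all add: h_skew)

lemma R_xi: "VF X \<Longrightarrow> VF Y \<Longrightarrow> p \<in> U \<Longrightarrow> R X Y \<xi> p = N X Y p - N Y X p"
  by (rule R_eq_hessian [OF _ _ VF_xi])

text \<open>Ricci identity for \<theta>: by torsion-freeness the terms with \<open>nab W X\<close>
  and \<open>nab X W\<close> combine to the bracket part of the curvature.\<close>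

lemma T_ricci:
  assumes W: "VF W" and X: "VF X" and Y: "VF Y" and p: "p \<in> U"
  shows "T W X Y p - T X W Y p = R W X (Th Y) p - \<theta> p (R W X Y p)"
proof -
  have AB: "nab W (A X Y) p = nab W (nab X (Th Y)) p - nab W (Th (nab X Y)) p"
    if "VF W" "VF X" for W X
  proof -
    have "nab W (A X Y) p = nab W (\<lambda>q. nab X (Th Y) q - Th (nab X Y) q) p"
      by (simp add: cov_End_def [abs_def])
    then show ?thesis
      using that Y p by (simp add: nab_diff2 nc_intros)
  qed
  show ?thesis
    using W X Y p
    by (simp add: cov_bil_def AB curvature_def cov_End_def nab_lie_bracket nc_intros th_simps)
qed

lemma T_alt:
  assumes W: "VF W" and X: "VF X" and Y: "VF Y" and p: "p \<in> U"
  shows "T W X Y p = - T W Y X p"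
proof -
  have "nab W (A X Y) p = nab W (\<lambda>q. - A Y X q) p"
    using W X Y p by (intro nab_cong2) (simp_all add: nc_intros A_alt [of X Y])
  then show ?thesis
    using W X Y p A_alt [of "nab W X" Y p] A_alt [of X "nab W Y" p]
    by (simp add: cov_bil_def nab_neg2 nc_intros)
qed

lemma T_skew:
  assumes W: "VF W" and X: "VF X" and Y: "VF Y" and Z: "VF Z" and p: "p \<in> U"
  shows "g p (T W X Y p) (Z p) = - g p (Y p) (T W X Z p)"
proof -
  have "T W X Y p = cov_End nab W (A X) Y p - A (nab W X) Y p" for Y
    by (simp add: cov_bil_def cov_End_def)
  moreover have "g p (cov_End nab W (A X) Y p) (Z p) = - g p (Y p) (cov_End nab W (A X) Z p)"
    using A_skew [OF X] by (rule cov_End_skew [OF tensorial_A2 [OF X] W Y Z p])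
  moreover have "g p (A (nab W X) Y p) (Z p) = - g p (Y p) (A (nab W X) Z p)"
    using W X Y Z p by (simp add: A_skew nab_VF)
  ultimately show ?thesis
    using W X Y Z p cov_End_VF [OF tensorial_A2 [OF X] W]
    by (simp add: g_simps nc_intros)
qed

lemma T_xi:
  assumes W: "VF W" and X: "VF X" and p: "p \<in> U"
  shows "T W X \<xi> p = - A W (h X) p - A X (h W) p - \<theta> p (N W X p)"
proof -
  have "nab W (A X \<xi>) p = nab W (\<lambda>q. - \<theta> q (h X q)) p"
    using W X p by (intro nab_cong2) (simp_all add: nc_intros A_xi [of X])
  then have "nab W (A X \<xi>) p = - nab W (\<lambda>q. \<theta> q (h X q)) p"
    using W X p by (simp add: nab_neg2 nc_intros)
  then show ?thesis
    using W X p A_xi [OF nab_VF [OF W X] p]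
    by (simp add: cov_bil_def cov_End_def nc_intros th_simps)
qed

text \<open>The derivative of \<open>A_Th\<close> along W (\<open>e1\<close>), minus
  \<open>A_Th\<close> for the fields \<open>nab W X\<close> (\<open>e2\<close>) and
  \<open>nab W Y\<close> (\<open>e3\<close>). The two products of \<open>A\<close> come from
  differentiating the inner and the outer \<theta>.\<close>

lemma T_Th:
  assumes W: "VF W" and X: "VF X" and Y: "VF Y" and p: "p \<in> U"
  shows "T W X (Th Y) p + \<theta> p (T W X Y p) + A X (A W Y) p + A W (A X Y) p
    = g p (N W X p) (Y p) *\<^sub>R \<xi> p + g p (h X p) (Y p) *\<^sub>R h W p + g p (h W p) (Y p) *\<^sub>R h X p
      + g p (Y p) (\<xi> p) *\<^sub>R N W X p"
proof -
  note VF = W X Y nc_intros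
  have e1: "nab W (A X (Th Y)) p + nab W (\<lambda>q. \<theta> q (A X Y q)) p
      = (g p (nab W (h X) p) (Y p) + g p (h X p) (nab W Y p)) *\<^sub>R \<xi> p + g p (h X p) (Y p) *\<^sub>R h W p
        + (g p (nab W Y p) (\<xi> p) + g p (Y p) (h W p)) *\<^sub>R h X p + g p (Y p) (\<xi> p) *\<^sub>R nab W (h X) p"
  proof -
    have "nab W (A X (Th Y)) p + nab W (\<lambda>q. \<theta> q (A X Y q)) p
        = nab W (\<lambda>q. A X (Th Y) q + \<theta> q (A X Y q)) p"
      using p by (simp add: VF nab_add2)
    also have "\<dots> = nab W (\<lambda>q. g q (h X q) (Y q) *\<^sub>R \<xi> q + g q (Y q) (\<xi> q) *\<^sub>R h X q) p"
      using A_Th [OF X Y] p by (intro nab_cong2) (simp_all add: VF)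
    finally show ?thesis
      using p nab_metric [OF W h_VF [OF X] Y p] nab_metric [OF W Y VF_xi p]
      by (simp add: VF nab_add2 nab_scale2)
  qed
  have T1: "T W X (Th Y) p = nab W (A X (Th Y)) p - A (nab W X) (Th Y) p - A X (A W Y) p - A X (Th (nab W Y)) p"
  proof -
    have "A X (nab W (Th Y)) p = A X (\<lambda>q. A W Y q + Th (nab W Y) q) p"
      by (simp add: cov_End_def [of nab W])
    also have "\<dots> = A X (A W Y) p + A X (Th (nab W Y)) p"
      by (rule tensorial_add [OF tensorial_A2 [OF X]]) (simp_all add: VF p)
    finally show ?thesis
      by (simp add: cov_bil_def)
  qed
  have T2: "\<theta> p (T W X Y p) = nab W (\<lambda>q. \<theta> q (A X Y q)) p - A W (A X Y) p - \<theta> p (A (nab W X) Y p) - \<theta> p (A X (nab W Y) p)"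
  proof -
    have "nab W (\<lambda>q. \<theta> q (A X Y q)) p = A W (A X Y) p + \<theta> p (nab W (A X Y) p)"
      by (simp add: cov_End_def [of nab W])
    then show ?thesis
      using p by (simp add: cov_bil_def VF th_simps)
  qed
  have e2: "A (nab W X) (Th Y) p + \<theta> p (A (nab W X) Y p)
      = g p (h (nab W X) p) (Y p) *\<^sub>R \<xi> p + g p (Y p) (\<xi> p) *\<^sub>R h (nab W X) p"
    using p by (intro A_Th) (simp_all add: VF)
  have e3: "A X (Th (nab W Y)) p + \<theta> p (A X (nab W Y) p)
      = g p (h X p) (nab W Y p) *\<^sub>R \<xi> p + g p (nab W Y p) (\<xi> p) *\<^sub>R h X p"
    using p by (intro A_Th) (simp_all add: VF)
  have N: "nab W (h X) p = N W X p + h (nab W X) p"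
    by (simp add: cov_End_def)
  have sym: "g p (Y p) (h W p) = g p (h W p) (Y p)"
    using p by (simp add: g_sym VF)
  have "T W X (Th Y) p + \<theta> p (T W X Y p) + A X (A W Y) p + A W (A X Y) p
      = (nab W (A X (Th Y)) p + nab W (\<lambda>q. \<theta> q (A X Y q)) p)
        - (A (nab W X) (Th Y) p + \<theta> p (A (nab W X) Y p))
        - (A X (Th (nab W Y)) p + \<theta> p (A X (nab W Y) p))"
    unfolding T1 T2 by (simp only: diff_conv_add_uminus minus_add_distrib ac_simps) simp
  also have "\<dots> = g p (N W X p) (Y p) *\<^sub>R \<xi> p + g p (h X p) (Y p) *\<^sub>R h W p + g p (h W p) (Y p) *\<^sub>R h X p
      + g p (Y p) (\<xi> p) *\<^sub>R N W X p"
    unfolding e1 e2 e3 N sym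
    using p by (simp add: VF g_simps algebra_simps)
  finally show ?thesis .
qed

end

section \<open>Pointwise algebra\<close>

text \<open>The values at a point, in an orthonormal frame, of \<open>z = \<xi>\<close>, \<open>h = \<nabla>\<xi>\<close>, \<open>A = \<nabla>\<theta>\<close>, \<open>N = \<nabla>h\<close>, the curvature
  \<open>R\<close> and \<open>T = \<nabla>\<^sup>2\<theta>\<close>; the first arguments of \<open>A\<close>, \<open>N\<close>, \<open>T\<close> are the directions of differentiation.\<close>

locale nc_tensors =
  fixes z :: "'e::euclidean_space"
    and \<theta> h :: "'e \<Rightarrow> 'e"
    and A N :: "'e \<Rightarrow> 'e \<Rightarrow> 'e"
    and R T :: "'e \<Rightarrow> 'e \<Rightarrow> 'e \<Rightarrow> 'e"
  assumes z_Basis: "z \<in> Basis"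
    and lin_th: "linear \<theta>" and lin_h: "linear h"
    and lin_A2: "\<And>u. linear (A u)"
    and lin_N1: "\<And>v. linear (\<lambda>u. N u v)" and lin_N2: "\<And>u. linear (N u)"
    and lin_R1: "\<And>v w. linear (\<lambda>u. R u v w)"
    and lin_R3: "\<And>u v. linear (R u v)"
    and lin_T1: "\<And>v w. linear (\<lambda>u. T u v w)"
    and lin_T3: "\<And>u v. linear (T u v)"
    and th_z [simp]: "\<theta> z = 0" and h_z [simp]: "h z = 0"
    and th_skew: "\<And>u v. \<theta> u \<bullet> v = - (u \<bullet> \<theta> v)"
    and h_skew: "\<And>u v. h u \<bullet> v = - (u \<bullet> h v)"
    and th_th: "\<And>u. \<theta> (\<theta> u) = - u + (z \<bullet> u) *\<^sub>R z"
    and th_h: "\<And>u. \<theta> (h u) = - h (\<theta> u)"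
    and A_alt: "\<And>u v. A u v = - A v u"
    and A_skew: "\<And>u v w. A u v \<bullet> w = - (v \<bullet> A u w)"
    and A_z: "\<And>u. A u z = - \<theta> (h u)"
    and A_th: "\<And>u v. A u (\<theta> v) + \<theta> (A u v) = (h u \<bullet> v) *\<^sub>R z + (v \<bullet> z) *\<^sub>R h u"
    and N_z: "\<And>u. N u z = - h (h u)"
    and N_skew: "\<And>u v w. N u v \<bullet> w = - (v \<bullet> N u w)"
    and R_alt: "\<And>u v w. R u v w = - R v u w"
    and R_skew: "\<And>u v w x. R u v w \<bullet> x = - (w \<bullet> R u v x)"
    and R_bianchi: "\<And>u v w. R u v w + R v w u + R w u v = 0"
    and R_z: "\<And>u v. R u v z = N u v - N v u"
    and T_ricci: "\<And>w u v. T w u v - T u w v = R w u (\<theta> v) - \<theta> (R w u v)"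
    and T_alt: "\<And>w u v. T w u v = - T w v u"
    and T_skew: "\<And>w u v x. T w u v \<bullet> x = - (v \<bullet> T w u x)"
    and T_th: "\<And>w u v. T w u (\<theta> v) + \<theta> (T w u v) + A u (A w v) + A w (A u v)
        = (N w u \<bullet> v) *\<^sub>R z + (h u \<bullet> v) *\<^sub>R h w + (h w \<bullet> v) *\<^sub>R h u + (v \<bullet> z) *\<^sub>R N w u"
    and T_z: "\<And>w u. T w u z = - A w (h u) - A u (h w) - \<theta> (N w u)"
begin

lemmas linear_simps [simp] =
  linear_add [OF lin_th] linear_add [OF lin_h] linear_add [OF lin_A2]
  linear_add [OF lin_N1] linear_add [OF lin_N2] linear_add [OF lin_R1] linear_add [OF lin_R3]
  linear_add [OF lin_T1] linear_add [OF lin_T3]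
  linear_neg [OF lin_th] linear_neg [OF lin_h] linear_neg [OF lin_A2]
  linear_neg [OF lin_N1] linear_neg [OF lin_N2] linear_neg [OF lin_R1] linear_neg [OF lin_R3]
  linear_neg [OF lin_T1] linear_neg [OF lin_T3]
  linear_diff [OF lin_th] linear_diff [OF lin_h] linear_diff [OF lin_A2]
  linear_diff [OF lin_N1] linear_diff [OF lin_N2] linear_diff [OF lin_R1] linear_diff [OF lin_R3]
  linear_diff [OF lin_T1] linear_diff [OF lin_T3]
  linear_scale [OF lin_th] linear_scale [OF lin_h] linear_scale [OF lin_A2]
  linear_scale [OF lin_N1] linear_scale [OF lin_N2] linear_scale [OF lin_R1] linear_scale [OF lin_R3]
  linear_scale [OF lin_T1] linear_scale [OF lin_T3]
  linear_0 [OF lin_th] linear_0 [OF lin_h] linear_0 [OF lin_A2]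
  linear_0 [OF lin_N1] linear_0 [OF lin_N2] linear_0 [OF lin_R1] linear_0 [OF lin_R3]
  linear_0 [OF lin_T1] linear_0 [OF lin_T3]

lemma z_z [simp]: "z \<bullet> z = 1"
  using z_Basis by (simp add: inner_same_Basis)

lemma h_perp [simp]: "h u \<bullet> z = 0" "z \<bullet> h u = 0"
  using h_skew [of u z] by (simp_all add: inner_commute)

lemma th_perp [simp]: "\<theta> u \<bullet> z = 0" "z \<bullet> \<theta> u = 0"
  using th_skew [of u z] by (simp_all add: inner_commute)

lemma linear_A1: "linear (\<lambda>u. A u v)"
proof -
  have "(\<lambda>u. A u v) = (\<lambda>u. - A v u)"
    using A_alt by blast
  then show ?thesis
    using linear_compose_neg [OF lin_A2] by simp
qed

lemma linear_T2: "linear (\<lambda>u. T w u v)"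
proof -
  have "(\<lambda>u. T w u v) = (\<lambda>u. - T w v u)"
    using T_alt by blast
  then show ?thesis
    using linear_compose_neg [OF lin_T3] by simp
qed

lemma eq_neg_self: "v = - v \<Longrightarrow> v = 0" for v :: 'e
  by (metis add_eq_0_iff scaleR_2 scaleR_eq_0_iff zero_neq_numeral)

lemma A_1z: "A z u = \<theta> (h u)"
  using A_alt [of z u] A_z [of u] by simp

lemma h_h_sym: "h (h u) \<bullet> v = u \<bullet> h (h v)"
  using h_skew [of "h u" v] h_skew [of u "h v"] by simp

lemma th_h_h: "\<theta> (h (h u)) = h (h (\<theta> u))"
  by (simp add: th_h)

lemma N_inner_z: "N u v \<bullet> z = h (h u) \<bullet> v"
  using N_skew [of u v z] by (simp add: N_z inner_commute)

text \<open>The octahedron argument: four Bianchi identities are combined, and the antisymmetries in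
  each pair of slots cancel everything except the two terms compared.\<close>

lemma R_pair: "R u v w \<bullet> x = R w x u \<bullet> v"
proof -
  define r where "r a b c d = R a b c \<bullet> d" for a b c d
  have s1: "r a b c d = - r b a c d" for a b c d
    unfolding r_def using R_alt [of a b c] by simp
  have s2: "r a b c d = - r a b d c" for a b c d
    unfolding r_def using R_skew [of a b c d] by (simp add: inner_commute)
  have b: "r a b c d + r b c a d + r c a b d = 0" for a b c d
    unfolding r_def using arg_cong [OF R_bianchi [of a b c], of "\<lambda>y. y \<bullet> d"]
    by (simp add: inner_add_left)
  have "r u v w x = r w x u v"
    using b [of u v w x] b [of v w x u] b [of w x u v] b [of x u v w]
      s1 [of u v w x] s2 [of u v w x] s1 [of v w u x] s2 [of v w u x] s1 [of w u v x] s2 [of w u v x]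
      s1 [of v w x u] s2 [of v w x u] s1 [of w x v u] s2 [of w x v u] s1 [of x v w u] s2 [of x v w u]
      s1 [of w x u v] s2 [of w x u v] s1 [of x u w v] s2 [of x u w v] s1 [of u w x v] s2 [of u w x v]
      s1 [of x u v w] s2 [of x u v w] s1 [of u v x w] s2 [of u v x w] s1 [of v x u w] s2 [of v x u w]
    by linarith
  then show ?thesis
    by (simp add: r_def)
qed

text \<open>Kostant's formula for a Killing field. Pair symmetry moves z in R(u,v)z to the first
  slot, where the Bianchi identity makes the cyclic sum vanish; by \<open>R_z\<close> and skewness
  of N this sum is twice the cyclic sum of N. Solving R(v,w)z = N_v w - N_w v with it gives the
  second claim.\<close>

lemma N_cyclic: "N u v \<bullet> w + N v w \<bullet> u + N w u \<bullet> v = 0"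
  and N_eq_R: "N u v \<bullet> w = - (R z u v \<bullet> w)"
proof -
  define a where "a u v w = N u v \<bullet> w" for u v w
  define r where "r a b c = R a b z \<bullet> c" for a b c
  have s: "a u v w = - a u w v" for u v w
    unfolding a_def using N_skew [of u v w] by (simp add: inner_commute)
  have r: "r u v w = a u v w - a v u w" for u v w
    by (simp add: r_def a_def R_z inner_diff_left)
  have r_R: "r u v w = R z w u \<bullet> v" for u v w
    unfolding r_def by (rule R_pair)
  have cyc: "R z u v \<bullet> w + R z v w \<bullet> u + R z w u \<bullet> v = 0" for u v w
  proof -
    have "R u v w \<bullet> z + R v w u \<bullet> z + R w u v \<bullet> z = 0"
      using arg_cong [OF R_bianchi [of u v w], of "\<lambda>y. y \<bullet> z"] by (simp add: inner_add_left)
    moreover have "R u v w \<bullet> z = - (R z w u \<bullet> v)" for u v w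
      using R_pair [of u v w z] R_alt [of w z u] by simp
    ultimately show ?thesis
      by (smt (verit))
  qed
  have cyc': "r u v w + r v w u + r w u v = 0" for u v w
    using cyc [of u v w] by (simp add: r_R)
  have "a u v w + a v w u + a w u v = 0"
    using cyc' [of u v w] s [of u v w] s [of v w u] s [of w u v]
    by (simp add: r)
  then show "N u v \<bullet> w + N v w \<bullet> u + N w u \<bullet> v = 0"
    by (simp add: a_def)
  have "r v w u = a v w u - a w v u"
    by (rule r)
  then have "R z u v \<bullet> w = a v w u - a w v u"
    using r_R by simp
  with \<open>a u v w + a v w u + a w u v = 0\<close> s [of w v u]
  show "N u v \<bullet> w = - (R z u v \<bullet> w)"
    by (simp add: a_def)
qed

text \<open>In the cyclic sum at z the other two terms are given by the symmetric operator h^2 and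
  cancel.\<close>

lemma N_1z [simp]: "N z u = 0"
proof -
  have "N z u \<bullet> v = 0" for v
    using N_cyclic [of z u v] h_h_sym [of u v]
    by (simp add: N_inner_z N_z inner_commute [of u])
  then show ?thesis
    using inner_eq_zero_iff by blast
qed

section \<open>The 3-form \<open>al\<close> and its contractions with h\<close>

definition al where "al u v w = A u v \<bullet> w"

lemma al_12: "al u v w = - al v u w"
  unfolding al_def using A_alt [of u v] by simp

lemma al_23: "al u v w = - al u w v"
  unfolding al_def using A_skew [of u v w] by (simp add: inner_commute)

lemma al_neg [simp]:
  "al (- u) v w = - al u v w" "al u (- v) w = - al u v w" "al u v (- w) = - al u v w"
  by (simp_all add: al_def linear_neg [OF linear_A1])

text \<open>Orthogonality to z kills the right-hand side of \<open>A_th\<close> when it is paired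
  with w.\<close>

lemma al_th_23:
  assumes "z \<bullet> v = 0" "z \<bullet> w = 0"
  shows "al u (\<theta> v) w = al u v (\<theta> w)"
  using arg_cong [OF A_th [of u v], of "\<lambda>y. y \<bullet> w"] th_skew [of "A u v" w] assms
  by (simp add: al_def inner_add_left inner_commute [of v z] inner_commute [of w z])

lemma al_th_12:
  assumes "z \<bullet> u = 0" "z \<bullet> v = 0"
  shows "al (\<theta> u) v w = al u (\<theta> v) w"
  using al_th_23 [of u v w] assms
  by (smt (verit) al_12 al_23 al_th_23)

text \<open>By \<open>T_2z\<close> this equals \<open>al v (h u) w - T u z v \<bullet> w\<close>.
  The first term is skew in v and w because \<open>al\<close> is, the second because T is.\<close>

definition P where "P u v w = N u v \<bullet> \<theta> w - al u (h v) w"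

lemma T_2z: "T w z u = A w (h u) + A u (h w) + \<theta> (N w u)"
  using T_alt [of w z u] T_z [of w u] by simp

lemma P_23: "P u v w = - P u w v"
proof -
  have "T u z v \<bullet> w + T u z w \<bullet> v = 0"
    using T_skew [of u z v w] by (simp add: inner_commute)
  then show ?thesis
    using al_23 [of v "h u" w] al_12 [of v "h u" w] al_23 [of w "h u" v] al_12 [of w "h u" v]
      al_12 [of w v "h u"] al_23 [of "h u" v w]
    by (simp add: T_2z P_def inner_add_left th_skew al_def)
qed

text \<open>The Ricci identity exchanges the first two slots of \<open>T u z v\<close>; the
  curvature terms are N again by \<open>N_eq_R\<close>, and \<open>P_23\<close> removes the
  remaining \<open>N u w\<close>. This leaves -3 P plus terms in \<open>al\<close>, and the
  alternation of \<open>T z u v\<close> in u and v forces the skewness of P.\<close>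

lemma P_12: "P u v w = - P v u w"
proof -
  have T: "T z u v \<bullet> w = - 3 * (N u v \<bullet> \<theta> w) + 2 * al u (h v) w + al u (h w) v + al v (h u) w" for u v w
  proof -
    have "T z u v \<bullet> w = T u z v \<bullet> w + R z u (\<theta> v) \<bullet> w - \<theta> (R z u v) \<bullet> w"
      using arg_cong [OF T_ricci [of z u v], of "\<lambda>y. y \<bullet> w"]
      by (simp add: inner_diff_left)
    also have "\<dots> = T u z v \<bullet> w - N u (\<theta> v) \<bullet> w - N u v \<bullet> \<theta> w"
      by (simp add: th_skew N_eq_R)
    also have "\<dots> = al u (h v) w + al v (h u) w - 2 * (N u v \<bullet> \<theta> w) + N u w \<bullet> \<theta> v"
      using N_skew [of u "\<theta> v" w]
      by (simp add: T_2z inner_add_left th_skew al_def inner_commute [of v "\<theta> (N u w)"])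
    finally show ?thesis
      using P_23 [of u v w] by (simp add: P_def)
  qed
  have "T z u v \<bullet> w = - (T z v u \<bullet> w)"
    using T_alt [of z u v] by simp
  then show ?thesis
    using al_12 [of u "h w" v] al_23 [of "h w" u v] al_12 [of "h w" v u]
    unfolding T P_def by simp
qed

text \<open>Since \<theta>^2 = -1 off z, N itself is expressed by P with \<theta> in its last
  argument. For the three values \<open>p1\<close>, \<open>p2\<close>, \<open>p3\<close> with
  \<theta> in one slot, the skewness of N gives two differences and \<open>N_cyclic\<close> gives
  the sum; the linear system is solved for \<open>p3\<close>.\<close>

lemma P_th:
  assumes "z \<bullet> u = 0" "z \<bullet> v = 0" "z \<bullet> w = 0"
  shows "3 * P u v (\<theta> w) = al u v (\<theta> (h w)) - 2 * al (h u) v (\<theta> w) - 2 * al u (h v) (\<theta> w)"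
proof -
  have N: "N u v \<bullet> w = - P u v (\<theta> w) - al u (h v) (\<theta> w)" if "z \<bullet> w = 0" for u v w
    using that by (simp add: P_def th_th)
  have N23: "N u v \<bullet> w = - (N u w \<bullet> v)" for u v w
    using N_skew [of u v w] by (simp add: inner_commute)
  have al: "al u (\<theta> v) w = al u v (\<theta> w)" if "z \<bullet> v = 0" "z \<bullet> w = 0" for u v w
    by (rule al_th_23 [OF that])
  define p1 where "p1 = P (\<theta> u) v w"
  define p2 where "p2 = P u (\<theta> v) w"
  define p3 where "p3 = P u v (\<theta> w)"
  define b1 where "b1 = al (h u) v (\<theta> w)"
  define b2 where "b2 = al u (h v) (\<theta> w)"
  define b3 where "b3 = al u v (\<theta> (h w))"
  have e32: "p3 - p2 = b3 - b2"
  proof -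
    have "p3 + P u w (\<theta> v) = - b2 - al u (h w) (\<theta> v)"
      using N23 [of u v w] assms by (simp add: N p3_def b2_def)
    moreover have "P u w (\<theta> v) = - p2"
      unfolding p2_def by (rule P_23)
    moreover have "al u (h w) (\<theta> v) = - b3"
      using al_23 [of u "h w" "\<theta> v"] al [of v "h w" u] assms by (simp add: b3_def al)
    ultimately show ?thesis by simp
  qed
  have e13: "p1 - p3 = b1 - b3"
  proof -
    have "N v w \<bullet> u = - P v w (\<theta> u) - al v (h w) (\<theta> u)"
      using N assms by simp
    moreover have "N v u \<bullet> w = - P v u (\<theta> w) - al v (h u) (\<theta> w)"
      using N assms by simp
    moreover have "P v w (\<theta> u) = p1"
      unfolding p1_def using P_12 P_23 by metis
    moreover have "P v u (\<theta> w) = - p3"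
      unfolding p3_def by (rule P_12)
    moreover have "al v (h w) (\<theta> u) = b3"
      using al_th_12 al_th_23 assms unfolding b3_def
      by (smt (verit) al_12 al_23 h_perp(2))
    moreover have "al v (h u) (\<theta> w) = - b1"
      unfolding b1_def by (rule al_12)
    ultimately show ?thesis using N23 [of v w u] by simp
  qed
  have "N w u \<bullet> v = - p2 - b1"
  proof -
    have "P w u (\<theta> v) = p2"
      unfolding p2_def using P_12 P_23 by metis
    moreover have "al w (h u) (\<theta> v) = b1"
      using al_th_12 al_th_23 assms unfolding b1_def
      by (smt (verit) al_12 al_23 h_perp(2))
    ultimately show ?thesis using N assms by simp
  qed
  moreover have "N u v \<bullet> w = - p3 - b2"
    using N assms unfolding p3_def b2_def by simp
  moreover have "N v w \<bullet> u = - p1 - b3"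
  proof -
    have "P v w (\<theta> u) = p1"
      unfolding p1_def using P_12 P_23 by metis
    moreover have "al v (h w) (\<theta> u) = b3"
      using al_th_12 al_th_23 assms unfolding b3_def
      by (smt (verit) al_12 al_23 h_perp(2))
    ultimately show ?thesis using N assms by simp
  qed
  ultimately show ?thesis
    using N_cyclic [of u v w] e32 e13
    by (simp add: b1_def b2_def b3_def p3_def)
qed

text \<open>Skewness of \<open>P\<close> applied to the previous formula shows that \<open>h\<close> may be moved between the slots of
  \<open>al\<close>; since \<open>\<theta>\<close> may be moved as well but anticommutes with \<open>h\<close>, the form then vanishes.\<close>

lemma al_h_13:
  assumes "z \<bullet> u = 0" "z \<bullet> v = 0" "z \<bullet> w = 0"
  shows "al (h u) v w = al u v (h w)"
proof -
  \<comment> \<open>P changes sign when its outer slots are exchanged, so the sum of these two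
    instances has left-hand side 0. On the right the terms with h in the middle slot cancel too, and
    the coefficients -2 and 1 leave one copy of each remaining term.\<close>
  have 1: "3 * P (\<theta> u) v (\<theta> w) = al (\<theta> u) v (\<theta> (h w)) - 2 * al (h (\<theta> u)) v (\<theta> w) - 2 * al (\<theta> u) (h v) (\<theta> w)"
    using P_th [of "\<theta> u" v w] assms by simp
  have 2: "3 * P (\<theta> w) v (\<theta> u) = al (\<theta> w) v (\<theta> (h u)) - 2 * al (h (\<theta> w)) v (\<theta> u) - 2 * al (\<theta> w) (h v) (\<theta> u)"
    using P_th [of "\<theta> w" v u] assms by simp
  have 3: "P (\<theta> w) v (\<theta> u) = - P (\<theta> u) v (\<theta> w)"
    using P_12 P_23 by metis
  have s: "al c b a = - al a b c" for a b c
    using al_12 al_23 by metis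
  have t: "al (\<theta> a) b (\<theta> c) = - al a b c" if "z \<bullet> a = 0" "z \<bullet> b = 0" "z \<bullet> c = 0" for a b c
    using al_th_12 [of a b "\<theta> c"] al_th_23 [of b "\<theta> c" a] al_th_23 [of "\<theta> b" c a] that
    by (simp add: al_th_23 th_th)
  have a: "al (\<theta> u) v (\<theta> (h w)) = - al u v (h w)" "al (\<theta> w) v (\<theta> (h u)) = - al w v (h u)"
      "al (\<theta> u) (h v) (\<theta> w) = - al u (h v) w" "al (\<theta> w) (h v) (\<theta> u) = - al w (h v) u"
    using t [of u v "h w"] t [of w v "h u"] t [of u "h v" w] t [of w "h v" u] assms by simp_all
  have a': "al (h (\<theta> u)) v (\<theta> w) = al (h u) v w" "al (h (\<theta> w)) v (\<theta> u) = al (h w) v u"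
    using t [of "h u" v w] t [of "h w" v u] assms by (simp_all add: th_h)
  show ?thesis
    using 1 2 3 s [of w "h v" u] s [of u v "h w"] s [of w v "h u"] unfolding a a' by simp
qed

lemma al_h_3_eq_0:
  assumes "z \<bullet> u = 0" "z \<bullet> v = 0" "z \<bullet> w = 0"
  shows "al u v (h w) = 0"
proof -
  have m: "al (h u) v w = al u (h v) w" if "z \<bullet> u = 0" "z \<bullet> v = 0" "z \<bullet> w = 0" for u v w
    using al_h_13 [of u w v] that al_23 [of "h u" v w] al_23 [of u w "h v"] by simp
  have k: "al u v (h (\<theta> w)) = 0" if "z \<bullet> u = 0" "z \<bullet> v = 0" "z \<bullet> w = 0" for u v w
  proof -
    have "al u v (h (\<theta> w)) = - al u (\<theta> v) (h w)"
      using that th_h [of w] al_th_23 [of v "h w" u] by simp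
    also have "\<dots> = - al (h u) (\<theta> v) w"
      using al_h_13 [of u "\<theta> v" w] that by simp
    also have "\<dots> = - al (h u) v (\<theta> w)"
      using al_th_23 [of v w "h u"] that by simp
    also have "\<dots> = - al u v (h (\<theta> w))"
      using al_h_13 [of u v "\<theta> w"] that by simp
    finally show ?thesis by simp
  qed
  show ?thesis
    using k [of u v "\<theta> w"] assms by (simp add: th_th)
qed

lemma al_h_eq_0:
  assumes "z \<bullet> u = 0" "z \<bullet> v = 0" "z \<bullet> w = 0"
  shows "al (h u) v w = 0" "al u (h v) w = 0" "al u v (h w) = 0"
  using al_h_3_eq_0 [OF assms] al_h_13 [OF assms] al_h_3_eq_0 [of u w v] al_23 [of u "h v" w] assms
  by simp_all

text \<open>In \<open>P_th\<close> each term contains a value of h inside \<open>al\<close>, hence P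
  vanishes and with it N. For general u the component along z contributes nothing by
  \<open>N_1z\<close>.\<close>

lemma N_eq_0:
  assumes "z \<bullet> v = 0" "z \<bullet> w = 0"
  shows "N u v \<bullet> w = 0"
proof -
  have *: "N u v \<bullet> w = 0" if "z \<bullet> u = 0" for u
  proof -
    have "P u v (\<theta> w) = 0"
      using P_th [of u v w] that assms al_h_eq_0(1) [of u v "\<theta> w"] al_h_eq_0(2) [of u v "\<theta> w"]
        al_h_eq_0(3) [of u v "\<theta> w"] by (simp add: th_h)
    moreover have "al u (h v) (\<theta> w) = 0"
      using that assms al_h_eq_0(2) [of u v "\<theta> w"] by simp
    ultimately show ?thesis
      using assms by (simp add: P_def th_th)
  qed
  have "N (u - (z \<bullet> u) *\<^sub>R z) v \<bullet> w = 0"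
    by (rule *) (simp add: inner_diff_right)
  then show ?thesis by simp
qed


section \<open>Traces over the basis\<close>

lemma linear_Basis_expand:
  assumes "linear f"
  shows "f x = (\<Sum>b\<in>Basis. (x \<bullet> b) *\<^sub>R f (b :: 'e))"
proof -
  have "f (\<Sum>b\<in>Basis. (x \<bullet> b) *\<^sub>R b) = (\<Sum>b\<in>Basis. (x \<bullet> b) *\<^sub>R f b)"
    using assms by (simp add: linear_sum linear_scale)
  then show ?thesis
    by (simp add: euclidean_representation)
qed

text \<open>Both sums contract f with the matrix of \<theta>, which is antisymmetric.\<close>

lemma trace_th:
  fixes f :: "'e \<Rightarrow> 'e \<Rightarrow> real"
  assumes 1: "\<And>v. linear (\<lambda>u. f u v)" and 2: "\<And>u. linear (f u)"
  shows "(\<Sum>b\<in>Basis. f b (\<theta> b)) = - (\<Sum>b\<in>Basis. f (\<theta> b) b)"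
proof -
  have "(\<Sum>b\<in>Basis. f b (\<theta> b)) = (\<Sum>b\<in>Basis. \<Sum>c\<in>Basis. (\<theta> b \<bullet> c) * f b c)"
    by (intro sum.cong refl) (subst linear_Basis_expand [OF 2], simp)
  also have "\<dots> = (\<Sum>c\<in>Basis. \<Sum>b\<in>Basis. (\<theta> b \<bullet> c) * f b c)"
    by (rule sum.swap)
  also have "\<dots> = (\<Sum>c\<in>Basis. - (\<Sum>b\<in>Basis. (\<theta> c \<bullet> b) * f b c))"
    unfolding sum_negf [symmetric]
    by (intro sum.cong refl) (metis inner_commute mult_minus_left th_skew)
  also have "\<dots> = - (\<Sum>b\<in>Basis. f (\<theta> b) b)"
    unfolding sum_negf
    by (intro arg_cong [of _ _ uminus] sum.cong refl) (subst (2) linear_Basis_expand [OF 1], simp)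
  finally show ?thesis .
qed

lemma sum_Basis_z: "(\<Sum>b\<in>Basis. f b) = f z + (\<Sum>b\<in>Basis - {z}. f b)"
  using z_Basis by (simp add: sum.remove)

lemma Basis_perp:
  assumes "b \<in> Basis - {z}"
  shows "z \<bullet> b = 0" "b \<bullet> z = 0"
  using assms z_Basis by (auto simp: inner_not_same_Basis)

definition pr where "pr v = v - (v \<bullet> z) *\<^sub>R z"

lemma pr_perp [simp]: "pr v \<bullet> z = 0" "z \<bullet> pr v = 0"
  by (simp_all add: pr_def inner_diff_left inner_diff_right inner_commute)

lemma pr_inner: "z \<bullet> w = 0 \<Longrightarrow> pr v \<bullet> w = v \<bullet> w"
  by (simp add: pr_def inner_diff_left)

lemma th_pr [simp]: "\<theta> (pr v) = \<theta> v"
  by (simp add: pr_def)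

lemma eq_0_if_perp:
  assumes "z \<bullet> v = 0" "\<And>w. z \<bullet> w = 0 \<Longrightarrow> v \<bullet> w = 0"
  shows "v = 0"
  using assms inner_eq_zero_iff by blast

lemma linear_pr: "linear pr"
  by (rule linearI) (simp_all add: pr_def algebra_simps)

text \<open>With this sign convention \<open>ric\<close> is minus the Ricci tensor and
  \<open>\<rho>\<close> the same trace twisted by \<theta>; \<open>D\<close> represents minus the
  rough Laplacian of \<theta>.\<close>

definition \<rho> where "\<rho> y v = (\<Sum>b\<in>Basis. R b y (\<theta> b) \<bullet> v)"
definition ric where "ric y v = (\<Sum>b\<in>Basis. R b y b \<bullet> v)"
definition D where "D y v = (\<Sum>b\<in>Basis. T b b y \<bullet> v)"

text \<open>As \<open>T y b b\<close> vanishes by alternation, the Ricci identity expresses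
  \<open>T b y b\<close> by curvature alone.\<close>

lemma D_eq: "D y v = - \<rho> y v - ric y (\<theta> v)"
proof -
  have "T b b y \<bullet> v = - (R b y (\<theta> b) \<bullet> v) - R b y b \<bullet> \<theta> v" for b
  proof -
    have "T y b b = 0"
      using T_alt [of y b b] by (simp add: eq_neg_self)
    then have "T b y b = R b y (\<theta> b) - \<theta> (R b y b)"
      using T_ricci [of b y b] by simp
    then show ?thesis
      using T_alt [of b b y] by (simp add: inner_diff_left th_skew)
  qed
  then show ?thesis
    unfolding D_def \<rho>_def ric_def by (simp add: sum_subtractf sum_negf)
qed

lemma D_skew: "D y v = - D v y"
proof -
  have "T b b y \<bullet> v = - (T b b v \<bullet> y)" for b
    using T_skew [of b b y v] by (simp add: inner_commute)
  then show ?thesis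
    unfolding D_def sum_negf [symmetric] by simp
qed

text \<open>Pair symmetry carries \<theta> to the other traced slot, and \<open>trace_th\<close>
  carries it back with a sign.\<close>

lemma rho_skew: "\<rho> y v = - \<rho> v y"
proof -
  have "\<rho> y v = (\<Sum>b\<in>Basis. R (\<theta> b) v b \<bullet> y)"
    unfolding \<rho>_def by (intro sum.cong refl) (rule R_pair)
  also have "\<dots> = - \<rho> v y"
    unfolding \<rho>_def
    by (subst trace_th [where f = "\<lambda>u w. R u v w \<bullet> y"])
      (auto intro!: linearI simp: inner_add_left)
  finally show ?thesis .
qed

lemma ric_sym: "ric y v = ric v y"
  unfolding ric_def by (intro sum.cong refl) (rule R_pair)

text \<open>The Bianchi identity yields two terms, and \<open>trace_th\<close> shows that each has
  trace \<rho>; hence the factor 2.\<close>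

lemma sum_R_th: "(\<Sum>b\<in>Basis. R b (\<theta> b) y \<bullet> v) = 2 * \<rho> y v"
proof -
  have "R b (\<theta> b) y \<bullet> v = R b y (\<theta> b) \<bullet> v - R (\<theta> b) y b \<bullet> v" for b
    using arg_cong [OF R_bianchi [of b "\<theta> b" y], of "\<lambda>x. x \<bullet> v"] R_alt [of y b "\<theta> b"]
    by (simp add: inner_add_left inner_diff_left)
  moreover have "(\<Sum>b\<in>Basis. R (\<theta> b) y b \<bullet> v) = - \<rho> y v"
    unfolding \<rho>_def
    by (subst trace_th [where f = "\<lambda>u w. R u y w \<bullet> v"])
      (auto intro!: linearI simp: inner_add_left)
  ultimately show ?thesis
    by (simp add: sum_subtractf \<rho>_def)
qed

text \<open>For b orthogonal to z, \<open>T_th\<close> expresses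
  \<open>T b b (\<theta> y) \<bullet> v\<close> as \<open>T b (\<theta> b) y \<bullet> v\<close>
  plus products of \<open>A\<close> and \<open>h\<close> that are symmetric in y and v. The
  difference removes the products and doubles the skew term. For b = z the right-hand side is 0 and
  symmetry of h^2 suffices.\<close>

lemma T_swap_th:
  assumes "b \<in> Basis" "z \<bullet> y = 0" "z \<bullet> v = 0"
  shows "T b b (\<theta> y) \<bullet> v - T b b (\<theta> v) \<bullet> y = 2 * (T b (\<theta> b) y \<bullet> v)"
proof (cases "b = z")
  case True
  have "T z z (\<theta> y) \<bullet> v = - (h (h (\<theta> y)) \<bullet> \<theta> v)" for y v
    by (simp add: T_2z A_1z th_skew)
  then show ?thesis
    using h_h_sym [of "\<theta> y" "\<theta> v"] by (simp add: True inner_commute linear_0 [OF linear_T2])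
next
  case False
  with assms(1) have b: "z \<bullet> b = 0" "b \<bullet> z = 0"
    using Basis_perp by blast+
  have A0: "A b b = 0"
    using A_alt [of b b] by (simp add: eq_neg_self)
  have hb: "h b \<bullet> b = 0"
    using h_skew [of b b] by (simp add: inner_commute)
  have T23: "T b u w \<bullet> x = - (T b u x \<bullet> w)" for u w x
    using T_skew [of b u w x] by (simp add: inner_commute)
  have T12: "T b u w \<bullet> x = - (T b w u \<bullet> x)" for u w x
    using T_alt [of b u w] by simp
  have *: "T b b (\<theta> y) \<bullet> v = T b (\<theta> b) y \<bullet> v + A b v \<bullet> A b y + (h b \<bullet> v) * (h b \<bullet> y)"
    if "z \<bullet> y = 0" for y v
  proof -
    have "T b v (\<theta> b) \<bullet> y + \<theta> (T b v b) \<bullet> y + A b (A v b) \<bullet> y = (h v \<bullet> b) * (h b \<bullet> y)"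
      using arg_cong [OF T_th [of b v b], of "\<lambda>x. x \<bullet> y"] that b A0 hb
      by (simp add: inner_add_left)
    moreover have "A b (A v b) \<bullet> y = A b v \<bullet> A b y"
      using A_skew [of b "A v b" y] A_alt [of v b] by simp
    moreover have "h v \<bullet> b = - (h b \<bullet> v)"
      using h_skew [of v b] by (simp add: inner_commute)
    moreover have "T b v (\<theta> b) \<bullet> y = T b (\<theta> b) y \<bullet> v"
      using T23 T12 by metis
    moreover have "\<theta> (T b v b) \<bullet> y = - (T b b (\<theta> y) \<bullet> v)"
      using T23 T12 th_skew by metis
    ultimately show ?thesis
      by simp
  qed
  show ?thesis
    using * [of y v] * [of v y] T23 [of "\<theta> b" v y] assms by (simp add: inner_commute)
qed

text \<open>With \<open>E\<close> and \<open>r\<close> as in the proof, commuting the two derivatives gives \<open>E = - r\<close>, whereas moving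
  \<open>\<theta>\<close> between the slots of \<open>T\<close> gives \<open>E = 2 r\<close>.\<close>

lemma D_th:
  assumes y: "z \<bullet> y = 0" and v: "z \<bullet> v = 0"
  shows "D (\<theta> y) v + D y (\<theta> v) = 0"
proof -
  define E where "E = D (\<theta> y) v + D y (\<theta> v)"
  define r where "r = \<rho> (\<theta> y) v + \<rho> y (\<theta> v)"
  have "ric (\<theta> y) (\<theta> v) + ric y (\<theta> (\<theta> v)) = 0"
  proof -
    \<comment> \<open>D and \<rho> are skew, hence so is the third term in
      \<open>D_eq\<close>.\<close>
    have "ric y (\<theta> v) = - ric v (\<theta> y)" for y v
      using D_eq [of y v] D_eq [of v y] D_skew [of y v] rho_skew [of y v] by simp
    from this [of "\<theta> y" v] have "ric (\<theta> y) (\<theta> v) = ric v y"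
      using y by (simp add: th_th ric_def sum_negf)
    moreover have "ric y (\<theta> (\<theta> v)) = - ric y v"
      using v by (simp add: th_th ric_def sum_negf)
    ultimately show ?thesis
      using ric_sym by simp
  qed
  then have 1: "E = - r"
    by (simp add: E_def r_def D_eq)
  have "E = D (\<theta> y) v - D (\<theta> v) y"
    unfolding E_def using D_skew [of y "\<theta> v"] by simp
  also have "\<dots> = 2 * (\<Sum>b\<in>Basis. T b (\<theta> b) y \<bullet> v)"
    unfolding D_def sum_subtractf [symmetric] sum_distrib_left
    using assms by (intro sum.cong refl T_swap_th)
  \<comment> \<open>One of the two copies is rewritten by \<open>trace_th\<close>, which produces
    the commutator of two derivatives and hence curvature.\<close>
  also have "\<dots> = (\<Sum>b\<in>Basis. T b (\<theta> b) y \<bullet> v) - (\<Sum>b\<in>Basis. T (\<theta> b) b y \<bullet> v)"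
  proof -
    have "linear (\<lambda>w. T u w y \<bullet> v)" for u
      by (auto intro!: linearI simp: inner_add_left linear_add [OF linear_T2] linear_scale [OF linear_T2])
    then have "(\<Sum>b\<in>Basis. T b (\<theta> b) y \<bullet> v) = - (\<Sum>b\<in>Basis. T (\<theta> b) b y \<bullet> v)"
      by (intro trace_th) (auto intro!: linearI simp: inner_add_left)
    then show ?thesis by simp
  qed
  also have "\<dots> = (\<Sum>b\<in>Basis. R b (\<theta> b) (\<theta> y) \<bullet> v + R b (\<theta> b) y \<bullet> \<theta> v)"
    unfolding sum_subtractf [symmetric] inner_diff_left [symmetric] T_ricci
    by (simp add: inner_diff_left th_skew)
  also have "\<dots> = 2 * r"
    by (simp add: sum.distrib sum_R_th r_def)
  finally have "E = 2 * r" .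
  with 1 show ?thesis
    unfolding E_def by simp
qed

text \<open>\<open>L\<close> is the trace of the second derivative of J for the projected
  connection, in the form found in \<open>cov2_J\<close>. Its sums over h collapse to h^2 composed
  with \<theta>, and h^2 commutes with \<theta>; the other part is \<open>D_th\<close>.\<close>

lemma laplacian_J_commutes:
  defines "L \<equiv> \<lambda>y. \<Sum>b\<in>Basis. pr (T b b y) + (\<theta> y \<bullet> h b) *\<^sub>R h b + (y \<bullet> h b) *\<^sub>R \<theta> (h b)"
  assumes y: "z \<bullet> y = 0"
  shows "L (\<theta> y) = \<theta> (L y)"
proof -
  define S where "S y = (\<Sum>b\<in>Basis. T b b y)" for y
  have h: "(\<Sum>b\<in>Basis. (y \<bullet> h b) *\<^sub>R f (h b)) = - f (h (h y))" if "linear f" for f :: "'e \<Rightarrow> 'e" and y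
  proof -
    have "linear (\<lambda>x. f (h x))"
      using linear_compose [OF lin_h that] by (simp add: o_def)
    from linear_Basis_expand [OF this, of "h y"]
    have "f (h (h y)) = (\<Sum>b\<in>Basis. (h y \<bullet> b) *\<^sub>R f (h b))" .
    then show ?thesis
      by (simp add: h_skew sum_negf)
  qed
  have L: "L y = pr (S y) - h (h (\<theta> y)) - \<theta> (h (h y))" for y
    using h [of "\<lambda>x. x" "\<theta> y"] h [OF lin_th, of y]
    by (simp add: L_def S_def sum.distrib linear_sum [OF linear_pr] linear_ident)
  have "pr (S (\<theta> y)) - \<theta> (S y) = 0"
  proof (rule eq_0_if_perp)
    fix v assume v: "z \<bullet> v = 0"
    have "S u \<bullet> w = D u w" for u w
      by (simp add: S_def D_def inner_sum_left)
    then show "(pr (S (\<theta> y)) - \<theta> (S y)) \<bullet> v = 0"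
      using D_th [OF y v] v by (simp add: inner_diff_left pr_inner th_skew)
  qed (simp add: inner_diff_right)
  then have "pr (S (\<theta> y)) = \<theta> (S y)"
    by simp
  then show ?thesis
    by (simp add: L th_h_h)
qed

text \<open>Every summand vanishes separately, so the second harmonic section equation loses its J
  term.\<close>

lemma sum_A_h: "(\<Sum>b\<in>Basis. pr (A b (h b))) = 0"
proof (rule sum.neutral, rule ballI)
  fix b :: 'e assume b: "b \<in> Basis"
  show "pr (A b (h b)) = 0"
  proof (rule eq_0_if_perp)
    fix w assume w: "z \<bullet> w = 0"
    show "pr (A b (h b)) \<bullet> w = 0"
    proof (cases "b = z")
      case False
      then have "al b (h b) w = 0"
        using al_h_eq_0(2) [of b b w] w b Basis_perp by blast
      then show ?thesis
        using w by (simp add: pr_inner al_def)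
    qed (simp add: w pr_inner)
  qed simp
qed

lemma sum_N: "(\<Sum>b\<in>Basis. N b b) = - (\<Sum>b\<in>Basis. h b \<bullet> h b) *\<^sub>R z"
proof -
  have "N b b = - (h b \<bullet> h b) *\<^sub>R z" if b: "b \<in> Basis" for b
  proof -
    have 1: "N b b \<bullet> z = - (h b \<bullet> h b)"
      by (simp add: N_inner_z h_skew [of "h b" b] h_skew [of b "h b"])
    have "pr (N b b) = 0"
    proof (rule eq_0_if_perp)
      fix w assume w: "z \<bullet> w = 0"
      show "pr (N b b) \<bullet> w = 0"
        using N_eq_0 [of b w b] b Basis_perp w by (cases "b = z") (auto simp: pr_inner)
    qed simp
    then show ?thesis
      using 1 by (simp add: pr_def eq_neg_iff_add_eq_0)
  qed
  then show ?thesis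
    by (simp add: sum_negf scaleR_left.sum)
qed

text \<open>\<open>R_z\<close> reduces the curvature to N, which vanishes off z; the component of x
  along z contributes h(hb), orthogonal to hb by skewness.\<close>

lemma h_inner_R_z:
  assumes "b \<in> Basis"
  shows "h b \<bullet> R b x z = 0"
proof (cases "b = z")
  case False
  then have b: "z \<bullet> b = 0"
    using assms Basis_perp by blast
  have "N b x \<bullet> h b = 0"
  proof -
    have "N b (pr x) \<bullet> h b = 0"
      by (rule N_eq_0) simp_all
    moreover have "h (h b) \<bullet> h b = 0"
      using h_skew [of "h b" "h b"] by (simp add: inner_commute)
    ultimately show ?thesis
      by (simp add: pr_def N_z inner_diff_left inner_add_left)
  qed
  moreover have "N x b \<bullet> h b = 0"
    by (rule N_eq_0 [OF b]) simp
  ultimately show ?thesis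
    by (simp add: R_z inner_diff_right inner_commute)
qed simp

text \<open>\<open>\<Psi>\<close> is cyclically invariant, so three times the sum is its contraction
  with the cyclic sum of R, which is zero.\<close>

lemma sum_A_th_R:
  "(\<Sum>i\<in>Basis - {z}. \<Sum>j\<in>Basis - {z}. \<theta> (A i j) \<bullet> R i x j) = 0"
proof -
  define B where "B = Basis - {z}"
  have perp: "z \<bullet> b = 0" if "b \<in> B" for b
    using that Basis_perp unfolding B_def by blast
  define \<Psi> where "\<Psi> i j k = \<theta> (A i j) \<bullet> k" for i j k
  define r where "r i j k = R i j k \<bullet> x" for i j k
  define c where "c i j k = \<Psi> i j k * r i j k" for i j k
  have cyc: "\<Psi> j k i = \<Psi> i j k" if "i \<in> B" "j \<in> B" "k \<in> B" for i j k
  proof -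
    have "al j k (\<theta> i) = al j (\<theta> k) i"
      using al_th_23 [of k i j] perp that by simp
    then have "al j k (\<theta> i) = al i j (\<theta> k)"
      using al_12 al_23 by metis
    then show ?thesis
      by (simp add: \<Psi>_def th_skew al_def)
  qed
  have rot: "(\<Sum>i\<in>B. \<Sum>j\<in>B. \<Sum>k\<in>B. f j k i) = (\<Sum>i\<in>B. \<Sum>j\<in>B. \<Sum>k\<in>B. f i j k)"
    for f :: "'e \<Rightarrow> 'e \<Rightarrow> 'e \<Rightarrow> real"
  proof -
    have "(\<Sum>i\<in>B. \<Sum>j\<in>B. \<Sum>k\<in>B. f j k i) = (\<Sum>j\<in>B. \<Sum>i\<in>B. \<Sum>k\<in>B. f j k i)"
      by (rule sum.swap)
    also have "\<dots> = (\<Sum>j\<in>B. \<Sum>k\<in>B. \<Sum>i\<in>B. f j k i)"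
      by (intro sum.cong [OF refl] sum.swap)
    finally show ?thesis .
  qed
  \<comment> \<open>Pair symmetry brings x to the last slot, leaving i, j, k to the Bianchi
    identity. The component k = z is absent because \<theta> takes values orthogonal to z.\<close>
  have "\<theta> (A i j) \<bullet> R i x j = (\<Sum>k\<in>B. c j k i)" if "i \<in> B" "j \<in> B" for i j
  proof -
    have "\<theta> (A i j) \<bullet> R i x j = (\<Sum>k\<in>Basis. \<Psi> i j k * (R i x j \<bullet> k))"
      unfolding \<Psi>_def by (subst euclidean_inner) simp
    also have "\<dots> = (\<Sum>k\<in>B. \<Psi> i j k * (R i x j \<bullet> k))"
      unfolding B_def by (subst sum_Basis_z) (simp add: \<Psi>_def)
    also have "\<dots> = (\<Sum>k\<in>B. c j k i)"
      using that cyc R_pair [of i x j] by (intro sum.cong refl) (simp add: c_def r_def)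
    finally show ?thesis .
  qed
  then have G: "(\<Sum>i\<in>B. \<Sum>j\<in>B. \<theta> (A i j) \<bullet> R i x j) = (\<Sum>i\<in>B. \<Sum>j\<in>B. \<Sum>k\<in>B. c j k i)"
    by simp
  have "0 = (\<Sum>i\<in>B. \<Sum>j\<in>B. \<Sum>k\<in>B. \<Psi> i j k * (r i j k + r j k i + r k i j))"
  proof -
    have "r i j k + r j k i + r k i j = 0" for i j k
      using arg_cong [OF R_bianchi [of i j k], of "\<lambda>y. y \<bullet> x"] by (simp add: r_def inner_add_left)
    then show ?thesis by simp
  qed
  also have "\<dots> = (\<Sum>i\<in>B. \<Sum>j\<in>B. \<Sum>k\<in>B. c i j k + c j k i + c k i j)"
  proof (intro sum.cong refl)
    fix i j k assume "i \<in> B" "j \<in> B" "k \<in> B"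
    then show "\<Psi> i j k * (r i j k + r j k i + r k i j) = c i j k + c j k i + c k i j"
      using cyc [of i j k] cyc [of j k i] unfolding c_def by (simp add: distrib_left)
  qed
  also have "\<dots> = 3 * (\<Sum>i\<in>B. \<Sum>j\<in>B. \<Sum>k\<in>B. c j k i)"
    using rot [of c] rot [of "\<lambda>i j k. c j k i"] by (simp add: sum.distrib)
  finally show ?thesis
    using G unfolding B_def by simp
qed

text \<open>\<open>Rb\<close> is the curvature of the projected connection, in the form found in
  \<open>curvature_nb\<close>. Moving \<theta> from it onto \<open>A\<close> shows that both halves
  of the commutator contribute equally, and the h terms of \<open>Rb\<close> disappear against
  \<open>al\<close>.\<close>

lemma harmonic_map_first_term:
  fixes x :: 'e
  defines "Rb \<equiv> \<lambda>i y. pr (R i x y) + (y \<bullet> h x) *\<^sub>R h i - (y \<bullet> h i) *\<^sub>R h x"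
  shows "(\<Sum>i\<in>Basis. \<Sum>j\<in>Basis - {z}. pr (A i j) \<bullet> (Rb i (\<theta> j) - \<theta> (Rb i j))) = 0"
proof -
  define B where "B = Basis - {z}"
  have perp: "z \<bullet> b = 0" "b \<bullet> z = 0" if "b \<in> B" for b
    using that Basis_perp unfolding B_def by blast+
  have linRb: "linear (Rb i)" for i
    unfolding Rb_def
    by (rule linearI) (simp_all add: linear_add [OF linear_pr] linear_scale [OF linear_pr] algebra_simps inner_add_left)
  have Ath: "pr (A i (\<theta> j)) = - \<theta> (A i j)" if "j \<in> B" for i j
  proof -
    have "A i (\<theta> j) = - \<theta> (A i j) + (h i \<bullet> j) *\<^sub>R z"
      using A_th [of i j] perp [OF that] by (simp add: algebra_simps)
    then show ?thesis
      by (simp add: pr_def inner_diff_left inner_add_left)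
  qed
  have 1: "(\<Sum>j\<in>B. pr (A i j) \<bullet> (Rb i (\<theta> j) - \<theta> (Rb i j))) = 2 * (\<Sum>j\<in>B. \<theta> (A i j) \<bullet> R i x j)"
    if i: "i \<in> Basis" for i
  proof -
    \<comment> \<open>\<open>trace_th\<close> needs the whole basis; z may be added because
      \<theta>z = 0.\<close>
    have "(\<Sum>j\<in>B. pr (A i j) \<bullet> Rb i (\<theta> j)) = (\<Sum>j\<in>Basis. pr (A i j) \<bullet> Rb i (\<theta> j))"
      unfolding B_def by (subst sum_Basis_z) (simp add: linear_0 [OF linRb])
    also have "\<dots> = - (\<Sum>j\<in>Basis. pr (A i (\<theta> j)) \<bullet> Rb i j)"
      by (rule trace_th)
        (auto intro!: linearI simp: inner_add_left inner_add_right linear_add [OF linRb] linear_scale [OF linRb]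
          linear_add [OF linear_pr] linear_scale [OF linear_pr])
    also have "\<dots> = - (\<Sum>j\<in>B. pr (A i (\<theta> j)) \<bullet> Rb i j)"
      unfolding B_def by (subst sum_Basis_z) (simp add: linear_0 [OF linear_pr])
    also have "\<dots> = (\<Sum>j\<in>B. \<theta> (A i j) \<bullet> Rb i j)"
      by (simp add: Ath sum_negf)
    finally have "(\<Sum>j\<in>B. pr (A i j) \<bullet> (Rb i (\<theta> j) - \<theta> (Rb i j))) = (\<Sum>j\<in>B. 2 * (\<theta> (A i j) \<bullet> Rb i j))"
    proof -
      assume *: "(\<Sum>j\<in>B. pr (A i j) \<bullet> Rb i (\<theta> j)) = (\<Sum>j\<in>B. \<theta> (A i j) \<bullet> Rb i j)"
      have "pr (A i j) \<bullet> \<theta> (Rb i j) = - (\<theta> (A i j) \<bullet> Rb i j)" for j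
        using th_skew [of "pr (A i j)" "Rb i j"] by simp
      then show ?thesis
        using * by (simp add: inner_diff_right sum.distrib sum_distrib_left [symmetric])
    qed
    also have "\<dots> = 2 * (\<Sum>j\<in>B. \<theta> (A i j) \<bullet> R i x j)"
      unfolding sum_distrib_left
    proof (intro sum.cong refl)
      fix j assume j: "j \<in> B"
      have "\<theta> (A i j) \<bullet> h w = 0" if "i \<noteq> z" for w
      proof -
        have "z \<bullet> i = 0"
          using i that perp(1) unfolding B_def by blast
        then have "al i j (h (\<theta> w)) = 0"
          using perp(1) [OF j] by (intro al_h_3_eq_0) simp_all
        then show ?thesis
          by (simp add: th_skew th_h al_def)
      qed
      then have "\<theta> (A i j) \<bullet> Rb i j = \<theta> (A i j) \<bullet> pr (R i x j)"
        unfolding Rb_def by (cases "i = z") (simp_all add: inner_add_right inner_diff_right)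
      then show "2 * (\<theta> (A i j) \<bullet> Rb i j) = 2 * (\<theta> (A i j) \<bullet> R i x j)"
        using pr_inner [of "\<theta> (A i j)" "R i x j"] by (simp add: inner_commute)
    qed
    finally show ?thesis .
  qed
  have "(\<Sum>i\<in>Basis. \<Sum>j\<in>B. \<theta> (A i j) \<bullet> R i x j)
      = (\<Sum>j\<in>B. \<theta> (A z j) \<bullet> R z x j) + (\<Sum>i\<in>B. \<Sum>j\<in>B. \<theta> (A i j) \<bullet> R i x j)"
    unfolding B_def by (rule sum_Basis_z)
  also have "\<dots> = 0"
  proof -
    \<comment> \<open>Since A_z = \<theta>h, the left factor is -hj; \<open>N_eq_R\<close> then
      identifies the product with \<open>N x j \<bullet> h j\<close>.\<close>
    have "\<theta> (A z j) \<bullet> R z x j = 0" if "j \<in> B" for j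
      using N_eq_R [of x j "h j"] N_eq_0 [of j "h j" x] perp [OF that]
      by (simp add: A_1z th_th inner_commute)
    then show ?thesis
      using sum_A_th_R by (simp add: B_def)
  qed
  finally show ?thesis
    unfolding B_def [symmetric] by (simp add: 1 sum_distrib_left [symmetric])
qed

end

section \<open>Transfer to an adapted frame\<close>

context nearly_cosymplectic_domain
begin

section \<open>The bundle orthogonal to \<xi> and its projected connection\<close>

abbreviation FS where "FS \<equiv> Fdist M g \<xi>"
abbreviation sec where "sec \<equiv> smooth_section M FS U"
abbreviation J where "J \<equiv> Jop M g \<theta> \<xi>"
abbreviation nb where "nb \<equiv> nabla_bar g nab \<xi>"

definition PR :: "'a \<Rightarrow> 'a functional \<Rightarrow> 'a functional" where
  "PR p v = v - g p v (\<xi> p) *\<^sub>R \<xi> p"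

lemma FS_iff: "v \<in> FS p \<longleftrightarrow> v \<in> TS p \<and> g p (\<xi> p) v = 0"
  by (simp add: Fdist_def)

lemma sec_iff: "sec Z \<longleftrightarrow> VF Z \<and> (\<forall>p\<in>U. g p (\<xi> p) (Z p) = 0)"
  unfolding smooth_section_def using VF_tangent by (auto simp: FS_iff)

lemma sec_VF: "sec Z \<Longrightarrow> VF Z"
  and sec_perp: "sec Z \<Longrightarrow> p \<in> U \<Longrightarrow> g p (\<xi> p) (Z p) = 0"
  by (simp_all add: sec_iff)

lemma sec_FS: "sec Z \<Longrightarrow> p \<in> U \<Longrightarrow> Z p \<in> FS p"
  by (simp add: FS_iff sec_perp VF_tangent [OF sec_VF])

lemma sec_perp': "sec Z \<Longrightarrow> p \<in> U \<Longrightarrow> g p (Z p) (\<xi> p) = 0"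
  using sec_perp [of Z p] g_sym [of p "Z p" "\<xi> p"] by (simp add: VF_tangent [OF sec_VF] xi_TS)

lemma sec_cong: "sec Z \<Longrightarrow> (\<And>q. q \<in> U \<Longrightarrow> Z q = Z' q) \<Longrightarrow> sec Z'"
  unfolding sec_iff using VF_cong [of Z Z'] by simp

lemma J_eq: "v \<in> FS p \<Longrightarrow> Jtensor M g \<theta> \<xi> p v = \<theta> p v"
  by (simp add: Jtensor_def)

lemma Jop_eq: "sec Z \<Longrightarrow> p \<in> U \<Longrightarrow> J Z p = \<theta> p (Z p)"
  by (simp add: Jop_def J_eq sec_FS)

lemma PR_TS: "p \<in> U \<Longrightarrow> v \<in> TS p \<Longrightarrow> PR p v \<in> TS p"
  by (simp add: PR_def tangent_intros xi_TS)

lemma PR_perp: "p \<in> U \<Longrightarrow> v \<in> TS p \<Longrightarrow> g p (\<xi> p) (PR p v) = 0"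
  using g_sym [of p v "\<xi> p"] by (simp add: PR_def g_simps tangent_intros xi_TS g_xi_xi)

lemma sec_PR: "VF X \<Longrightarrow> sec (\<lambda>q. PR q (X q))"
  by (simp add: sec_iff PR_perp VF_tangent) (simp add: PR_def nc_intros)

lemma sec_Th: "VF X \<Longrightarrow> sec (\<lambda>q. \<theta> q (X q))"
  by (simp add: sec_iff g_xi_th nc_intros)

lemma sec_J: "sec Z \<Longrightarrow> sec (J Z)"
  by (rule sec_cong [OF sec_Th [OF sec_VF]]) (simp_all add: Jop_eq)

lemma sec_h: "VF X \<Longrightarrow> sec (h X)"
  by (simp add: sec_iff nc_intros g_xi_h)

lemma nb_eq_PR: "nb X Z p = PR p (nab X Z p)"
  by (simp add: nabla_bar_def PR_def)

lemma sec_nb: "VF X \<Longrightarrow> VF Z \<Longrightarrow> sec (nb X Z)"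
  by (rule sec_cong [OF sec_PR [OF nab_VF]]) (simp_all add: nb_eq_PR)

text \<open>Differentiating g(Z,\<xi>) = 0 makes the normal component algebraic in Z, so that the
  projection can be iterated.\<close>

lemma nb_eq:
  assumes X: "VF X" and Z: "sec Z" and p: "p \<in> U"
  shows "nb X Z p = nab X Z p + g p (Z p) (h X p) *\<^sub>R \<xi> p"
proof -
  have "dapply (X p) (\<lambda>q. g q (Z q) (\<xi> q)) = dapply (X p) (\<lambda>q. 0)"
    using sec_perp' [OF Z] by (intro VF_deriv_cong [OF X g_SF [OF sec_VF [OF Z] VF_xi] p]) simp
  then have "g p (nab X Z p) (\<xi> p) = - g p (Z p) (h X p)"
    using nab_metric [OF X sec_VF [OF Z] VF_xi p] p by (simp add: VF_deriv_const [OF X])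
  then show ?thesis
    by (simp add: nabla_bar_def)
qed

lemma PR_add: "p \<in> U \<Longrightarrow> u \<in> TS p \<Longrightarrow> v \<in> TS p \<Longrightarrow> PR p (u + v) = PR p u + PR p v"
  by (simp add: PR_def g_simps xi_TS algebra_simps)

lemma PR_diff: "p \<in> U \<Longrightarrow> u \<in> TS p \<Longrightarrow> v \<in> TS p \<Longrightarrow> PR p (u - v) = PR p u - PR p v"
  by (simp add: PR_def g_simps xi_TS algebra_simps)

lemma PR_scale: "p \<in> U \<Longrightarrow> u \<in> TS p \<Longrightarrow> PR p (c *\<^sub>R u) = c *\<^sub>R PR p u"
  by (simp add: PR_def g_simps xi_TS algebra_simps)

lemma PR_xi: "p \<in> U \<Longrightarrow> PR p (\<xi> p) = 0"
  by (simp add: PR_def g_xi_xi)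

lemma PR_perp_eq: "p \<in> U \<Longrightarrow> v \<in> TS p \<Longrightarrow> g p (\<xi> p) v = 0 \<Longrightarrow> PR p v = v"
  using g_sym [of p v "\<xi> p"] by (simp add: PR_def xi_TS)

lemma PR_h: "VF X \<Longrightarrow> p \<in> U \<Longrightarrow> PR p (h X p) = h X p"
  by (simp add: PR_perp_eq nc_intros g_xi_h)

lemma PR_th: "v \<in> TS p \<Longrightarrow> p \<in> U \<Longrightarrow> PR p (\<theta> p v) = \<theta> p v"
  by (simp add: PR_perp_eq nc_intros g_xi_th)

lemmas PR_simps = PR_add PR_diff PR_scale PR_xi PR_h PR_th

lemma th_PR: "p \<in> U \<Longrightarrow> v \<in> TS p \<Longrightarrow> \<theta> p (PR p v) = \<theta> p v"
  by (simp add: PR_def th_simps th_xi nc_intros)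

text \<open>J is unspecified off its bundle, so \<theta> replaces it only where the argument is a
  section; \<open>th_PR\<close> then absorbs the projection under \<theta>.\<close>

lemma cov_J:
  assumes X: "VF X" and Z: "sec Z" and p: "p \<in> U"
  shows "cov_End nb X J Z p = PR p (A X Z p)"
proof -
  have "nab X (J Z) p = nab X (\<lambda>q. \<theta> q (Z q)) p"
    using X Z p by (intro nab_cong2) (simp_all add: nc_intros sec_VF Jop_eq)
  moreover have "J (nb X Z) p = \<theta> p (nab X Z p)"
    using X Z p by (simp add: Jop_eq sec_nb sec_VF nb_eq_PR th_PR nc_intros)
  ultimately show ?thesis
    using X sec_VF [OF Z] p
    by (simp add: cov_End_def nb_eq_PR PR_simps nc_intros)
qed

text \<open>The first h term comes from differentiating the normal part of \<open>A X Z\<close>, the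
  second from the normal part of \<open>nab X Z\<close> through \<open>A_xi\<close>.\<close>

lemma cov2_J:
  assumes X: "VF X" and Z: "sec Z" and p: "p \<in> U"
  shows "cov_End nb X (cov_End nb X J) Z p - cov_End nb (nab X X) J Z p
    = PR p (T X X Z p) + g p (\<theta> p (Z p)) (h X p) *\<^sub>R h X p + g p (Z p) (h X p) *\<^sub>R \<theta> p (h X p)"
proof -
  note VF = X sec_VF [OF Z] nc_intros p
  have "nab X (cov_End nb X J Z) p = nab X (\<lambda>q. A X Z q + g q (\<theta> q (Z q)) (h X q) *\<^sub>R \<xi> q) p"
  proof (rule nab_cong2)
    fix q assume q: "q \<in> U"
    have "g q (A X Z q) (\<xi> q) = - g q (\<theta> q (Z q)) (h X q)"
      using A_skew [OF X sec_VF [OF Z] VF_xi q] q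
      by (simp add: A_xi VF g_simps th_skew)
    then show "cov_End nb X J Z q = A X Z q + g q (\<theta> q (Z q)) (h X q) *\<^sub>R \<xi> q"
      using cov_J [OF X Z q] by (simp add: PR_def)
  qed (simp_all add: VF)
  then have 1: "nb X (cov_End nb X J Z) p = PR p (nab X (A X Z) p) + g p (\<theta> p (Z p)) (h X p) *\<^sub>R h X p"
    by (simp add: nb_eq_PR nab_add2 nab_scale2 PR_simps VF)
  have "A X (nb X Z) p = A X (\<lambda>q. nab X Z q + g q (Z q) (h X q) *\<^sub>R \<xi> q) p"
    by (rule tensorial_cong [OF tensorial_A2 [OF X]]) (simp_all add: VF nb_eq [OF X Z])
  also have "\<dots> = A X (nab X Z) p + g p (Z p) (h X p) *\<^sub>R A X \<xi> p"
    by (simp add: tensorial_add [OF tensorial_A2 [OF X]] tensorial_scale [OF tensorial_A2 [OF X]] VF)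
  also have "\<dots> = A X (nab X Z) p - g p (Z p) (h X p) *\<^sub>R \<theta> p (h X p)"
    by (simp add: A_xi VF)
  finally have 2: "cov_End nb X J (nb X Z) p = PR p (A X (nab X Z) p) - g p (Z p) (h X p) *\<^sub>R \<theta> p (h X p)"
    using cov_J [OF X sec_nb [OF X sec_VF [OF Z]] p] by (simp add: PR_simps VF)
  have 3: "cov_End nb (nab X X) J Z p = PR p (A (nab X X) Z p)"
    by (simp add: cov_J VF Z)
  have "cov_End nb X (cov_End nb X J) Z p = nb X (cov_End nb X J Z) p - cov_End nb X J (nb X Z) p"
    by (simp add: cov_End_def [of nb X "cov_End nb X J"])
  then show ?thesis
    unfolding 1 2 3 cov_bil_def by (simp add: PR_simps VF)
qed

text \<open>Gauss equation of the subbundle, with h in the role of the second fundamental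
  form.\<close>

lemma curvature_nb:
  assumes W: "VF W" and X: "VF X" and Z: "sec Z" and p: "p \<in> U"
  shows "curvature M nb W X Z p
    = PR p (R W X Z p) + g p (Z p) (h X p) *\<^sub>R h W p - g p (Z p) (h W p) *\<^sub>R h X p"
proof -
  have *: "nb W (nb X Z) p = PR p (nab W (nab X Z) p) + g p (Z p) (h X p) *\<^sub>R h W p"
    if W: "VF W" and X: "VF X" for W X
  proof -
    have "nab W (nb X Z) p = nab W (\<lambda>q. nab X Z q + g q (Z q) (h X q) *\<^sub>R \<xi> q) p"
      using W X sec_VF [OF Z] p by (intro nab_cong2) (simp_all add: nc_intros nb_eq Z)
    then show ?thesis
      using W X sec_VF [OF Z] p
      by (simp add: nb_eq_PR nab_add2 nab_scale2 PR_simps nc_intros)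
  qed
  show ?thesis
    using W X sec_VF [OF Z] p * [OF W X] * [OF X W]
    by (simp add: curvature_def nb_eq_PR PR_simps nc_intros)
qed

end

text \<open>Enumerating the basis of the model space by \<open>b\<close> identifies the tangent space at \<open>p\<close> isometrically
  with \<^typ>\<open>'e\<close>, so that tensors at \<open>p\<close> become multilinear maps on a Euclidean space.\<close>

locale nearly_cosymplectic_frame = nearly_cosymplectic_domain M U g nab \<theta> \<xi> \<eta>
  for M :: "('a, 'e::euclidean_space) manifold" and U g nab \<theta> \<xi> \<eta> +
  fixes n :: nat and E :: "nat \<Rightarrow> 'a field" and p :: 'a and b :: "nat \<Rightarrow> 'e"
  assumes frame: "adapted_frame M g \<xi> n U E" and p: "p \<in> U"
    and b: "bij_betw b {..<2 * n + 1} Basis"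
begin

definition idx where "idx = {..<2 * n + 1}"

lemma finite_idx [simp]: "finite idx"
  and idx_last [simp]: "2 * n \<in> idx"
  and idx_F: "i < 2 * n \<Longrightarrow> i \<in> idx"
  by (simp_all add: idx_def)

lemma b_idx: "bij_betw b idx Basis"
  using b by (simp add: idx_def)

lemma frame_unfold:
  "orthonormal_frame M g (tangent_space M) (2 * n + 1) U E" "\<And>p. p \<in> U \<Longrightarrow> E (2 * n) p = \<xi> p"
  "orthonormal_frame M g FS (2 * n) U E"
  using frame unfolding adapted_frame_def by blast+

lemma sec_E: "i < 2 * n \<Longrightarrow> sec (E i)"
  using frame_unfold(3) unfolding orthonormal_frame_def by blast

lemma VF_E: "i \<in> idx \<Longrightarrow> VF (E i)"
  using frame_unfold(1) unfolding orthonormal_frame_def smooth_section_def idx_def by blast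

lemma E_TS: "q \<in> U \<Longrightarrow> i \<in> idx \<Longrightarrow> E i q \<in> TS q"
  by (rule VF_tangent [OF VF_E])

lemma g_E: "q \<in> U \<Longrightarrow> i \<in> idx \<Longrightarrow> j \<in> idx \<Longrightarrow> g q (E i q) (E j q) = (if i = j then 1 else 0)"
  using frame_unfold(1) unfolding orthonormal_frame_def idx_def by blast

lemma E_expand:
  assumes q: "q \<in> U" and v: "v \<in> TS q"
  shows "(\<Sum>i\<in>idx. g q v (E i q) *\<^sub>R E i q) = v"
proof -
  define W where "W = {v \<in> TS q. (\<Sum>i\<in>idx. g q v (E i q) *\<^sub>R E i q) = v}"
  have "subspace W"
    unfolding subspace_def W_def
    by (auto simp: tangent_intros g_simps q E_TS scaleR_add_left sum.distrib
        scaleR_sum_right [symmetric] scaleR_scaleR [symmetric] simp del: scaleR_scaleR)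
  moreover have "(\<lambda>i. E i q) ` idx \<subseteq> W"
  proof
    fix x assume "x \<in> (\<lambda>i. E i q) ` idx"
    then obtain j where j: "j \<in> idx" "x = E j q" by blast
    have "(\<Sum>i\<in>idx. g q (E j q) (E i q) *\<^sub>R E i q) = (\<Sum>i\<in>idx. if i = j then E i q else 0)"
      using q j by (intro sum.cong refl) (simp add: g_E)
    then show "x \<in> W"
      unfolding W_def using j q by (simp add: E_TS)
  qed
  ultimately have "span ((\<lambda>i. E i q) ` idx) \<subseteq> W"
    by (simp add: span_minimal)
  moreover have "span ((\<lambda>i. E i q) ` idx) = TS q"
    using frame_unfold(1) q unfolding orthonormal_frame_def idx_def by blast
  ultimately show ?thesis
    using v unfolding W_def by blast
qed

lemma b_Basis: "i \<in> idx \<Longrightarrow> b i \<in> Basis"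
  using b_idx bij_betwE by blast

lemma b_inner: "i \<in> idx \<Longrightarrow> j \<in> idx \<Longrightarrow> b i \<bullet> b j = (if i = j then 1 else 0)"
  using b_Basis [of i] b_Basis [of j] inj_onD [OF bij_betw_imp_inj_on [OF b_idx], of i j]
  by (auto simp: inner_Basis)

lemma sum_b: "(\<Sum>i\<in>idx. f (b i)) = sum f Basis"
  by (rule sum.reindex_bij_betw [OF b_idx])

lemma b_expand: "(\<Sum>i\<in>idx. (u \<bullet> b i) *\<^sub>R b i) = u"
  using sum_b [of "\<lambda>c. (u \<bullet> c) *\<^sub>R c"] by (simp add: euclidean_representation)

definition crd :: "'a functional \<Rightarrow> 'e" where
  "crd v = (\<Sum>i\<in>idx. g p v (E i p) *\<^sub>R b i)"

text \<open>A field with constant coefficients rather than a vector at p, since the operators take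
  fields as arguments.\<close>

definition emb :: "'e \<Rightarrow> 'a field" where
  "emb u q = (\<Sum>i\<in>idx. (u \<bullet> b i) *\<^sub>R E i q)"

lemma VF_emb: "VF (emb u)"
  unfolding emb_def [abs_def] by (intro VF_sum VF_scale smooth_fun_const VF_E) simp

lemma crd_b: "i \<in> idx \<Longrightarrow> crd v \<bullet> b i = g p v (E i p)"
proof -
  assume i: "i \<in> idx"
  have "crd v \<bullet> b i = (\<Sum>j\<in>idx. g p v (E j p) * (b j \<bullet> b i))"
    by (simp add: crd_def inner_sum_left)
  also have "\<dots> = (\<Sum>j\<in>idx. if j = i then g p v (E j p) else 0)"
    using i by (intro sum.cong refl) (simp add: b_inner)
  finally show ?thesis
    using i by simp
qed

lemma emb_crd: "v \<in> TS p \<Longrightarrow> emb (crd v) p = v"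
  using E_expand [OF p, of v] by (simp add: emb_def crd_b cong: sum.cong_simp)

lemma crd_emb: "crd (emb u p) = u"
proof -
  have "g p (emb u p) (E j p) = u \<bullet> b j" if j: "j \<in> idx" for j
  proof -
    have "g p (emb u p) (E j p) = (\<Sum>i\<in>idx. (u \<bullet> b i) * g p (E i p) (E j p))"
      unfolding emb_def using p j by (subst g_sum_left) (simp_all add: E_TS tangent_intros g_simps)
    also have "\<dots> = (\<Sum>i\<in>idx. if i = j then u \<bullet> b i else 0)"
      using j p by (intro sum.cong refl) (simp add: g_E)
    finally show ?thesis
      using j by simp
  qed
  then show ?thesis
    using b_expand [of u] by (simp add: crd_def cong: sum.cong_simp)
qed

lemma crd_add: "u \<in> TS p \<Longrightarrow> v \<in> TS p \<Longrightarrow> crd (u + v) = crd u + crd v"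
  and crd_scale: "u \<in> TS p \<Longrightarrow> crd (c *\<^sub>R u) = c *\<^sub>R crd u"
  and crd_0: "crd 0 = 0"
  by (simp_all add: crd_def g_simps p E_TS scaleR_add_left sum.distrib scaleR_sum_right)

lemma crd_neg: "u \<in> TS p \<Longrightarrow> crd (- u) = - crd u"
  using crd_scale [of u "- 1"] by simp

lemma crd_diff: "u \<in> TS p \<Longrightarrow> v \<in> TS p \<Longrightarrow> crd (u - v) = crd u - crd v"
  using crd_add [of u "- v"] by (simp add: crd_neg tangent_intros)

lemma crd_sum: "(\<And>i. i \<in> K \<Longrightarrow> v i \<in> TS p) \<Longrightarrow> crd (\<Sum>i\<in>K. v i) = (\<Sum>i\<in>K. crd (v i))"
  by (induction K rule: infinite_finite_induct) (simp_all add: crd_0 crd_add tangent_space_sum)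

lemmas crd_simps = crd_add crd_scale crd_0 crd_neg crd_diff

lemma crd_inner: "u \<in> TS p \<Longrightarrow> v \<in> TS p \<Longrightarrow> crd u \<bullet> crd v = g p u v"
proof -
  assume u: "u \<in> TS p" and v: "v \<in> TS p"
  have "crd u \<bullet> crd v = (\<Sum>i\<in>idx. g p v (E i p) * g p u (E i p))"
    by (subst (2) crd_def) (simp add: inner_sum_right crd_b cong: sum.cong_simp)
  also have "\<dots> = g p u (\<Sum>i\<in>idx. g p v (E i p) *\<^sub>R E i p)"
    using p u by (subst g_sum_right) (simp_all add: E_TS tangent_intros g_simps)
  finally show ?thesis
    using E_expand [OF p v] by simp
qed

lemma crd_eqD: "u \<in> TS p \<Longrightarrow> v \<in> TS p \<Longrightarrow> crd u = crd v \<Longrightarrow> u = v"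
  using emb_crd by metis

lemma crd_E: "i \<in> idx \<Longrightarrow> crd (E i p) = b i"
proof -
  assume i: "i \<in> idx"
  have "crd (E i p) = (\<Sum>j\<in>idx. if j = i then b j else 0)"
    unfolding crd_def using i p by (intro sum.cong refl) (simp add: g_E)
  then show ?thesis
    using i by simp
qed

text \<open>The frame expands X on all of U with smooth coefficients, which can be pulled out of the
  operator. Hence its value at p depends on X only through the value of X at p.\<close>

lemma tensorial_expand:
  assumes H: "tensorial H" and X: "VF X"
  shows "H X p = (\<Sum>i\<in>idx. g p (X p) (E i p) *\<^sub>R H (E i) p)"
proof -
  have "H X p = H (\<lambda>q. \<Sum>i\<in>idx. g q (X q) (E i q) *\<^sub>R E i q) p"
    by (rule tensorial_cong [OF H _ p])
      (simp_all add: E_expand VF_tangent X VF_sum VF_scale g_SF VF_E)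
  also have "\<dots> = (\<Sum>i\<in>idx. H (\<lambda>q. g q (X q) (E i q) *\<^sub>R E i q) p)"
    by (rule tensorial_sum [OF H p]) (simp add: VF_scale g_SF VF_E X)
  also have "\<dots> = (\<Sum>i\<in>idx. g p (X p) (E i p) *\<^sub>R H (E i) p)"
    by (intro sum.cong refl tensorial_scale [OF H] g_SF X VF_E p) auto
  finally show ?thesis .
qed

lemma tensorial_emb_crd:
  assumes H: "tensorial H" and X: "VF X"
  shows "H (emb (crd (X p))) p = H X p"
  unfolding tensorial_expand [OF H X] tensorial_expand [OF H VF_emb]
  by (simp add: emb_crd VF_tangent X p)

lemma linear_crd_tensorial:
  assumes H: "tensorial H"
  shows "linear (\<lambda>u. crd (H (emb u) p))"
proof (rule linearI)
  have TS: "H (emb u) p \<in> TS p" for u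
    by (rule VF_tangent [OF tensorial_VF [OF H VF_emb] p])
  have "emb (u + v) = (\<lambda>q. emb u q + emb v q)" for u v
    by (intro ext) (simp add: emb_def inner_add_left scaleR_add_left sum.distrib)
  then show "crd (H (emb (u + v)) p) = crd (H (emb u) p) + crd (H (emb v) p)" for u v
    using tensorial_add [OF H VF_emb VF_emb p, of u v] by (simp add: crd_add TS)
  have "emb (c *\<^sub>R u) = (\<lambda>q. c *\<^sub>R emb u q)" for c u
    by (intro ext) (simp add: emb_def scaleR_sum_right)
  then show "crd (H (emb (c *\<^sub>R u)) p) = c *\<^sub>R crd (H (emb u) p)" for c u
    using tensorial_scale [OF H smooth_fun_const VF_emb p, of c u] by (simp add: crd_scale TS)
qed

definition zc where "zc = crd (\<xi> p)"
definition thc where "thc u = crd (\<theta> p (emb u p))"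
definition hc where "hc u = crd (h (emb u) p)"
definition Ac where "Ac u v = crd (A (emb u) (emb v) p)"
definition Nc where "Nc u v = crd (N (emb u) (emb v) p)"
definition Rc where "Rc u v w = crd (R (emb u) (emb v) (emb w) p)"
definition Tc where "Tc u v w = crd (T (emb u) (emb v) (emb w) p)"

lemma T_VF: "VF W \<Longrightarrow> VF X \<Longrightarrow> VF Y \<Longrightarrow> VF (T W X Y)"
  by (rule tensorial_VF [OF tensorial_T3])

lemmas all_intros = nc_intros R_VF T_VF VF_emb p

lemma crd_th: "v \<in> TS p \<Longrightarrow> crd (\<theta> p v) = thc (crd v)"
  by (simp add: thc_def emb_crd)

lemma crd_h: "VF X \<Longrightarrow> crd (h X p) = hc (crd (X p))"
  by (simp add: hc_def tensorial_emb_crd [OF tensorial_h])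

lemma crd_A: "VF X \<Longrightarrow> VF Y \<Longrightarrow> crd (A X Y p) = Ac (crd (X p)) (crd (Y p))"
  using tensorial_emb_crd [OF tensorial_A1 [of Y], of X]
    tensorial_emb_crd [OF tensorial_A2 [of "emb (crd (X p))"], of Y]
  by (simp add: Ac_def VF_emb)

lemma crd_N: "VF X \<Longrightarrow> VF Y \<Longrightarrow> crd (N X Y p) = Nc (crd (X p)) (crd (Y p))"
  using tensorial_emb_crd [OF tensorial_N1 [of Y], of X]
    tensorial_emb_crd [OF tensorial_N2 [of "emb (crd (X p))"], of Y]
  by (simp add: Nc_def VF_emb)

lemma crd_R: "VF X \<Longrightarrow> VF Y \<Longrightarrow> VF Z \<Longrightarrow> crd (R X Y Z p) = Rc (crd (X p)) (crd (Y p)) (crd (Z p))"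
  using tensorial_emb_crd [OF tensorial_R1 [of Y Z], of X]
    tensorial_emb_crd [OF tensorial_R2 [of "emb (crd (X p))" Z], of Y]
    tensorial_emb_crd [OF tensorial_R3 [of "emb (crd (X p))" "emb (crd (Y p))"], of Z]
  by (simp add: Rc_def VF_emb)

lemma crd_T: "VF X \<Longrightarrow> VF Y \<Longrightarrow> VF Z \<Longrightarrow> crd (T X Y Z p) = Tc (crd (X p)) (crd (Y p)) (crd (Z p))"
  using tensorial_emb_crd [OF tensorial_T1 [of Y Z], of X]
    tensorial_emb_crd [OF tensorial_T2 [of "emb (crd (X p))" Z], of Y]
    tensorial_emb_crd [OF tensorial_T3 [of "emb (crd (X p))" "emb (crd (Y p))"], of Z]
  by (simp add: Tc_def VF_emb)

lemmas crd_tensors = crd_th crd_h crd_A crd_N crd_R crd_T crd_emb zc_def [symmetric]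

lemma zc_b: "zc = b (2 * n)"
  using crd_E [of "2 * n"] frame_unfold(2) [OF p] by (simp add: zc_def)

sublocale t: nc_tensors zc thc hc Ac Nc Rc Tc
proof (rule nc_tensors.intro)
  show "zc \<in> Basis"
    by (simp add: zc_b b_Basis)
  show "linear thc"
    using linear_crd_tensorial [OF tensorial_Th] by (simp add: thc_def [abs_def])
  show "linear hc"
    using linear_crd_tensorial [OF tensorial_h] by (simp add: hc_def [abs_def])
  show "linear (Ac u)" for u
    using linear_crd_tensorial [OF tensorial_A2 [OF VF_emb]] by (simp add: Ac_def [abs_def])
  show "linear (\<lambda>u. Nc u v)" "linear (Nc v)" for v
    using linear_crd_tensorial [OF tensorial_N1 [OF VF_emb]] linear_crd_tensorial [OF tensorial_N2 [OF VF_emb]]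
    by (simp_all add: Nc_def [abs_def])
  show "linear (\<lambda>u. Rc u v w)" "linear (Rc v w)" for v w
    using linear_crd_tensorial [OF tensorial_R1 [OF VF_emb VF_emb]] linear_crd_tensorial [OF tensorial_R3 [OF VF_emb VF_emb]]
    by (simp_all add: Rc_def [abs_def])
  show "linear (\<lambda>u. Tc u v w)" "linear (Tc v w)" for v w
    using linear_crd_tensorial [OF tensorial_T1 [OF _ _ VF_emb VF_emb]] linear_crd_tensorial [OF tensorial_T3 [OF _ _ VF_emb VF_emb]]
    by (simp_all add: Tc_def [abs_def])
  show "thc zc = 0"
    using arg_cong [OF th_xi [OF p], of crd] by (simp add: crd_tensors crd_simps all_intros)
  show "hc zc = 0"
    using arg_cong [OF h_xi [OF p], of crd] by (simp add: crd_tensors crd_simps all_intros)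
  fix u v w x :: 'e
  let ?u = "emb u" and ?v = "emb v" and ?w = "emb w" and ?x = "emb x"
  \<comment> \<open>Each axiom is the corresponding identity of fields, applied to
    constant-coefficient extensions, evaluated at p and written in coordinates.\<close>
  note s = crd_inner [symmetric] crd_tensors crd_simps all_intros
  show "thc u \<bullet> v = - (u \<bullet> thc v)"
    using th_skew [OF p, of "?u p" "?v p"] by (simp add: s)
  show "hc u \<bullet> v = - (u \<bullet> hc v)"
    using h_skew [of ?u ?v p] by (simp add: s)
  show "thc (thc u) = - u + (zc \<bullet> u) *\<^sub>R zc"
    using arg_cong [OF th_th [OF p, of "?u p"], of crd] by (simp add: s)
  show "thc (hc u) = - hc (thc u)"
    using arg_cong [OF th_h [of ?u p], of crd] by (simp add: s)
  show "Ac u v = - Ac v u"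
    using arg_cong [OF A_alt [of ?u ?v p], of crd] by (simp add: s)
  show "Ac u v \<bullet> w = - (v \<bullet> Ac u w)"
    using A_skew [of ?u ?v ?w p] by (simp add: s)
  show "Ac u zc = - thc (hc u)"
    using arg_cong [OF A_xi [of ?u p], of crd] by (simp add: s)
  show "Ac u (thc v) + thc (Ac u v) = (hc u \<bullet> v) *\<^sub>R zc + (v \<bullet> zc) *\<^sub>R hc u"
    using arg_cong [OF A_Th [of ?u ?v p], of crd] by (simp add: s)
  show "Nc u zc = - hc (hc u)"
    using arg_cong [OF N_xi [of ?u p], of crd] by (simp add: s)
  show "Nc u v \<bullet> w = - (v \<bullet> Nc u w)"
    using N_skew [of ?u ?v ?w p] by (simp add: s)
  show "Rc u v w = - Rc v u w"
    using arg_cong [OF R_alt [of ?u ?v ?w p], of crd] by (simp add: s)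
  show "Rc u v w \<bullet> x = - (w \<bullet> Rc u v x)"
    using R_skew [of ?u ?v ?w ?x p] by (simp add: s)
  show "Rc u v w + Rc v w u + Rc w u v = 0"
    using arg_cong [OF R_bianchi [of ?u ?v ?w p], of crd] by (simp add: s)
  show "Rc u v zc = Nc u v - Nc v u"
    using arg_cong [OF R_xi [of ?u ?v p], of crd] by (simp add: s)
  show "Tc w u v - Tc u w v = Rc w u (thc v) - thc (Rc w u v)"
    using arg_cong [OF T_ricci [of ?w ?u ?v p], of crd] by (simp add: s)
  show "Tc w u v = - Tc w v u"
    using arg_cong [OF T_alt [of ?w ?u ?v p], of crd] by (simp add: s)
  show "Tc w u v \<bullet> x = - (v \<bullet> Tc w u x)"
    using T_skew [of ?w ?u ?v ?x p] by (simp add: s)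
  show "Tc w u (thc v) + thc (Tc w u v) + Ac u (Ac w v) + Ac w (Ac u v)
      = (Nc w u \<bullet> v) *\<^sub>R zc + (hc u \<bullet> v) *\<^sub>R hc w + (hc w \<bullet> v) *\<^sub>R hc u + (v \<bullet> zc) *\<^sub>R Nc w u"
    using arg_cong [OF T_Th [of ?w ?u ?v p], of crd] by (simp add: s)
  show "Tc w u zc = - Ac w (hc u) - Ac u (hc w) - thc (Nc w u)"
    using arg_cong [OF T_xi [of ?w ?u p], of crd] by (simp add: s)
qed

end

context nearly_cosymplectic_frame
begin

section \<open>The three equations at a point\<close>

lemma crd_PR: "v \<in> TS p \<Longrightarrow> crd (PR p v) = t.pr (crd v)"
  by (simp add: PR_def t.pr_def crd_simps crd_inner [symmetric] zc_def [symmetric] all_intros)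

lemma sum_crd_E: "(\<Sum>i\<in>idx. f (crd (E i p))) = sum f Basis"
  using sum_b [of f] by (simp add: crd_E cong: sum.cong_simp)

text \<open>The index 2n carries \<xi>, so leaving it out removes \<open>zc\<close> from the
  basis.\<close>

lemma sum_crd_F: "(\<Sum>j<2 * n. f (crd (E j p))) = (\<Sum>c\<in>Basis - {zc}. f c)"
proof -
  have "inj_on b idx"
    by (rule bij_betw_imp_inj_on [OF b_idx])
  then have "b ` (idx - {2 * n}) = Basis - {zc}"
    using b_idx by (simp add: inj_on_image_set_diff [where C = idx] bij_betw_imp_surj_on zc_b)
  moreover have "idx - {2 * n} = {..<2 * n}"
    unfolding idx_def by auto
  ultimately have "bij_betw b {..<2 * n} (Basis - {zc})"
    using inj_on_subset [OF \<open>inj_on b idx\<close>, of "{..<2 * n}"] idx_F by (auto simp: bij_betw_def)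
  from sum.reindex_bij_betw [OF this, of f] show ?thesis
    by (simp add: crd_E idx_F)
qed

lemma FS_sum: "(\<And>i. i \<in> K \<Longrightarrow> v i \<in> FS p) \<Longrightarrow> sum v K \<in> FS p"
  by (simp add: FS_iff tangent_space_sum g_sum_right p xi_TS)

lemma FS_neg: "v \<in> FS p \<Longrightarrow> - v \<in> FS p"
  by (simp add: FS_iff g_simps all_intros)

lemma first_eq:
  assumes Z: "sec Z"
  shows "op_commutator (rough_laplacian_End nab nb n E J) J Z p = 0"
proof -
  define L where "L = rough_laplacian_End nab nb n E J"
  define S where "S Z i = PR p (T (E i) (E i) Z p) + g p (\<theta> p (Z p)) (h (E i) p) *\<^sub>R h (E i) p
      + g p (Z p) (h (E i) p) *\<^sub>R \<theta> p (h (E i) p)" for Z i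
  have L: "L Z p = - sum (S Z) idx" if Z: "sec Z" for Z
    unfolding L_def rough_laplacian_End_def idx_def [symmetric]
    by (intro arg_cong [of _ _ uminus] sum.cong refl) (simp add: S_def cov2_J VF_E Z p)
  have S: "S Z i \<in> FS p" if "sec Z" "i \<in> idx" for Z i
    using that by (simp add: S_def FS_iff g_simps all_intros PR_TS PR_perp g_xi_h g_xi_th VF_E sec_VF)
  have L_FS: "L Z p \<in> FS p" if "sec Z" for Z
    using S that by (simp add: L FS_neg FS_sum)
  have S_crd: "crd (S Z i) = t.pr (Tc (crd (E i p)) (crd (E i p)) (crd (Z p)))
      + (thc (crd (Z p)) \<bullet> hc (crd (E i p))) *\<^sub>R hc (crd (E i p))
      + (crd (Z p) \<bullet> hc (crd (E i p))) *\<^sub>R thc (hc (crd (E i p)))" if "sec Z" "i \<in> idx" for Z i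
    using that
    by (simp add: S_def crd_simps crd_tensors crd_PR crd_inner [symmetric] all_intros PR_TS VF_E sec_VF)
  define Lc where "Lc y = (\<Sum>c\<in>Basis. t.pr (Tc c c y) + (thc y \<bullet> hc c) *\<^sub>R hc c + (y \<bullet> hc c) *\<^sub>R thc (hc c))" for y
  have L_crd: "crd (L Z p) = - Lc (crd (Z p))" if Z: "sec Z" for Z
  proof -
    have TS: "S Z i \<in> TS p" if "i \<in> idx" for i
      using S [OF Z that] by (simp add: FS_iff)
    then have "crd (L Z p) = - (\<Sum>i\<in>idx. crd (S Z i))"
      by (simp add: L [OF Z] crd_neg tangent_space_sum crd_sum)
    also have "\<dots> = - Lc (crd (Z p))"
      unfolding Lc_def sum_crd_E [symmetric] using S_crd [OF Z] by simp
    finally show ?thesis .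
  qed
  \<comment> \<open>J reads only the value at p, so it is enough that this value lies in the fibre
    of the bundle.\<close>
  have "J (L Z) p = \<theta> p (L Z p)"
    using L_FS [OF Z] by (simp add: Jop_def J_eq)
  moreover have "L (J Z) p = \<theta> p (L Z p)"
  proof (rule crd_eqD)
    have "zc \<bullet> crd (Z p) = 0"
      using sec_perp [OF Z p] by (simp add: zc_def crd_inner all_intros sec_VF Z)
    then have "Lc (thc (crd (Z p))) = thc (Lc (crd (Z p)))"
      unfolding Lc_def by (rule t.laplacian_J_commutes)
    moreover have "crd (J Z p) = thc (crd (Z p))"
      using Z by (simp add: Jop_eq p crd_th all_intros sec_VF)
    ultimately show "crd (L (J Z) p) = crd (\<theta> p (L Z p))"
      using L_FS [OF Z] by (simp add: L_crd sec_J Z crd_th FS_iff)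
  qed (use L_FS [OF Z] L_FS [OF sec_J [OF Z]] in \<open>simp_all add: FS_iff all_intros\<close>)
  ultimately show ?thesis
    by (simp add: op_commutator_def L_def)
qed

text \<open>The argument of J is zero by \<open>t.sum_A_h\<close>, and the Laplacian of \<xi> is
  minus the trace of N, evaluated in \<open>t.sum_N\<close>.\<close>

lemma second_eq:
  "rough_laplacian nab n E \<xi> p =
     (\<Sum>i<2 * n + 1. g p (nab (E i) \<xi> p) (nab (E i) \<xi> p)) *\<^sub>R \<xi> p
     - (1 / 2) *\<^sub>R Jtensor M g \<theta> \<xi> p (\<Sum>i<2 * n + 1. cov_End nb (E i) J (nab (E i) \<xi>) p)"
  unfolding idx_def [symmetric]
proof -
  have "(\<Sum>i\<in>idx. cov_End nb (E i) J (h (E i)) p) = (\<Sum>i\<in>idx. PR p (A (E i) (h (E i)) p))"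
    by (intro sum.cong refl cov_J sec_h VF_E p)
  also have "\<dots> = 0"
  proof (rule crd_eqD)
    have "crd (\<Sum>i\<in>idx. PR p (A (E i) (h (E i)) p))
        = (\<Sum>i\<in>idx. t.pr (Ac (crd (E i p)) (hc (crd (E i p)))))"
      by (simp add: crd_sum crd_PR crd_A crd_h all_intros PR_TS VF_E)
    also have "\<dots> = 0"
      by (simp add: sum_crd_E [of "\<lambda>c. t.pr (Ac c (hc c))"] t.sum_A_h)
    finally show "crd (\<Sum>i\<in>idx. PR p (A (E i) (h (E i)) p)) = crd 0"
      by (simp add: crd_0)
  qed (simp_all add: tangent_space_sum PR_TS all_intros VF_E)
  finally have 1: "Jtensor M g \<theta> \<xi> p (\<Sum>i\<in>idx. cov_End nb (E i) J (h (E i)) p) = 0"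
    by (simp add: J_eq FS_iff th_0 g_0_right all_intros)
  have "rough_laplacian nab n E \<xi> p = - (\<Sum>i\<in>idx. N (E i) (E i) p)"
    unfolding rough_laplacian_def idx_def [symmetric] by (simp add: cov_End_def)
  also have "\<dots> = (\<Sum>i\<in>idx. g p (h (E i) p) (h (E i) p)) *\<^sub>R \<xi> p"
  proof (rule crd_eqD)
    have "crd (- (\<Sum>i\<in>idx. N (E i) (E i) p)) = - (\<Sum>i\<in>idx. Nc (crd (E i p)) (crd (E i p)))"
      by (simp add: crd_neg crd_sum crd_N tangent_space_sum all_intros VF_E)
    also have "\<dots> = (\<Sum>i\<in>idx. hc (crd (E i p)) \<bullet> hc (crd (E i p))) *\<^sub>R zc"
      using t.sum_N sum_crd_E [of "\<lambda>c. Nc c c"] sum_crd_E [of "\<lambda>c. hc c \<bullet> hc c"] by simp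
    also have "\<dots> = crd ((\<Sum>i\<in>idx. g p (h (E i) p) (h (E i) p)) *\<^sub>R \<xi> p)"
      by (simp add: crd_scale zc_def crd_inner [symmetric] crd_h all_intros VF_E)
    finally show "crd (- (\<Sum>i\<in>idx. N (E i) (E i) p)) = crd ((\<Sum>i\<in>idx. g p (h (E i) p) (h (E i) p)) *\<^sub>R \<xi> p)" .
  qed (simp_all add: tangent_space_sum all_intros VF_E)
  finally show "rough_laplacian nab n E \<xi> p =
     (\<Sum>i\<in>idx. g p (nab (E i) \<xi> p) (nab (E i) \<xi> p)) *\<^sub>R \<xi> p
     - (1 / 2) *\<^sub>R Jtensor M g \<theta> \<xi> p (\<Sum>i\<in>idx. cov_End nb (E i) J (nab (E i) \<xi>) p)"
    by (simp add: 1)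
qed

lemma harmonic_map_eq_at:
  assumes X: "VF X"
  shows "(\<Sum>i<2 * n + 1. inner_End g n E (cov_End nb (E i) J) (op_commutator (curvature M nb (E i) X) J) p)
    + 8 * (\<Sum>i<2 * n + 1. g p (nab (E i) \<xi> p) (curvature M nab (E i) X \<xi> p)) = 0"
  unfolding idx_def [symmetric]
proof -
  define x where "x = crd (X p)"
  define Rb where "Rb u y = t.pr (Rc u x y) + (y \<bullet> hc x) *\<^sub>R hc u - (y \<bullet> hc u) *\<^sub>R hc x" for u y
  have R: "curvature M nb W X Z p \<in> FS p \<and> crd (curvature M nb W X Z p) = Rb (crd (W p)) (crd (Z p))"
    if "VF W" "sec Z" for W Z
    using that X
    by (simp add: curvature_nb p FS_iff g_simps PR_TS PR_perp g_xi_h all_intros sec_VF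
        crd_simps crd_tensors crd_PR crd_inner [symmetric] Rb_def x_def)
  have com: "op_commutator (curvature M nb W X) J Z p \<in> TS p \<and> crd (op_commutator (curvature M nb W X) J Z p)
      = Rb (crd (W p)) (thc (crd (Z p))) - thc (Rb (crd (W p)) (crd (Z p)))"
    if W: "VF W" and Z: "sec Z" for W Z
  proof -
    have "crd (J Z p) = thc (crd (Z p))"
      using Z by (simp add: Jop_eq p crd_th all_intros sec_VF)
    moreover have "J (curvature M nb W X Z) p = \<theta> p (curvature M nb W X Z p)"
      using R [OF W Z] by (simp add: Jop_def J_eq)
    ultimately show ?thesis
      using R [OF W Z] R [OF W sec_J [OF Z]]
      by (simp add: op_commutator_def crd_simps crd_th FS_iff all_intros)
  qed
  have "inner_End g n E (cov_End nb (E i) J) (op_commutator (curvature M nb (E i) X) J) p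
      = (\<Sum>c\<in>Basis - {zc}. t.pr (Ac (crd (E i p)) c) \<bullet> (Rb (crd (E i p)) (thc c) - thc (Rb (crd (E i p)) c)))"
    if i: "i \<in> idx" for i
    unfolding inner_End_def sum_crd_F [symmetric]
  proof (intro sum.cong refl)
    fix j assume "j \<in> {..<2 * n}"
    then have j: "sec (E j)"
      by (simp add: sec_E)
    have "cov_End nb (E i) J (E j) p = PR p (A (E i) (E j) p)"
      using i j by (simp add: cov_J VF_E p)
    then show "g p (cov_End nb (E i) J (E j) p) (op_commutator (curvature M nb (E i) X) J (E j) p)
        = t.pr (Ac (crd (E i p)) (crd (E j p)))
          \<bullet> (Rb (crd (E i p)) (thc (crd (E j p))) - thc (Rb (crd (E i p)) (crd (E j p))))"
      using com [OF VF_E [OF i] j] i sec_VF [OF j]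
      by (simp add: crd_inner [symmetric] PR_TS crd_PR crd_A all_intros VF_E)
  qed
  then have "(\<Sum>i\<in>idx. inner_End g n E (cov_End nb (E i) J) (op_commutator (curvature M nb (E i) X) J) p)
      = (\<Sum>i\<in>idx. \<Sum>c\<in>Basis - {zc}. t.pr (Ac (crd (E i p)) c) \<bullet> (Rb (crd (E i p)) (thc c) - thc (Rb (crd (E i p)) c)))"
    by simp
  also have "\<dots> = 0"
    unfolding sum_crd_E [of "\<lambda>u. \<Sum>c\<in>Basis - {zc}. t.pr (Ac u c) \<bullet> (Rb u (thc c) - thc (Rb u c))"]
    unfolding Rb_def by (rule t.harmonic_map_first_term)
  finally have 1: "(\<Sum>i\<in>idx. inner_End g n E (cov_End nb (E i) J) (op_commutator (curvature M nb (E i) X) J) p) = 0" .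
  have "g p (h (E i) p) (R (E i) X \<xi> p) = 0" if i: "i \<in> idx" for i
    using t.h_inner_R_z [OF b_Basis [OF i], of x] i X
    by (simp add: crd_inner [symmetric] crd_tensors crd_E all_intros VF_E x_def)
  with 1 show "(\<Sum>i\<in>idx. inner_End g n E (cov_End nb (E i) J) (op_commutator (curvature M nb (E i) X) J) p)
    + 8 * (\<Sum>i\<in>idx. g p (nab (E i) \<xi> p) (curvature M nab (E i) X \<xi> p)) = 0"
    by simp
qed

end

theorem mainTheorem1:
  fixes M :: "('a, 'e::euclidean_space) manifold"
    and g :: "'a \<Rightarrow> 'a functional \<Rightarrow> 'a functional \<Rightarrow> real"
    and nab :: "'a field \<Rightarrow> 'a field \<Rightarrow> 'a field"
    and \<theta> :: "'a \<Rightarrow> 'a functional \<Rightarrow> 'a functional"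
    and \<xi> :: "'a field"
    and \<eta> :: "'a \<Rightarrow> 'a functional \<Rightarrow> real"
    and n :: nat
  assumes "smooth_manifold M"
    and "DIM('e) = 2 * n + 1"
    and "riemannian_metric M g"
    and "levi_civita M g nab"
    and "nearly_cosymplectic M g nab \<theta> \<xi> \<eta>"
  shows "defines_harmonic_map M g nab \<theta> \<xi> n \<and> defines_harmonic_section M g nab \<theta> \<xi> n"
proof -
  \<comment> \<open>The dimension hypothesis enters here: the basis of the model space has as many
    elements as an adapted frame.\<close>
  obtain b :: "nat \<Rightarrow> 'e" where b: "bij_betw b {..<2 * n + 1} Basis"
    using ex_bij_betw_nat_finite [of "Basis :: 'e set"] assms(2) by (auto simp: atLeast0LessThan)
  have *: "nearly_cosymplectic_frame M U g nab \<theta> \<xi> \<eta> n E p b"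
    if "openin (mtop M) U" "adapted_frame M g \<xi> n U E" "p \<in> U" for U E p
    using that assms b by unfold_locales
  have "first_harmonic_section_eq M g nab \<theta> \<xi> n"
    unfolding first_harmonic_section_eq_def
    using nearly_cosymplectic_frame.first_eq [OF *] by blast
  moreover have "second_harmonic_section_eq M g nab \<theta> \<xi> n"
    unfolding second_harmonic_section_eq_def
    using nearly_cosymplectic_frame.second_eq [OF *] by blast
  moreover have "harmonic_map_eq M g nab \<theta> \<xi> n"
    unfolding harmonic_map_eq_def
    using nearly_cosymplectic_frame.harmonic_map_eq_at [OF *] by blast
  ultimately show ?thesis
    by (simp add: defines_harmonic_map_def defines_harmonic_section_def)
qed

end
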